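(* Let $x\subseteq\omega$ be ITTM-recognizable. Then either $x$ is ITTM-computable, or $0'_{\mathrm{ITTM}}$ is ITTM-computable from $x$.
   Context: ITTMs are Hamkins–Lewis Infinite Time Turing Machines, possibly with an oracle. A real $x$ is ITTM-computable from $y$ if some ITTM-program in oracle $y$ halts with $x$ on the output tape; ITTM-computable means computable from $\emptyset$. $0'_{\mathrm{ITTM}}=\{i\in\omega: P_i(0)\text{ halts}\}$ is the ITTM halting set for a fixed natural enumeration $(P_i)$ of ITTM-programs. $\delta(a,x)=1$ if $a=x$, else $0$. A real $x$ is ITTM-recognizable if there is an ITTM-program $P$ with $P^{z}\downarrow=\delta(z,x)$ for every $z\subseteq\omega$. *)

theory Defs
  imports Main "HOL-Library.Nat_Bijection"
begin

text \<open>Reals are subsets of omega, i.e. values of type nat set.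
  A machine has a read-only oracle tape (holding the oracle real) and the three
  standard Hamkins--Lewis tapes (input, scratch, output), each with cells indexed
  by nat.  Special states: 0 = start, 1 = halt, 2 = limit state.\<close>

record cfg =
  st   :: nat
  hd   :: nat
  tin  :: "nat \<Rightarrow> bool"
  tsc  :: "nat \<Rightarrow> bool"
  tout :: "nat \<Rightarrow> bool"

text \<open>An instruction (q, r, q', w, m): in state q, reading the symbol combination
  coded by r (oracle + 2*input + 4*scratch + 8*output), go to state q', write the
  bits of w (bit 0 input, bit 1 scratch, bit 2 output) and move left if m = 0,
  right otherwise.  A program is a finite list of instructions; the first matching
  instruction is used; if none matches, the machine halts.\<close>

type_synonym instr = "nat \<times> nat \<times> nat \<times> nat \<times> nat"
type_synonym prog = "instr list"

definition init_cfg :: "nat set \<Rightarrow> cfg" where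
  "init_cfg z = \<lparr>st = 0, hd = 0, tin = (\<lambda>n. n \<in> z), tsc = (\<lambda>_. False), tout = (\<lambda>_. False)\<rparr>"

definition readcode :: "nat set \<Rightarrow> cfg \<Rightarrow> nat" where
  "readcode y c = (if hd c \<in> y then 1 else 0) + (if tin c (hd c) then 2 else 0)
      + (if tsc c (hd c) then 4 else 0) + (if tout c (hd c) then 8 else 0)"

definition step :: "prog \<Rightarrow> nat set \<Rightarrow> cfg \<Rightarrow> cfg" where
  "step p y c = (if st c = 1 then c else
     (case find (\<lambda>(q, r, _). q = st c \<and> r = readcode y c) p of
        None \<Rightarrow> c\<lparr>st := 1\<rparr>
      | Some (_, _, q', w, m) \<Rightarrow>
          c\<lparr>st := q',
            tin := (tin c)(hd c := odd w),
            tsc := (tsc c)(hd c := odd (w div 2)),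
            tout := (tout c)(hd c := odd (w div 4)),
            hd := (if m = 0 then hd c - 1 else Suc (hd c))\<rparr>))"

definition limsup_cell :: "'a rel \<Rightarrow> 'a \<Rightarrow> ('a \<Rightarrow> bool) \<Rightarrow> bool" where
  "limsup_cell r a v \<longleftrightarrow> (\<forall>b\<in>underS r a. \<exists>d\<in>underS r a. (b, d) \<in> r \<and> v d)"

definition lim_cfg :: "'a rel \<Rightarrow> ('a \<Rightarrow> cfg) \<Rightarrow> 'a \<Rightarrow> cfg" where
  "lim_cfg r c a = \<lparr>st = 2, hd = 0,
      tin = (\<lambda>n. limsup_cell r a (\<lambda>d. tin (c d) n)),
      tsc = (\<lambda>n. limsup_cell r a (\<lambda>d. tsc (c d) n)),
      tout = (\<lambda>n. limsup_cell r a (\<lambda>d. tout (c d) n))\<rparr>"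

definition is_run :: "prog \<Rightarrow> nat set \<Rightarrow> nat set \<Rightarrow> 'a rel \<Rightarrow> ('a \<Rightarrow> cfg) \<Rightarrow> bool" where
  "is_run p y z r c \<longleftrightarrow> Well_order r \<and> Field r \<noteq> {} \<and>
     (\<forall>a\<in>Field r.
        (underS r a = {} \<longrightarrow> c a = init_cfg z) \<and>
        (\<forall>b\<in>underS r a. (\<forall>d\<in>underS r a. (d, b) \<in> r) \<longrightarrow> c a = step p y (c b)) \<and>
        (underS r a \<noteq> {} \<and> (\<forall>b\<in>underS r a. \<exists>d\<in>underS r a. (b, d) \<in> r \<and> d \<noteq> b)
            \<longrightarrow> c a = lim_cfg r c a))"

text \<open>p with oracle y on input z halts with output x: there is a run along a
  well-order with a last element at which the machine is (for the first time) in
  the halting state, and the output tape then contains x.  Run lengths are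
  well-orders on subsets of the type nat set (this covers all countable ordinals,
  in fact all ordinals below (2^aleph_0)^+).\<close>

definition halts_with :: "prog \<Rightarrow> nat set \<Rightarrow> nat set \<Rightarrow> nat set \<Rightarrow> bool" where
  "halts_with p y z x \<longleftrightarrow> (\<exists>(r :: nat set rel) c t.
     is_run p y z r c \<and> t \<in> Field r \<and> (\<forall>a\<in>Field r. (a, t) \<in> r) \<and>
     st (c t) = 1 \<and> (\<forall>a\<in>underS r t. st (c a) \<noteq> 1) \<and>
     {n. tout (c t) n} = x)"

definition halts :: "prog \<Rightarrow> nat set \<Rightarrow> nat set \<Rightarrow> bool" where
  "halts p y z \<longleftrightarrow> (\<exists>x. halts_with p y z x)"

definition decode_instr :: "nat \<Rightarrow> instr" where
  "decode_instr n = (case prod_decode n of (q, n1) \<Rightarrow>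
     (case prod_decode n1 of (r, n2) \<Rightarrow>
       (case prod_decode n2 of (q', n3) \<Rightarrow>
         (case prod_decode n3 of (w, m) \<Rightarrow> (q, r, q', w, m)))))"

definition P :: "nat \<Rightarrow> prog" where
  "P i = map decode_instr (list_decode i)"

text \<open>Natural numbers 0/1 as outputs are coded as the reals {} and {0}.\<close>

definition delta :: "nat set \<Rightarrow> nat set \<Rightarrow> nat set" where
  "delta a x = (if a = x then {0} else {})"

definition ittm_computable_from :: "nat set \<Rightarrow> nat set \<Rightarrow> bool" where
  "ittm_computable_from x y \<longleftrightarrow> (\<exists>i. halts_with (P i) y {} x)"

definition ittm_computable :: "nat set \<Rightarrow> bool" where
  "ittm_computable x \<longleftrightarrow> ittm_computable_from x {}"

definition ittm_halting_set :: "nat set" where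
  "ittm_halting_set = {i. halts (P i) {} {}}"

definition ittm_recognizable :: "nat set \<Rightarrow> bool" where
  "ittm_recognizable x \<longleftrightarrow> (\<exists>i. \<forall>z. halts_with (P i) z {} (delta z x))"

end

theory Submission
  imports Defs
begin

text \<open>
  Let program \<open>r\<close> recognize \<open>x\<close> and let \<open>\<tau>\<close> be its halting time with oracle \<open>x\<close>.  Run all programs at once with empty
  oracle and read the relations shown on their output tapes as codes of ordinals.  Let \<open>\<sigma>\<close> be the limit superior of the
  ordinals shown and \<open>\<zeta>\<close> the supremum of the ordinals of eventually writable reals.  As in Welch's analysis, a machine that
  keeps guessing ordinals until it has seen a cell change shows that all runs have the same snapshot at \<open>\<zeta>\<close> and at \<open>\<sigma>\<close>
  and then cycle; hence a program that halts does so before \<open>\<sigma>\<close>.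

  If \<open>\<sigma> \<le> \<tau>\<close>, running all programs until \<open>r\<close> halts with oracle \<open>x\<close> decides the halting set from \<open>x\<close>.  If \<open>\<tau> < \<sigma>\<close>, a code of
  an ordinal above \<open>\<tau>\<close> is shown at some time.  Given such a code, the accepting runs of \<open>r\<close>, with the oracle unknown, are the
  branches of a computable tree; its pruning is computable and leaves \<open>x\<close> as the only oracle.  So \<open>x\<close> is found by
  trying all codes that are shown, and is certified by \<open>r\<close>.

  All computations are built from operators on reals iterated transfinitely with limits superior, which are compiled
  to machines once and for all.
\<close>

section \<open>Transfinite time\<close>

unbundle cardinal_syntax

abbreviation continuum :: "nat set rel" where "continuum \<equiv> card_of (UNIV :: nat set set)"

definition continuum_succ :: "nat set set rel" where "continuum_succ = cardSuc continuum"

lemma Card_order_continuum_succ: "Card_order continuum_succ"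
  unfolding continuum_succ_def by (rule cardSuc_Card_order[OF card_of_Card_order])

lemma Well_order_continuum_succ: "Well_order continuum_succ"
  using Card_order_continuum_succ unfolding card_order_on_def by blast

lemma continuum_less_continuum_succ: "continuum <o continuum_succ"
  unfolding continuum_succ_def by (rule cardSuc_greater[OF card_of_Card_order])

lemma infinite_reals: "infinite (UNIV :: nat set set)"
  by (simp add: Finite_Set.finite_set)

lemma Field_continuum_succ_nonempty: "\<exists>x. x \<in> Field continuum_succ"
proof -
  have "infinite (Field continuum_succ)"
    unfolding continuum_succ_def cardSuc_finite[OF card_of_Card_order]
    by (simp add: infinite_reals Field_card_of)
  then show ?thesis using infinite_imp_nonempty by blast
qed

text \<open>Times are the ordinals below the successor cardinal of the continuum.  These are all the run lengths admitted
  by \<^const>\<open>halts_with\<close>, and every function from the reals to times is bounded.\<close>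

typedef time = "Field continuum_succ" by (rule Field_continuum_succ_nonempty)

instantiation time :: linorder
begin
definition less_eq_time where "less_eq_time a b \<longleftrightarrow> (Rep_time a, Rep_time b) \<in> continuum_succ"
definition less_time where "less_time (a::time) b \<longleftrightarrow> a \<le> b \<and> a \<noteq> b"
instance
proof
  have refl: "refl_on (Field continuum_succ) continuum_succ" and trans: "trans continuum_succ"
    and antisym: "antisym continuum_succ" and total: "total_on (Field continuum_succ) continuum_succ"
    using Well_order_continuum_succ
    unfolding well_order_on_def linear_order_on_def partial_order_on_def preorder_on_def by auto
  fix x y z :: time
  show le_refl: "x \<le> x" unfolding less_eq_time_def using refl_onD[OF refl Rep_time] .
  show "x \<le> y \<Longrightarrow> y \<le> z \<Longrightarrow> x \<le> z" unfolding less_eq_time_def by (rule transD[OF trans])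
  show le_antisym: "x = y" if "x \<le> y" "y \<le> x"
    using antisymD[OF antisym that[unfolded less_eq_time_def]] by (simp only: Rep_time_inject)
  show "x < y \<longleftrightarrow> x \<le> y \<and> \<not> y \<le> x" unfolding less_time_def using le_antisym le_refl by blast
  show "x \<le> y \<or> y \<le> x"
  proof (cases "x = y")
    case False
    then have "Rep_time x \<noteq> Rep_time y" unfolding Rep_time_inject .
    then show ?thesis unfolding less_eq_time_def
      using total Rep_time[of x] Rep_time[of y] unfolding total_on_def by blast
  qed (use le_refl in simp)
qed
end

lemma wf_time: "wf {(x::time, y). x < y}"
proof -
  have "wf (continuum_succ - Id)" using Well_order_continuum_succ unfolding well_order_on_def by auto
  then have "wf (inv_image (continuum_succ - Id) Rep_time)" by (rule wf_inv_image)
  moreover have "{(x::time, y). x < y} \<subseteq> inv_image (continuum_succ - Id) Rep_time"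
    by (auto simp: inv_image_def less_time_def less_eq_time_def Rep_time_inject)
  ultimately show ?thesis by (rule wf_subset)
qed

instance time :: wellorder
proof
  fix Q and a :: time
  assume "\<And>x::time. (\<And>y. y < x \<Longrightarrow> Q y) \<Longrightarrow> Q x"
  then show "Q a" using wf_induct[OF wf_time, of Q] by blast
qed

lemma card_lessThan_time: "|{..<t::time}| \<le>o continuum"
proof -
  have "|underS continuum_succ (Rep_time t)| <o continuum_succ"
    by (rule card_of_underS[OF Card_order_continuum_succ Rep_time])
  then have "|underS continuum_succ (Rep_time t)| \<le>o continuum"
    unfolding continuum_succ_def
    using cardSuc_ordLeq_ordLess[OF card_of_Card_order card_of_Card_order] by blast
  moreover have "Rep_time ` {..<t} \<subseteq> underS continuum_succ (Rep_time t)"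
    unfolding underS_def by (auto simp: less_time_def less_eq_time_def Rep_time_inject)
  then have "|{..<t}| \<le>o |underS continuum_succ (Rep_time t)|"
    by (intro card_of_ordLeqI[of Rep_time]) (auto simp: inj_on_def Rep_time_inject)
  ultimately show ?thesis by (rule ordLeq_transitive[rotated])
qed

lemma card_atMost_time: "|{..t::time}| \<le>o continuum"
proof -
  have "|{t}| \<le>o continuum" by (rule card_of_singl_ordLeq) simp
  then have "|{..<t} \<union> {t}| \<le>o continuum"
    by (intro card_of_Un_ordLeq_infinite_Field card_lessThan_time card_of_Card_order)
      (simp_all add: Field_card_of infinite_reals)
  moreover have "{..<t} \<union> {t} = {..t}" by auto
  ultimately show ?thesis by simp
qed

lemma not_card_time_le_continuum: "\<not> |UNIV :: time set| \<le>o continuum"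
proof
  assume "|UNIV :: time set| \<le>o continuum"
  moreover have "continuum <o |UNIV :: time set|"
  proof -
    have "|Field continuum_succ| \<le>o |UNIV :: time set|"
      using card_of_image[of Rep_time UNIV] type_definition.Rep_range[OF type_definition_time] by simp
    then have "continuum_succ \<le>o |UNIV :: time set|"
      using card_of_Field_ordIso[OF Card_order_continuum_succ] ordIso_ordLeq_trans ordIso_symmetric
      by blast
    then show ?thesis using continuum_less_continuum_succ ordLess_ordLeq_trans by blast
  qed
  ultimately show False using not_ordLess_ordLeq by blast
qed

lemma time_bounded:
  fixes S :: "time set"
  assumes "|S| \<le>o continuum"
  shows "\<exists>b. \<forall>s\<in>S. s < b"
proof (rule ccontr)
  assume "\<not> ?thesis"
  then have "(\<Union>s\<in>S. {..s}) = UNIV" by (auto simp: not_less)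
  moreover have "|\<Union>s\<in>S. {..s}| \<le>o continuum"
    by (rule card_of_UNION_ordLeq_infinite[OF infinite_reals assms]) (simp add: card_atMost_time)
  ultimately show False using not_card_time_le_continuum by simp
qed

lemma time_bounded_image:
  fixes f :: "'a \<Rightarrow> time"
  assumes "|A| \<le>o continuum"
  shows "\<exists>b. \<forall>a\<in>A. f a < b"
  using time_bounded[OF ordLeq_transitive[OF card_of_image assms]] by (metis image_eqI)

lemma time_bounded_nat: "\<exists>b. \<forall>n::nat. f n < (b::time)"
proof -
  have "|UNIV :: nat set| \<le>o continuum"
    using card_of_ordLeqI[of "\<lambda>n. {n}" "UNIV :: nat set" "UNIV :: nat set set"]
    by (auto simp: inj_on_def)
  from time_bounded_image[OF this, of f] show ?thesis by auto
qed

lemma time_bounded_real: "\<exists>b. \<forall>c::nat set. f c < (b::time)"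
  using time_bounded_image[OF ordLeq_refl[OF card_of_Card_order], of f] by auto

instantiation time :: zero
begin
definition zero_time :: time where "0 = (LEAST t::time. True)"
instance ..
end

definition succ :: "time \<Rightarrow> time" where "succ t = (LEAST u. t < u)"

definition is_limit :: "time \<Rightarrow> bool" where "is_limit t \<longleftrightarrow> t \<noteq> 0 \<and> (\<forall>b<t. succ b < t)"

lemma zero_le_time [simp]: "0 \<le> (t::time)"
  unfolding zero_time_def by (rule Least_le) simp

lemma not_less_zero_time [simp]: "\<not> t < (0::time)"
  by (simp add: leD)

lemma le_zero_time_iff [simp]: "t \<le> 0 \<longleftrightarrow> t = (0::time)"
  by (auto intro: order_antisym)

lemma zero_less_time_iff: "0 < t \<longleftrightarrow> t \<noteq> (0::time)"
  by (auto simp: less_le)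

lemma less_succ [simp]: "t < succ t"
proof -
  obtain b where "t < b" using time_bounded_nat[of "\<lambda>_. t"] by auto
  then show ?thesis unfolding succ_def by (rule LeastI)
qed

lemma le_succ [simp]: "t \<le> succ t"
  by (rule less_imp_le) simp

lemma succ_neq_self [simp]: "succ t \<noteq> t" "t \<noteq> succ t"
  using less_irrefl[of t] less_succ[of t] by metis+

lemma less_succ_iff: "u < succ t \<longleftrightarrow> u \<le> t"
proof
  assume "u < succ t"
  then show "u \<le> t" using not_less_Least[of u "\<lambda>u. t < u"] unfolding succ_def by auto
qed (use le_less_trans less_succ in blast)

lemma succ_le_iff: "succ t \<le> u \<longleftrightarrow> t < u"
  using less_succ_iff[of u t] by (simp add: not_less[symmetric])

lemma le_succ_iff: "u \<le> succ t \<longleftrightarrow> u \<le> t \<or> u = succ t"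
  by (auto simp: le_less less_succ_iff)

lemma lessThan_succ: "{..<succ t} = insert t {..<t}"
  by (auto simp: less_succ_iff)

lemma succ_neq_zero [simp]: "succ t \<noteq> 0" "0 \<noteq> succ t"
  using less_succ not_less_zero_time by metis+

lemma succ_inject [simp]: "succ t = succ u \<longleftrightarrow> t = u"
  by (metis antisym less_succ less_succ_iff)

lemma not_is_limit_succ [simp]: "\<not> is_limit (succ t)"
  unfolding is_limit_def using less_succ[of t] by blast

lemma not_is_limit_zero [simp]: "\<not> is_limit 0"
  unfolding is_limit_def by auto

lemma is_limit_succ_less: "is_limit t \<Longrightarrow> b < t \<Longrightarrow> succ b < t"
  unfolding is_limit_def by auto

lemma is_limit_pos: "is_limit t \<Longrightarrow> 0 < t"
  unfolding is_limit_def by (simp add: zero_less_time_iff)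

lemma is_limitI:
  assumes "a < t" "\<And>b. b < t \<Longrightarrow> \<exists>u<t. b < u"
  shows "is_limit t"
  unfolding is_limit_def
proof (intro conjI allI impI)
  show "t \<noteq> 0" using assms(1) by auto
  fix b assume "b < t"
  then obtain u where "u < t" "b < u" using assms(2) by blast
  then show "succ b < t" using succ_le_iff[of b u] by simp
qed

lemma time_cases [case_names zero succ limit]:
  obtains "t = 0" | u where "t = succ u" | "is_limit t"
proof (cases "t = 0 \<or> is_limit t")
  case False
  then obtain b where "b < t" "\<not> succ b < t" unfolding is_limit_def by auto
  then have "t = succ b" using succ_le_iff[of b t] by auto
  then show ?thesis using that by blast
qed (use that in blast)

lemma time_induct [case_names zero succ limit]:
  assumes "Q 0" "\<And>t. Q t \<Longrightarrow> Q (succ t)" "\<And>t. is_limit t \<Longrightarrow> (\<And>u. u < t \<Longrightarrow> Q u) \<Longrightarrow> Q t"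
  shows "Q t"
proof (induction t rule: less_induct)
  case (less t)
  show ?case by (cases t rule: time_cases) (use assms less in auto)
qed

definition time_rec :: "'c \<Rightarrow> (time \<Rightarrow> 'c \<Rightarrow> 'c) \<Rightarrow> ((time \<Rightarrow> 'c) \<Rightarrow> time \<Rightarrow> 'c) \<Rightarrow> time \<Rightarrow> 'c" where
  "time_rec z s l = wfrec {(x, y). x < y} (\<lambda>f t. if t = 0 then z
     else if \<exists>u. t = succ u then s (THE u. t = succ u) (f (THE u. t = succ u)) else l f t)"

lemma time_rec_zero: "time_rec z s l 0 = z"
  unfolding time_rec_def by (subst wfrec[OF wf_time]) simp

lemma time_rec_succ: "time_rec z s l (succ t) = s t (time_rec z s l t)"
  unfolding time_rec_def by (subst wfrec[OF wf_time]) (simp add: cut_apply)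

lemma time_rec_limit:
  assumes "is_limit t" "\<And>f g. (\<And>u. u < t \<Longrightarrow> f u = g u) \<Longrightarrow> l f t = l g t"
  shows "time_rec z s l t = l (time_rec z s l) t"
proof -
  have "t \<noteq> 0" "\<not> (\<exists>u. t = succ u)" using assms(1) by auto
  then have "time_rec z s l t = l (cut (time_rec z s l) {(x, y). x < y} t) t"
    unfolding time_rec_def by (subst wfrec[OF wf_time]) simp
  also have "\<dots> = l (time_rec z s l) t" by (rule assms(2)) (simp add: cut_apply)
  finally show ?thesis .
qed

definition strict_sup :: "(time \<Rightarrow> time) \<Rightarrow> time \<Rightarrow> time" where
  "strict_sup f t = (LEAST w. \<forall>s<t. f s < w)"

lemma less_strict_sup: "s < t \<Longrightarrow> f s < strict_sup f t"
proof -
  obtain w where "\<forall>s\<in>{..<t}. f s < w" using time_bounded_image[OF card_lessThan_time, of t f] by blast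
  then have "\<forall>s<t. f s < w" by simp
  then have "\<forall>s<t. f s < strict_sup f t" unfolding strict_sup_def by (rule LeastI)
  then show "s < t \<Longrightarrow> f s < strict_sup f t" by blast
qed

lemma less_strict_supD: "w < strict_sup f t \<Longrightarrow> \<exists>s<t. w \<le> f s"
  using not_less_Least[of w "\<lambda>w. \<forall>s<t. f s < w"] unfolding strict_sup_def by (auto simp: not_less)

lemma strict_sup_cong: "(\<And>s. s < t \<Longrightarrow> f s = g s) \<Longrightarrow> strict_sup f t = strict_sup g t"
  unfolding strict_sup_def by (intro arg_cong[where f = Least] ext) auto

lemma is_limit_strict_sup:
  assumes "is_limit t" "\<And>s. s < t \<Longrightarrow> f s < f (succ s)"
  shows "is_limit (strict_sup f t)"
proof (rule is_limitI)
  show "f 0 < strict_sup f t" using less_strict_sup is_limit_pos[OF assms(1)] by blast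
  fix b assume "b < strict_sup f t"
  then obtain s where s: "s < t" "b \<le> f s" using less_strict_supD by blast
  then have "b < f (succ s)" using assms(2) by (meson le_less_trans)
  then show "\<exists>u<strict_sup f t. b < u" using less_strict_sup is_limit_succ_less[OF assms(1) s(1)]
    by blast
qed

instantiation time :: plus
begin
definition plus_time :: "time \<Rightarrow> time \<Rightarrow> time" where "u + t = time_rec u (\<lambda>_. succ) strict_sup t"
instance ..
end

lemma add_zero_time [simp]: "u + 0 = (u::time)"
  unfolding plus_time_def by (rule time_rec_zero)

lemma add_succ [simp]: "u + succ t = succ (u + t)"
  unfolding plus_time_def by (rule time_rec_succ)

lemma add_limit: "is_limit t \<Longrightarrow> u + t = strict_sup ((+) u) t"
  unfolding plus_time_def[abs_def] by (erule time_rec_limit) (rule strict_sup_cong)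

lemma is_limit_add: "is_limit t \<Longrightarrow> is_limit (u + t)"
  unfolding add_limit by (rule is_limit_strict_sup) auto

lemma add_strict_mono_time: "s < t \<Longrightarrow> u + s < u + (t::time)"
proof (induction t rule: time_induct)
  case (succ t)
  then have "s = t \<or> s < t" by (auto simp: less_succ_iff le_less)
  then show ?case using succ.IH less_succ[of "u + t"] by (auto intro: order.strict_trans)
next
  case (limit t)
  then show ?case by (simp add: add_limit less_strict_sup)
qed simp

lemma add_less_iff_time: "u + s < u + t \<longleftrightarrow> s < (t::time)"
  using add_strict_mono_time[of s t u] add_strict_mono_time[of t s u] by (metis less_asym less_linear)

lemma add_le_iff_time: "u + s \<le> u + t \<longleftrightarrow> s \<le> (t::time)"
  using add_less_iff_time[of u t s] by (simp add: not_less[symmetric])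

lemma le_add_time: "u \<le> u + (t::time)"
  using add_le_iff_time[of u 0 t] by simp

lemma strict_mono_imp_increasing_time:
  fixes f :: "time \<Rightarrow> time"
  assumes "\<And>s t. s < t \<Longrightarrow> t \<le> b \<Longrightarrow> f s < f t"
  shows "b \<le> f b"
  using assms
proof (induction b rule: less_induct)
  case (less b)
  show ?case
  proof (rule ccontr)
    assume "\<not> b \<le> f b"
    then have fb: "f b < b" by simp
    then have "f b \<le> f (f b)" using less.IH[of "f b"] less.prems by (meson less_imp_le order_trans)
    then show False using less.prems[OF fb order_refl] by simp
  qed
qed

lemma ex_add_eq_time:
  fixes u :: time
  assumes "u \<le> w"
  shows "\<exists>t. u + t = w"
proof -
  define t where "t = (LEAST t. w \<le> u + t)"
  have "w \<le> u + w" by (rule strict_mono_imp_increasing_time) (rule add_strict_mono_time)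
  then have upper: "w \<le> u + t" unfolding t_def by (rule LeastI)
  have below: "u + s < w" if "s < t" for s
    using not_less_Least[of s "\<lambda>t. w \<le> u + t"] that unfolding t_def by auto
  have "u + t \<le> w"
  proof (cases t rule: time_cases)
    case zero
    then show ?thesis using assms by simp
  next
    case (succ s)
    then show ?thesis using below[of s] by (simp add: succ_le_iff)
  next
    case limit
    show ?thesis
    proof (rule ccontr)
      assume "\<not> u + t \<le> w"
      then obtain s where "s < t" "w \<le> u + s" using less_strict_supD add_limit[OF limit]
        by (metis not_le)
      then show False using below by fastforce
    qed
  qed
  then show ?thesis using upper by (blast intro: antisym)
qed

definition next_limit :: "time \<Rightarrow> time" where "next_limit u = (LEAST w. \<forall>n. (succ ^^ n) u < w)"

lemma funpow_succ_less_next_limit: "(succ ^^ n) u < next_limit u"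
proof -
  obtain w where "\<forall>n. (succ ^^ n) u < w" using time_bounded_nat[of "\<lambda>n. (succ ^^ n) u"] by blast
  then have "\<forall>n. (succ ^^ n) u < next_limit u" unfolding next_limit_def by (rule LeastI)
  then show ?thesis by blast
qed

lemma less_next_limit: "u < next_limit u"
  using funpow_succ_less_next_limit[of 0 u] by simp

lemma funpow_succ_le_iff: "(succ ^^ m) u \<le> (succ ^^ n) u \<longleftrightarrow> m \<le> n"
proof -
  have "(succ ^^ n) u < (succ ^^ m) u \<longleftrightarrow> n < m"
    by (rule lift_Suc_mono_less_iff[of "\<lambda>n. (succ ^^ n) u"]) simp
  then show ?thesis by (simp add: not_less[symmetric])
qed

lemma less_next_limitD: "w < next_limit u \<Longrightarrow> \<exists>n. w \<le> (succ ^^ n) u"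
  using not_less_Least[of w "\<lambda>w. \<forall>n. (succ ^^ n) u < w"] unfolding next_limit_def
  by (auto simp: not_less)

lemma is_limit_next_limit: "is_limit (next_limit u)"
proof (rule is_limitI[OF less_next_limit])
  fix b assume "b < next_limit u"
  then obtain n where "b \<le> (succ ^^ n) u" using less_next_limitD by blast
  then have "b < (succ ^^ Suc n) u" by (auto intro: le_less_trans)
  then show "\<exists>w<next_limit u. b < w" using funpow_succ_less_next_limit by blast
qed

lemma ex_funpow_succ_eq:
  assumes "u \<le> w" "w < next_limit u"
  shows "\<exists>n. w = (succ ^^ n) u"
proof -
  define n where "n = (LEAST n. w \<le> (succ ^^ n) u)"
  have upper: "w \<le> (succ ^^ n) u" unfolding n_def using less_next_limitD[OF assms(2)] by (rule LeastI_ex)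
  have "(succ ^^ n) u \<le> w"
  proof (cases n)
    case (Suc m)
    then have "\<not> w \<le> (succ ^^ m) u" using not_less_Least[of m "\<lambda>n. w \<le> (succ ^^ n) u"]
      unfolding n_def by auto
    then show ?thesis using Suc by (simp add: succ_le_iff)
  qed (use assms(1) in simp)
  then show ?thesis using upper by (blast intro: antisym)
qed

text \<open>The sets are read as functions to \<open>{0, 1}\<close>; this is the limit superior taken at limit stages.\<close>

definition limsup :: "(time \<Rightarrow> nat set) \<Rightarrow> time \<Rightarrow> nat set" where
  "limsup f t = {n. \<forall>b<t. \<exists>d. b \<le> d \<and> d < t \<and> n \<in> f d}"

lemma limsup_cong: "(\<And>u. u < t \<Longrightarrow> f u = g u) \<Longrightarrow> limsup f t = limsup g t"
  unfolding limsup_def by (intro Collect_cong) metis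

lemma limsup_vimage: "{n. h n \<in> limsup f t} = limsup (\<lambda>u. {n. h n \<in> f u}) t"
  unfolding limsup_def by simp

lemma in_limsupI:
  assumes "\<And>b. b < t \<Longrightarrow> \<exists>d. b \<le> d \<and> d < t \<and> n \<in> f d" shows "n \<in> limsup f t"
  using assms unfolding limsup_def by auto

lemma in_limsupD:
  assumes "n \<in> limsup f t" "b < t" obtains d where "b \<le> d" "d < t" "n \<in> f d"
  using assms unfolding limsup_def by auto

lemma in_limsup_eventually:
  assumes "b < t" "\<And>u. b \<le> u \<Longrightarrow> u < t \<Longrightarrow> (n \<in> f u) = v"
  shows "(n \<in> limsup f t) = v"
proof (cases v)
  case True
  have "n \<in> limsup f t"
    by (rule in_limsupI) (use assms True in \<open>metis max.cobounded1 max.cobounded2 max_less_iff_conj\<close>)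
  then show ?thesis using True by simp
next
  case False
  then show ?thesis using assms by (auto elim!: in_limsupD)
qed

lemma limsup_eventually_const:
  assumes "b < t" "\<And>u. b \<le> u \<Longrightarrow> u < t \<Longrightarrow> f u = X"
  shows "limsup f t = X"
  by (rule set_eqI, rule in_limsup_eventually[OF assms(1)]) (simp add: assms(2))

lemma in_limsup_next_limit: "n \<in> limsup f (next_limit u) \<longleftrightarrow> (\<forall>k. \<exists>j\<ge>k. n \<in> f ((succ ^^ j) u))"
proof (intro iffI allI)
  fix k
  assume "n \<in> limsup f (next_limit u)"
  then obtain d where d: "(succ ^^ k) u \<le> d" "d < next_limit u" "n \<in> f d"
    by (rule in_limsupD[OF _ funpow_succ_less_next_limit])
  then have "u \<le> d" using funpow_succ_le_iff[of 0 u k] by simp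
  then obtain j where "d = (succ ^^ j) u" using ex_funpow_succ_eq d(2) by blast
  then show "\<exists>j\<ge>k. n \<in> f ((succ ^^ j) u)" using d funpow_succ_le_iff by blast
next
  assume cofinal: "\<forall>k. \<exists>j\<ge>k. n \<in> f ((succ ^^ j) u)"
  show "n \<in> limsup f (next_limit u)"
  proof (rule in_limsupI)
    fix b assume "b < next_limit u"
    then obtain k where "b \<le> (succ ^^ k) u" using less_next_limitD by blast
    moreover obtain j where "j \<ge> k" "n \<in> f ((succ ^^ j) u)" using cofinal by blast
    ultimately show "\<exists>d. b \<le> d \<and> d < next_limit u \<and> n \<in> f d"
      using funpow_succ_le_iff funpow_succ_less_next_limit by (meson order_trans)
  qed
qed

lemma in_limsup_next_limit_eventually:
  assumes "\<And>j. k \<le> j \<Longrightarrow> (n \<in> f ((succ ^^ j) u)) = v"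
  shows "(n \<in> limsup f (next_limit u)) = v"
proof -
  have "\<exists>j\<ge>max k m. True" for m by blast
  then show ?thesis unfolding in_limsup_next_limit using assms by (metis max.boundedE order_refl)
qed

lemma limsup_add:
  assumes "is_limit t"
  shows "limsup g (u + t) = limsup (\<lambda>s. g (u + s)) t"
proof (intro set_eqI iffI)
  fix n assume n: "n \<in> limsup g (u + t)"
  show "n \<in> limsup (\<lambda>s. g (u + s)) t"
  proof (rule in_limsupI)
    fix b assume "b < t"
    then obtain d where d: "u + b \<le> d" "d < u + t" "n \<in> g d" using n add_strict_mono_time
      by (blast elim: in_limsupD)
    then obtain s where "u + s = d" using ex_add_eq_time le_add_time order_trans by meson
    then show "\<exists>s. b \<le> s \<and> s < t \<and> n \<in> g (u + s)" using d add_less_iff_time add_le_iff_time by blast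
  qed
next
  fix n assume n: "n \<in> limsup (\<lambda>s. g (u + s)) t"
  show "n \<in> limsup g (u + t)"
  proof (rule in_limsupI)
    fix w assume "w < u + t"
    then obtain s where s: "s < t" "w \<le> u + s" using less_strict_supD add_limit[OF assms] by metis
    then obtain d where "s \<le> d" "d < t" "n \<in> g (u + d)" using n by (blast elim: in_limsupD)
    then show "\<exists>d. w \<le> d \<and> d < u + t \<and> n \<in> g d"
      using s add_less_iff_time add_le_iff_time by (meson order_trans)
  qed
qed

definition iterate :: "(nat set \<Rightarrow> nat set) \<Rightarrow> nat set \<Rightarrow> time \<Rightarrow> nat set" where
  "iterate G S = time_rec S (\<lambda>_. G) limsup"

lemma iterate_zero [simp]: "iterate G S 0 = S"
  unfolding iterate_def by (rule time_rec_zero)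

lemma iterate_succ [simp]: "iterate G S (succ t) = G (iterate G S t)"
  unfolding iterate_def by (rule time_rec_succ)

lemma iterate_limit: "is_limit t \<Longrightarrow> iterate G S t = limsup (iterate G S) t"
  unfolding iterate_def by (erule time_rec_limit) (rule limsup_cong)

definition stops_at :: "(nat set \<Rightarrow> nat set) \<Rightarrow> nat set \<Rightarrow> time \<Rightarrow> bool" where
  "stops_at G S t \<longleftrightarrow> 0 \<in> iterate G S t \<and> (\<forall>s<t. 0 \<notin> iterate G S s)"

section \<open>Runs of machines\<close>

definition cfg_limsup :: "(time \<Rightarrow> cfg) \<Rightarrow> time \<Rightarrow> cfg" where
  "cfg_limsup c t = \<lparr>st = 2, hd = 0,
      tin = (\<lambda>n. n \<in> limsup (\<lambda>d. Collect (tin (c d))) t),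
      tsc = (\<lambda>n. n \<in> limsup (\<lambda>d. Collect (tsc (c d))) t),
      tout = (\<lambda>n. n \<in> limsup (\<lambda>d. Collect (tout (c d))) t)\<rparr>"

definition config :: "prog \<Rightarrow> nat set \<Rightarrow> nat set \<Rightarrow> time \<Rightarrow> cfg" where
  "config p y z = time_rec (init_cfg z) (\<lambda>_. step p y) cfg_limsup"

lemma config_zero [simp]: "config p y z 0 = init_cfg z"
  unfolding config_def by (rule time_rec_zero)

lemma config_succ [simp]: "config p y z (succ t) = step p y (config p y z t)"
  unfolding config_def by (rule time_rec_succ)

lemma config_funpow_succ: "config p y z ((succ ^^ n) u) = (step p y ^^ n) (config p y z u)"
  by (induction n) auto

lemma config_limit:
  assumes "is_limit t" shows "config p y z t = cfg_limsup (config p y z) t"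
  unfolding config_def
proof (rule time_rec_limit[OF assms])
  fix f g :: "time \<Rightarrow> cfg" assume "\<And>u. u < t \<Longrightarrow> f u = g u"
  then have "limsup (\<lambda>d. Collect (v (f d))) t = limsup (\<lambda>d. Collect (v (g d))) t" for v
    by (intro limsup_cong) simp
  then show "cfg_limsup f t = cfg_limsup g t" unfolding cfg_limsup_def by simp
qed

lemma st_config_limit: "is_limit t \<Longrightarrow> st (config p y z t) = 2"
  and hd_config_limit: "is_limit t \<Longrightarrow> cfg.hd (config p y z t) = 0"
  and tin_config_limit: "is_limit t \<Longrightarrow> tin (config p y z t) n \<longleftrightarrow>
      n \<in> limsup (\<lambda>u. Collect (tin (config p y z u))) t"
  and tsc_config_limit: "is_limit t \<Longrightarrow> tsc (config p y z t) n \<longleftrightarrow>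
      n \<in> limsup (\<lambda>u. Collect (tsc (config p y z u))) t"
  and tout_config_limit: "is_limit t \<Longrightarrow> tout (config p y z t) n \<longleftrightarrow>
      n \<in> limsup (\<lambda>u. Collect (tout (config p y z u))) t"
  by (simp_all add: config_limit cfg_limsup_def)

lemmas config_limit_sel =
  st_config_limit hd_config_limit tin_config_limit tsc_config_limit tout_config_limit

definition halts_at :: "prog \<Rightarrow> nat set \<Rightarrow> nat set \<Rightarrow> time \<Rightarrow> bool" where
  "halts_at p y z t \<longleftrightarrow> st (config p y z t) = 1 \<and> (\<forall>u<t. st (config p y z u) \<noteq> 1)"

locale initial_embedding =
  fixes r :: "'a rel" and h :: "'a \<Rightarrow> time"
  assumes well_order: "Well_order r"
    and le_iff: "\<And>a b. a \<in> Field r \<Longrightarrow> b \<in> Field r \<Longrightarrow> (a, b) \<in> r \<longleftrightarrow> h a \<le> h b"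
    and initial: "\<And>a w. a \<in> Field r \<Longrightarrow> w < h a \<Longrightarrow> \<exists>b\<in>Field r. h b = w"
begin

lemma h_eq_iff: "a \<in> Field r \<Longrightarrow> b \<in> Field r \<Longrightarrow> h a = h b \<longleftrightarrow> a = b"
  using le_iff[of a b] le_iff[of b a] well_order
  unfolding well_order_on_def linear_order_on_def partial_order_on_def antisym_def by auto

lemma in_underS_iff: "a \<in> Field r \<Longrightarrow> b \<in> underS r a \<longleftrightarrow> b \<in> Field r \<and> h b < h a"
  using le_iff[of b a] h_eq_iff[of b a] unfolding underS_def Field_def by (auto simp: less_le)

lemma underS_eq_empty_iff: "a \<in> Field r \<Longrightarrow> underS r a = {} \<longleftrightarrow> h a = 0"
  using in_underS_iff initial by (metis all_not_in_conv not_less_zero_time zero_less_time_iff)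

lemma greatest_underS_iff:
  assumes "a \<in> Field r" "b \<in> underS r a"
  shows "(\<forall>d\<in>underS r a. (d, b) \<in> r) \<longleftrightarrow> h a = succ (h b)"
proof
  assume greatest: "\<forall>d\<in>underS r a. (d, b) \<in> r"
  have b: "b \<in> Field r" "succ (h b) \<le> h a" using in_underS_iff assms by (auto simp: succ_le_iff)
  show "h a = succ (h b)"
  proof (rule ccontr)
    assume "h a \<noteq> succ (h b)"
    then have "succ (h b) < h a" using b(2) by simp
    then obtain d where "d \<in> Field r" "h d = succ (h b)" using initial assms(1) by blast
    then show False using greatest in_underS_iff[OF assms(1)] le_iff[of d b] b(1) \<open>succ (h b) < h a\<close>
      by (metis less_succ not_le)
  qed
next
  assume "h a = succ (h b)"
  then show "\<forall>d\<in>underS r a. (d, b) \<in> r" using in_underS_iff assms le_iff less_succ_iff by auto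
qed

lemma no_greatest_underS_iff:
  assumes a: "a \<in> Field r"
  shows "underS r a \<noteq> {} \<and> (\<forall>b\<in>underS r a. \<exists>d\<in>underS r a. (b, d) \<in> r \<and> d \<noteq> b) \<longleftrightarrow> is_limit (h a)"
    (is "?L \<longleftrightarrow> ?R")
proof
  assume L: ?L
  then have "0 < h a" using underS_eq_empty_iff a by (simp add: zero_less_time_iff)
  then show ?R
  proof (rule is_limitI)
    fix w assume "w < h a"
    then obtain b where b: "b \<in> Field r" "h b = w" using initial a by blast
    then obtain d where "d \<in> underS r a" "(b, d) \<in> r" "d \<noteq> b" using L in_underS_iff a \<open>w < h a\<close> by metis
    then show "\<exists>u<h a. w < u" using le_iff h_eq_iff in_underS_iff a b by (metis less_le)
  qed
next
  assume R: ?R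
  have "\<exists>d\<in>underS r a. (b, d) \<in> r \<and> d \<noteq> b" if "b \<in> underS r a" for b
  proof -
    have b: "b \<in> Field r" "succ (h b) < h a" using in_underS_iff a that is_limit_succ_less[OF R] by auto
    then obtain d where "d \<in> Field r" "h d = succ (h b)" using initial a by blast
    then show ?thesis using in_underS_iff a le_iff b by (intro bexI[of _ d]) auto
  qed
  then show ?L using underS_eq_empty_iff a is_limit_pos[OF R] by auto
qed

lemma limsup_cell_iff:
  assumes a: "a \<in> Field r" and eq: "\<And>d. d \<in> Field r \<Longrightarrow> h d < h a \<Longrightarrow> c d = c' (h d)"
  shows "limsup_cell r a (\<lambda>d. v (c d) n) \<longleftrightarrow> n \<in> limsup (\<lambda>d. Collect (v (c' d))) (h a)"
proof
  assume cell: "limsup_cell r a (\<lambda>d. v (c d) n)"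
  show "n \<in> limsup (\<lambda>d. Collect (v (c' d))) (h a)"
  proof (rule in_limsupI)
    fix w assume "w < h a"
    then obtain b where b: "b \<in> Field r" "h b = w" using initial a by blast
    then have "b \<in> underS r a" using in_underS_iff a \<open>w < h a\<close> by auto
    then obtain d where "d \<in> underS r a" "(b, d) \<in> r" "v (c d) n"
      using cell unfolding limsup_cell_def by blast
    then show "\<exists>d. w \<le> d \<and> d < h a \<and> n \<in> Collect (v (c' d))"
      using in_underS_iff a b le_iff eq by (intro exI[of _ "h d"]) auto
  qed
next
  assume limsup: "n \<in> limsup (\<lambda>d. Collect (v (c' d))) (h a)"
  show "limsup_cell r a (\<lambda>d. v (c d) n)" unfolding limsup_cell_def
  proof
    fix b assume "b \<in> underS r a"
    then have b: "b \<in> Field r" "h b < h a" using in_underS_iff a by auto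
    then obtain w where w: "h b \<le> w" "w < h a" "v (c' w) n" using limsup by (auto elim!: in_limsupD)
    then obtain d where "d \<in> Field r" "h d = w" using initial a by blast
    then show "\<exists>d\<in>underS r a. (b, d) \<in> r \<and> v (c d) n"
      using in_underS_iff a w le_iff b eq by (intro bexI[of _ d]) auto
  qed
qed

lemma lim_cfg_eq:
  assumes "a \<in> Field r" "\<And>d. d \<in> Field r \<Longrightarrow> h d < h a \<Longrightarrow> c d = c' (h d)"
  shows "lim_cfg r c a = cfg_limsup c' (h a)"
  using limsup_cell_iff[of a c c' tin] limsup_cell_iff[of a c c' tsc] limsup_cell_iff[of a c c' tout] assms
  unfolding lim_cfg_def cfg_limsup_def by simp

lemma is_run_config:
  assumes "Field r \<noteq> {}"
  shows "is_run p y z r (\<lambda>a. config p y z (h a))"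
  unfolding is_run_def
proof (intro conjI ballI impI well_order assms)
  fix a assume a: "a \<in> Field r"
  show "underS r a = {} \<Longrightarrow> config p y z (h a) = init_cfg z" using underS_eq_empty_iff a by simp
  show "config p y z (h a) = step p y (config p y z (h b))"
    if "b \<in> underS r a" "\<forall>d\<in>underS r a. (d, b) \<in> r" for b
    using greatest_underS_iff[OF a that(1)] that by simp
  show "config p y z (h a) = lim_cfg r (\<lambda>a. config p y z (h a)) a"
    if "underS r a \<noteq> {} \<and> (\<forall>b\<in>underS r a. \<exists>d\<in>underS r a. (b, d) \<in> r \<and> d \<noteq> b)"
    using no_greatest_underS_iff[OF a] that config_limit lim_cfg_eq[OF a, of _ "config p y z"] by simp
qed

lemma is_run_unique:
  assumes "is_run p y z r c" "a \<in> Field r"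
  shows "c a = config p y z (h a)"
  using assms(2)
proof (induction "h a" arbitrary: a rule: less_induct)
  case less
  have at_zero: "underS r a = {} \<longrightarrow> c a = init_cfg z"
    and at_succ: "\<forall>b\<in>underS r a. (\<forall>d\<in>underS r a. (d, b) \<in> r) \<longrightarrow> c a = step p y (c b)"
    and at_limit: "underS r a \<noteq> {} \<and> (\<forall>b\<in>underS r a. \<exists>d\<in>underS r a. (b, d) \<in> r \<and> d \<noteq> b) \<longrightarrow> c a =
        lim_cfg r c a"
    using assms(1) less.prems unfolding is_run_def by blast+
  show ?case
  proof (cases "h a" rule: time_cases)
    case zero
    then show ?thesis using at_zero underS_eq_empty_iff less.prems by simp
  next
    case (succ u)
    then obtain b where b: "b \<in> Field r" "h b = u" using initial[OF less.prems] less_succ by metis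
    then have "b \<in> underS r a" using in_underS_iff less.prems succ by auto
    then have "c a = step p y (c b)" using at_succ greatest_underS_iff[OF less.prems, of b] succ b
      by auto
    then show ?thesis using less.hyps[of b] b succ by simp
  next
    case limit
    then have "c a = lim_cfg r c a" using at_limit no_greatest_underS_iff[OF less.prems] by blast
    then show ?thesis
      using lim_cfg_eq[OF less.prems, of c "config p y z"] less.hyps config_limit[OF limit] by simp
  qed
qed

end

lemma ex_initial_embedding:
  fixes r :: "nat set rel"
  assumes wo: "Well_order r"
  shows "\<exists>h. initial_embedding r h"
proof -
  have "r <o continuum_succ"
  proof -
    have "|Field r| <o continuum_succ"
      using card_of_mono1[OF subset_UNIV] continuum_less_continuum_succ ordLeq_ordLess_trans by blast
    then have "\<not> continuum_succ \<le>o r"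
      using card_of_mono2[of continuum_succ r] card_of_Field_ordIso[OF Card_order_continuum_succ]
        not_ordLess_ordLeq ordIso_ordLeq_trans ordIso_symmetric by blast
    then show ?thesis using ordLess_or_ordLeq[OF wo Well_order_continuum_succ] by blast
  qed
  then obtain f where emb: "embed r continuum_succ f" unfolding ordLess_def embedS_def by blast
  then have compat: "compat r continuum_succ f" and inj: "inj_on f (Field r)"
    and filter: "wo_rel.ofilter continuum_succ (f ` Field r)"
    using embed_iff_compat_inj_on_ofilter[OF wo Well_order_continuum_succ] by blast+
  have range: "f a \<in> Field continuum_succ" if "a \<in> Field r" for a
    by (rule embed_in_Field[OF emb that])
  have Abs_time_le_iff: "Abs_time (f a) \<le> Abs_time (f b) \<longleftrightarrow> (f a, f b) \<in> continuum_succ"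
    if "a \<in> Field r" "b \<in> Field r" for a b
    unfolding less_eq_time_def using range that by (simp add: Abs_time_inverse)
  have "initial_embedding r (Abs_time \<circ> f)"
  proof
    fix a b assume a: "a \<in> Field r"
    show "(a, b) \<in> r \<longleftrightarrow> (Abs_time \<circ> f) a \<le> (Abs_time \<circ> f) b" if b: "b \<in> Field r"
    proof -
      have mono: "(f a', f b') \<in> continuum_succ" if "(a', b') \<in> r" for a' b' using compat that
        unfolding compat_def by blast
      have "(a, b) \<in> r \<or> (b, a) \<in> r" using wo_rel.TOTALS[of r] wo a b unfolding wo_rel_def by blast
      moreover have "f a = f b" if "(f a, f b) \<in> continuum_succ" "(b, a) \<in> r"
        using wo_rel.ANTISYM[of continuum_succ] Well_order_continuum_succ that mono
        unfolding wo_rel_def antisym_def by blast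
      ultimately show ?thesis unfolding o_apply Abs_time_le_iff[OF a b] using mono inj a b by (metis inj_onD)
    qed
    fix w assume "w < (Abs_time \<circ> f) a"
    then have "Rep_time w \<in> under continuum_succ (f a)"
      unfolding under_def less_time_def less_eq_time_def using range[OF a]
      by (simp add: Abs_time_inverse)
    then have "Rep_time w \<in> f ` Field r"
      using filter a Well_order_continuum_succ wo_rel.ofilter_def[of continuum_succ]
      unfolding wo_rel_def by blast
    then show "\<exists>b\<in>Field r. (Abs_time \<circ> f) b = w" using Rep_time_inverse by (metis imageE o_apply)
  qed (rule wo)
  then show ?thesis by blast
qed

lemma ex_initial_embedding_atMost: "\<exists>(r :: nat set rel) h. initial_embedding r h \<and> h ` Field r = {..t}"
proof -
  obtain f :: "time \<Rightarrow> nat set" where inj: "inj_on f {..t}"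
    using card_atMost_time[of t] card_of_ordLeq[of "{..t}" "UNIV :: nat set set"] by auto
  define A where "A = Rep_time ` {..t}"
  define g where "g = f \<circ> Abs_time"
  define r where "r = dir_image (Restr continuum_succ A) g"
  have sub: "A \<subseteq> Field continuum_succ" unfolding A_def using Rep_time by auto
  have Field_Restr: "Field (Restr continuum_succ A) = A"
    using wo_rel.REFL[of continuum_succ] Well_order_continuum_succ sub unfolding wo_rel_def
    by (intro Refl_Field_Restr2) auto
  have inj_g: "inj_on g A" unfolding A_def g_def using inj by (auto simp: inj_on_def Rep_time_inverse)
  have g: "g (Rep_time u) = f u" for u unfolding g_def by (simp add: Rep_time_inverse)
  have Field: "Field r = f ` {..t}" unfolding r_def dir_image_Field Field_Restr unfolding A_def
    by (simp add: g image_image)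
  have mem: "(f a, f b) \<in> r \<longleftrightarrow> a \<le> b" if "a \<le> t" "b \<le> t" for a b
  proof -
    have "(f a, f b) \<in> r \<longleftrightarrow> (\<exists>a'\<in>A. \<exists>b'\<in>A. f a = g a' \<and> f b = g b' \<and> (a', b') \<in> continuum_succ)"
      unfolding r_def dir_image_def by blast
    also have "\<dots> \<longleftrightarrow> (\<exists>a'\<in>{..t}. \<exists>b'\<in>{..t}. f a = f a' \<and> f b = f b' \<and> a' \<le> b')"
      unfolding A_def by (simp add: g less_eq_time_def)
    finally show ?thesis using inj that unfolding inj_on_def by (metis atMost_iff)
  qed
  have "initial_embedding r (the_inv_into {..t} f)"
  proof
    show "Well_order r" unfolding r_def
      by (rule Well_order_dir_image[OF Well_order_Restr[OF Well_order_continuum_succ]])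
         (simp add: Field_Restr inj_g)
  qed (auto simp: Field mem the_inv_into_f_f[OF inj])
  moreover have "the_inv_into {..t} f ` Field r = {..t}" unfolding Field
    using the_inv_into_f_f[OF inj] by force
  ultimately show ?thesis by blast
qed

lemma halts_with_iff:
  "halts_with p y z x \<longleftrightarrow> (\<exists>t. halts_at p y z t \<and> {n. tout (config p y z t) n} = x)"
proof
  assume "halts_with p y z x"
  then obtain r :: "nat set rel" and c t where run: "is_run p y z r c" and t: "t \<in> Field r"
    and halt: "st (c t) = 1" "\<forall>a\<in>underS r t. st (c a) \<noteq> 1" "{n. tout (c t) n} = x"
    unfolding halts_with_def by blast
  have "Well_order r" using run unfolding is_run_def by auto
  then obtain h where "initial_embedding r h" using ex_initial_embedding by blast
  then interpret initial_embedding r h .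
  have "st (config p y z u) \<noteq> 1" if u: "u < h t" for u
  proof -
    obtain b where b: "b \<in> Field r" "h b = u" using initial[OF t u] by blast
    then have "b \<in> underS r t" using in_underS_iff[OF t] u by blast
    then show ?thesis using halt(2) is_run_unique[OF run b(1)] b(2) by auto
  qed
  then show "\<exists>t. halts_at p y z t \<and> {n. tout (config p y z t) n} = x"
    unfolding halts_at_def using halt is_run_unique[OF run t] by auto
next
  assume "\<exists>t. halts_at p y z t \<and> {n. tout (config p y z t) n} = x"
  then obtain t where t: "st (config p y z t) = 1" "\<forall>u<t. st (config p y z u) \<noteq> 1"
    "{n. tout (config p y z t) n} = x"
    unfolding halts_at_def by blast
  obtain r :: "nat set rel" and h where emb: "initial_embedding r h" and range: "h ` Field r = {..t}"
    using ex_initial_embedding_atMost by blast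
  interpret initial_embedding r h by (rule emb)
  have "t \<in> h ` Field r" using range by simp
  then obtain a where a: "a \<in> Field r" "h a = t" by auto
  have "is_run p y z r (\<lambda>a. config p y z (h a))" using a(1) by (intro is_run_config) auto
  moreover have "\<forall>b\<in>Field r. (b, a) \<in> r" using le_iff a range by blast
  moreover have "\<forall>b\<in>underS r a. st (config p y z (h b)) \<noteq> 1" using in_underS_iff[OF a(1)] a(2) t(2)
    by auto
  ultimately show "halts_with p y z x" unfolding halts_with_def using t a
    by (intro exI[of _ r] exI[of _ "\<lambda>a. config p y z (h a)"] exI[of _ a]) auto
qed

lemma ex_halts_at_iff: "(\<exists>t. halts_at p y z t) \<longleftrightarrow> (\<exists>t. st (config p y z t) = 1)"
  unfolding halts_at_def using exists_least_iff[of "\<lambda>t. st (config p y z t) = 1"] by blast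

lemma halts_iff: "halts p y z \<longleftrightarrow> (\<exists>t. st (config p y z t) = 1)"
  unfolding halts_def halts_with_iff ex_halts_at_iff[symmetric] by blast

lemma halts_with_unique: "halts_with p y z w \<Longrightarrow> halts_with p y z w' \<Longrightarrow> w = w'"
  unfolding halts_with_iff halts_at_def by (metis less_linear)

lemma config_add_cong:
  assumes "config p y z u = config p y z u'"
  shows "config p y z (u + s) = config p y z (u' + s)"
proof (induction s rule: time_induct)
  case (limit s)
  have "limsup (\<lambda>d. Collect (v (config p y z d))) (u + s) =
      limsup (\<lambda>d. Collect (v (config p y z d))) (u' + s)"
    for v :: "cfg \<Rightarrow> nat \<Rightarrow> bool"
    unfolding limsup_add[OF limit(1)] by (rule limsup_cong) (simp add: limit(2))
  then show ?case unfolding config_limit[OF is_limit_add[OF limit(1)]] cfg_limsup_def by simp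
qed (simp_all add: assms)

section \<open>Transfinite simulation\<close>

text \<open>Between two stages a simulating run may show cells of either.\<close>

definition mixture :: "(time \<Rightarrow> nat set) \<Rightarrow> time set \<Rightarrow> nat set \<Rightarrow> bool" where
  "mixture f I X \<longleftrightarrow> (\<forall>n. \<exists>r\<in>I. (n \<in> X) = (n \<in> f r))"

lemma mixture_mono: "mixture f I X \<Longrightarrow> I \<subseteq> J \<Longrightarrow> mixture f J X"
  unfolding mixture_def by blast

lemma mixture_self: "r \<in> I \<Longrightarrow> mixture f I (f r)"
  unfolding mixture_def by blast

lemma mixture_const: "mixture f I X \<Longrightarrow> (\<And>r. r \<in> I \<Longrightarrow> f r = c) \<Longrightarrow> X = c"
  unfolding mixture_def by blast

lemma mixture_trans: "mixture f I X \<Longrightarrow> (\<And>r. r \<in> I \<Longrightarrow> mixture g J (f r)) \<Longrightarrow> mixture g J X"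
  unfolding mixture_def by metis

definition displays :: "(time \<Rightarrow> nat set) \<Rightarrow> (time \<Rightarrow> nat set) \<Rightarrow> bool" where
  "displays ob f \<longleftrightarrow> (\<forall>t. \<exists>u\<ge>t. ob u = f t) \<and> (\<forall>t. \<exists>u. \<forall>w\<ge>u. mixture f {t..} (ob w))"

lemma displays_trans:
  assumes "displays ob f" "displays f g"
  shows "displays ob g"
  unfolding displays_def
proof (intro conjI allI)
  fix t
  show "\<exists>u\<ge>t. ob u = g t" using assms unfolding displays_def by (metis order_trans)
  obtain v where v: "\<forall>r\<ge>v. mixture g {t..} (f r)" using assms(2) unfolding displays_def by blast
  obtain u where "\<forall>w\<ge>u. mixture f {v..} (ob w)" using assms(1) unfolding displays_def by blast
  then show "\<exists>u. \<forall>w\<ge>u. mixture g {t..} (ob w)" using v mixture_trans by (metis atLeast_iff)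
qed

lemma displays_vimage: "displays ob f \<Longrightarrow> displays (\<lambda>u. {n. h n \<in> ob u}) (\<lambda>t. {n. h n \<in> f t})"
  unfolding displays_def mixture_def mem_Collect_eq by metis

text \<open>\<open>stage_done u t\<close> says that the simulating run has, at its time \<open>u\<close>, completed stage \<open>t\<close> of the simulated
  run, whose states \<open>f t\<close> it shows as \<open>ob u\<close>.\<close>

locale simulation =
  fixes stage_done :: "time \<Rightarrow> time \<Rightarrow> bool" and stop :: "time \<Rightarrow> bool" and ob f :: "time \<Rightarrow> nat set"
      and start :: time
  assumes start: "stage_done start 0"
    and succ_stage: "\<And>u t. stage_done u t \<Longrightarrow> \<not> stop t \<Longrightarrow>
        \<exists>u'>u. stage_done u' (succ t) \<and> (\<forall>w\<in>{u..u'}. mixture f {t, succ t} (ob w))"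
    and limit_stage: "\<And>u t. is_limit t \<Longrightarrow> is_limit u \<Longrightarrow> (\<And>b. b < u \<Longrightarrow> \<exists>w s. b \<le> w \<and> w < u \<and> stage_done w s) \<Longrightarrow>
        ob u = f t \<Longrightarrow> \<exists>u'\<ge>u. stage_done u' t \<and> (\<forall>w\<in>{u..u'}. ob w = f t)"
    and ob_limit: "\<And>u. is_limit u \<Longrightarrow> ob u = limsup ob u"
    and f_limit: "\<And>t. is_limit t \<Longrightarrow> f t = limsup f t"
    and ob_eq: "\<And>u t. stage_done u t \<Longrightarrow> ob u = f t"
begin

definition completes_succ :: "time \<Rightarrow> time \<Rightarrow> time \<Rightarrow> bool" where
  "completes_succ t u u' \<longleftrightarrow> u < u' \<and> stage_done u' (succ t) \<and> (\<forall>w\<in>{u..u'}. mixture f {t, succ t} (ob w))"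

definition completes_limit :: "time \<Rightarrow> time \<Rightarrow> time \<Rightarrow> bool" where
  "completes_limit t u u' \<longleftrightarrow> u \<le> u' \<and> stage_done u' t \<and> (\<forall>w\<in>{u..u'}. ob w = f t)"

definition completion :: "time \<Rightarrow> time" where
  "completion = time_rec start (\<lambda>t u. SOME u'. completes_succ t u u')
     (\<lambda>g t. SOME u'. completes_limit t (strict_sup g t) u')"

lemma completion_zero: "completion 0 = start"
  unfolding completion_def by (rule time_rec_zero)

lemma completion_succ: "completion (succ t) = (SOME u'. completes_succ t (completion t) u')"
  unfolding completion_def by (rule time_rec_succ)

lemma completion_limit:
  assumes "is_limit t"
  shows "completion t = (SOME u'. completes_limit t (strict_sup completion t) u')"
  unfolding completion_def by (rule time_rec_limit[OF assms]) (simp cong: strict_sup_cong)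

definition faithful :: "time \<Rightarrow> bool" where
  "faithful t \<longleftrightarrow> stage_done (completion t) t \<and> (\<forall>s<t. completion s < completion t) \<and>
     (\<forall>s\<le>t. \<forall>w\<in>{completion s..completion t}. mixture f {s..t} (ob w))"

lemma faithful_less: "faithful t \<Longrightarrow> s < t \<Longrightarrow> completion s < completion t"
  unfolding faithful_def by blast

lemma faithful_mixture:
  "faithful t \<Longrightarrow> s \<le> t \<Longrightarrow> completion s \<le> w \<Longrightarrow> w \<le> completion t \<Longrightarrow> mixture f {s..t} (ob w)"
  unfolding faithful_def by simp

lemma faithful_zero: "faithful 0"
  unfolding faithful_def completion_zero using start ob_eq[OF start] mixture_self[of 0 "{0..0}" f]
  by (auto simp: completion_zero)

lemma faithful_succ:
  assumes "faithful t" "\<not> stop t"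
  shows "faithful (succ t)"
proof -
  have "\<exists>u'. completes_succ t (completion t) u'"
    unfolding completes_succ_def using succ_stage[of "completion t" t] assms unfolding faithful_def
    by blast
  then have "completes_succ t (completion t) (completion (succ t))" unfolding completion_succ
    by (rule someI_ex)
  then have less: "completion t < completion (succ t)"
      and don: "stage_done (completion (succ t)) (succ t)"
    and mix: "\<And>w. completion t \<le> w \<Longrightarrow> w \<le> completion (succ t) \<Longrightarrow> mixture f {t, succ t} (ob w)"
    unfolding completes_succ_def by auto
  have "mixture f {s..succ t} (ob w)" if s: "s \<le> succ t" and w: "completion s \<le> w"
    "w \<le> completion (succ t)" for s w
  proof (cases "s = succ t")
    case True
    then show ?thesis using w ob_eq[OF don] mixture_self[of "succ t" "{s..succ t}" f] by auto
  next
    case False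
    then have "s \<le> t" using s le_succ_iff by blast
    show ?thesis
    proof (cases "w \<le> completion t")
      case True
      then have "mixture f {s..t} (ob w)" using faithful_mixture[OF assms(1) \<open>s \<le> t\<close> w(1)] by blast
      then show ?thesis by (rule mixture_mono) (auto intro: order_trans[OF _ le_succ])
    next
      case False
      then have "mixture f {t, succ t} (ob w)" using mix w(2) by simp
      then show ?thesis by (rule mixture_mono) (use \<open>s \<le> t\<close> s in auto)
    qed
  qed
  moreover have "completion s < completion (succ t)" if "s < succ t" for s
    using that faithful_less[OF assms(1)] less unfolding less_succ_iff
    by (metis le_less order.strict_trans)
  ultimately show ?thesis unfolding faithful_def using don by auto
qed

context
  fixes t u
  assumes t_limit: "is_limit t" and below: "\<And>s. s < t \<Longrightarrow> faithful s"
      and u_def: "u = strict_sup completion t"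
begin

lemma completion_less_sup: "s < t \<Longrightarrow> completion s < u"
  unfolding u_def by (rule less_strict_sup)

lemma is_limit_sup: "is_limit u"
  unfolding u_def using faithful_less[OF below less_succ] is_limit_succ_less[OF t_limit]
  by (intro is_limit_strict_sup[OF t_limit]) blast

lemma cofinal_completion: "w < u \<Longrightarrow> s < t \<Longrightarrow> \<exists>s'<t. s \<le> s' \<and> w \<le> completion s'"
proof -
  assume "w < u" "s < t"
  then obtain s' where s': "s' < t" "w \<le> completion s'" using less_strict_supD unfolding u_def by blast
  show ?thesis
  proof (cases "s \<le> s'")
    case False
    then have "completion s' < completion s" using faithful_less[OF below[OF \<open>s < t\<close>]] by simp
    then show ?thesis using s' \<open>s < t\<close> by (intro exI[of _ s]) auto
  qed (use s' in blast)
qed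

lemma ob_sup: "ob u = f t"
  unfolding ob_limit[OF is_limit_sup] f_limit[OF t_limit]
proof (intro set_eqI iffI)
  fix n assume n: "n \<in> limsup ob u"
  show "n \<in> limsup f t"
  proof (rule in_limsupI)
    fix b assume b: "b < t"
    then obtain w where w: "completion b \<le> w" "w < u" "n \<in> ob w" using n completion_less_sup
      by (blast elim: in_limsupD)
    then obtain s where s: "s < t" "b \<le> s" "w \<le> completion s" using cofinal_completion b by blast
    then have "mixture f {b..s} (ob w)" using faithful_mixture[OF below] w(1) by blast
    then obtain r where "r \<in> {b..s}" "n \<in> f r" using w(3) unfolding mixture_def by blast
    then show "\<exists>d. b \<le> d \<and> d < t \<and> n \<in> f d" using s(1) by (auto intro: le_less_trans)
  qed
next
  fix n assume n: "n \<in> limsup f t"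
  show "n \<in> limsup ob u"
  proof (rule in_limsupI)
    fix w assume "w < u"
    then obtain s where s: "s < t" "w \<le> completion s"
      using cofinal_completion[OF _ is_limit_pos[OF t_limit]] by blast
    then obtain d where d: "s \<le> d" "d < t" "n \<in> f d" using n by (blast elim: in_limsupD)
    then have "w \<le> completion d" using s(2) faithful_less[OF below[OF d(2)], of s]
      by (auto simp: le_less)
    moreover have "ob (completion d) = f d" using below[OF d(2)] ob_eq unfolding faithful_def by blast
    ultimately show "\<exists>d. w \<le> d \<and> d < u \<and> n \<in> ob d" using completion_less_sup d by blast
  qed
qed

lemma faithful_limit: "faithful t"
proof -
  have "\<exists>w s. b \<le> w \<and> w < u \<and> stage_done w s" if "b < u" for b
    using cofinal_completion[OF that is_limit_pos[OF t_limit]] completion_less_sup below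
    unfolding faithful_def by blast
  then have "\<exists>u'. completes_limit t u u'"
    unfolding completes_limit_def using limit_stage[OF t_limit is_limit_sup _ ob_sup] by blast
  then have "completes_limit t u (completion t)"
    unfolding completion_limit[OF t_limit] u_def by (rule someI_ex)
  then have limit_stage_le: "u \<le> completion t" and stage: "stage_done (completion t) t"
    and const: "\<And>w. u \<le> w \<Longrightarrow> w \<le> completion t \<Longrightarrow> ob w = f t"
    unfolding completes_limit_def by auto
  have "mixture f {s..t} (ob w)" if s: "s \<le> t" and w: "completion s \<le> w" "w \<le> completion t" for s w
  proof (cases "u \<le> w")
    case True
    then show ?thesis using const w(2) s mixture_self[of t "{s..t}" f] by simp
  next
    case False
    then have "s < t" using s w(1) limit_stage_le by (metis le_less order_trans)
    then obtain s' where s': "s' < t" "s \<le> s'" "w \<le> completion s'"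
      using cofinal_completion[of w s] False by (auto simp: not_le)
    then have "mixture f {s..s'} (ob w)" using faithful_mixture[OF below] w(1) by blast
    then show ?thesis by (rule mixture_mono) (use s'(1) in auto)
  qed
  moreover have "completion s < completion t" if "s < t" for s
    using completion_less_sup[OF that] limit_stage_le by simp
  ultimately show ?thesis unfolding faithful_def using stage by auto
qed

end

lemma faithful: "(\<And>s. s < t \<Longrightarrow> \<not> stop s) \<Longrightarrow> faithful t"
proof (induction t rule: time_induct)
  case zero
  show ?case by (rule faithful_zero)
next
  case (succ t)
  then show ?case by (intro faithful_succ) (auto simp: less_succ_iff)
next
  case (limit t)
  show ?case by (rule faithful_limit[OF limit(1) _ refl]) (use limit in \<open>meson order.strict_trans\<close>)
qed

lemma le_completion: "(\<And>s. s < t \<Longrightarrow> \<not> stop s) \<Longrightarrow> t \<le> completion t"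
  by (rule strict_mono_imp_increasing_time, rule faithful_less[OF faithful]) (auto intro: less_le_trans)

theorem ex_stage_done:
  assumes "\<And>s. s < t \<Longrightarrow> \<not> stop s"
  shows "\<exists>u\<ge>t. stage_done u t"
  using faithful[OF assms] le_completion[OF assms] unfolding faithful_def by blast

theorem displays_simulated:
  assumes "\<And>t. \<not> stop t"
  shows "displays ob f"
  unfolding displays_def
proof (intro conjI allI)
  fix t
  show "\<exists>u\<ge>t. ob u = f t" using ex_stage_done assms ob_eq by blast
  have "mixture f {t..} (ob w)" if "completion t \<le> w" for w
  proof -
    have "w \<le> completion (max t w)" using le_completion[OF assms, of "max t w"] by simp
    then have "mixture f {t..max t w} (ob w)" using faithful_mixture[OF faithful[OF assms] _ that]
      by simp
    then show ?thesis by (rule mixture_mono) auto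
  qed
  then show "\<exists>u. \<forall>w\<ge>u. mixture f {t..} (ob w)" by blast
qed

end

section \<open>Finitary operators and loop programs\<close>

abbreviation pair :: "nat \<Rightarrow> nat \<Rightarrow> nat" where "pair a b \<equiv> prod_encode (a, b)"
definition pfst :: "nat \<Rightarrow> nat" where "pfst n = fst (prod_decode n)"
definition psnd :: "nat \<Rightarrow> nat" where "psnd n = snd (prod_decode n)"

lemma pfst_pair [simp]: "pfst (pair a b) = a" and psnd_pair [simp]: "psnd (pair a b) = b"
  unfolding pfst_def psnd_def by auto

lemma pair_collapse [simp]: "pair (pfst n) (psnd n) = n"
  unfolding pfst_def psnd_def by simp

lemma pair_0_0: "pair 0 0 = 0"
  by (simp add: prod_encode_def)

lemma pair_eq_0_iff [simp]: "pair a b = 0 \<longleftrightarrow> a = 0 \<and> b = 0"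
  using prod_encode_eq[of "(a, b)" "(0, 0)"] pair_0_0 by auto

lemma pfst_zero [simp]: "pfst 0 = 0" and psnd_zero [simp]: "psnd 0 = 0"
  using pfst_pair[of 0 0] psnd_pair[of 0 0] by (simp_all add: pair_0_0)

lemma pfst_Suc: "pfst (Suc n) = (if psnd n = 0 then 0 else Suc (pfst n))" (is "_ = ?a")
  and psnd_Suc: "psnd (Suc n) = (if psnd n = 0 then Suc (pfst n) else psnd n - 1)" (is "_ = ?b")
proof -
  have "pair ?a ?b = Suc (pair (pfst n) (psnd n))"
    by (auto simp: prod_encode_def simp del: pair_collapse)
  then have "Suc n = pair ?a ?b" by simp
  then show "pfst (Suc n) = ?a" "psnd (Suc n) = ?b" by (metis pfst_pair psnd_pair)+
qed

inductive prim_rec :: "(nat \<Rightarrow> nat) \<Rightarrow> bool" where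
  prim_rec_id: "prim_rec (\<lambda>n. n)"
| prim_rec_zero: "prim_rec (\<lambda>n. 0)"
| prim_rec_Suc: "prim_rec f \<Longrightarrow> prim_rec (\<lambda>n. Suc (f n))"
| prim_rec_pfst: "prim_rec f \<Longrightarrow> prim_rec (\<lambda>n. pfst (f n))"
| prim_rec_psnd: "prim_rec f \<Longrightarrow> prim_rec (\<lambda>n. psnd (f n))"
| prim_rec_pair: "prim_rec f \<Longrightarrow> prim_rec g \<Longrightarrow> prim_rec (\<lambda>n. pair (f n) (g n))"
| prim_rec_funpow: "prim_rec h \<Longrightarrow> prim_rec f \<Longrightarrow> prim_rec g \<Longrightarrow> prim_rec (\<lambda>n. (h ^^ g n) (f n))"

lemma prim_rec_comp: "prim_rec f \<Longrightarrow> prim_rec g \<Longrightarrow> prim_rec (\<lambda>n. f (g n))"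
proof (induction rule: prim_rec.induct)
  case (prim_rec_funpow h f k)
  from prim_rec.prim_rec_funpow[OF prim_rec_funpow.hyps(1) prim_rec_funpow.IH(2,3)] prim_rec_funpow.prems
  show ?case by simp
qed (auto intro: prim_rec.intros)

lemma prim_rec_const: "prim_rec (\<lambda>n. k)"
  by (induction k) (auto intro: prim_rec.intros)

lemma prim_rec_if_zero:
  assumes "prim_rec c" "prim_rec f" "prim_rec g"
  shows "prim_rec (\<lambda>n. if c n = 0 then f n else g n)"
proof -
  have "((\<lambda>s. pair (psnd s) (psnd s)) ^^ k) (pair a b) = (if k = 0 then pair a b else pair b b)"
      for k a b
    by (induction k) auto
  then have "(\<lambda>n. pfst (((\<lambda>s. pair (psnd s) (psnd s)) ^^ c n) (pair (f n) (g n)))) =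
      (\<lambda>n. if c n = 0 then f n else g n)"
    by (intro ext) simp
  moreover have "prim_rec (\<lambda>n. pfst (((\<lambda>s. pair (psnd s) (psnd s)) ^^ c n) (pair (f n) (g n))))"
    by (intro prim_rec.intros assms)
  ultimately show ?thesis by simp
qed

lemma prim_rec_pred: assumes "prim_rec f" shows "prim_rec (\<lambda>n. f n - 1)"
proof -
  have iter: "((\<lambda>s. pair (psnd s) (Suc (psnd s))) ^^ k) (pair 0 0) = pair (k - 1) k" for k
    by (induction k) auto
  have "prim_rec (\<lambda>n. pfst (((\<lambda>s. pair (psnd s) (Suc (psnd s))) ^^ f n) (pair 0 0)))"
    by (intro prim_rec.intros assms)
  then show ?thesis unfolding iter pfst_pair .
qed

lemma prim_rec_minus: assumes "prim_rec f" "prim_rec g" shows "prim_rec (\<lambda>n. f n - g n)"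
proof -
  have iter: "((\<lambda>n. n - 1) ^^ k) a = a - k" for k a :: nat by (induction k) auto
  have "prim_rec (\<lambda>n. ((\<lambda>n. n - 1) ^^ g n) (f n))"
    by (intro prim_rec_funpow prim_rec_pred prim_rec_id assms)
  then show ?thesis unfolding iter .
qed

lemma prim_rec_plus: assumes "prim_rec f" "prim_rec g" shows "prim_rec (\<lambda>n. f n + g n)"
proof -
  have iter: "(Suc ^^ k) a = a + k" for k a by (induction k) auto
  have "prim_rec (\<lambda>n. ((\<lambda>n. Suc n) ^^ g n) (f n))"
    by (intro prim_rec_funpow prim_rec_Suc prim_rec_id assms)
  then show ?thesis unfolding iter .
qed

lemma prim_rec_if_eq:
  assumes "prim_rec a" "prim_rec b" "prim_rec f" "prim_rec g"
  shows "prim_rec (\<lambda>n. if a n = b n then f n else g n)"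
proof -
  have "prim_rec (\<lambda>n. if (a n - b n) + (b n - a n) = 0 then f n else g n)"
    by (intro prim_rec_if_zero prim_rec_plus prim_rec_minus assms)
  moreover have "(a n - b n) + (b n - a n) = 0 \<longleftrightarrow> a n = b n" for n by auto
  ultimately show ?thesis by simp
qed

lemma prim_rec_half: assumes "prim_rec f" shows "prim_rec (\<lambda>n. f n div 2)"
proof -
  have iter: "((\<lambda>s. pair (psnd s) (Suc (pfst s))) ^^ k) (pair 0 0) = pair (k div 2) (Suc k div 2)" for k
    by (induction k) auto
  have "prim_rec (\<lambda>n. pfst (((\<lambda>s. pair (psnd s) (Suc (pfst s))) ^^ f n) (pair 0 0)))"
    by (intro prim_rec.intros assms)
  then show ?thesis unfolding iter pfst_pair .
qed

lemma prim_rec_div_power2: assumes "prim_rec f" "prim_rec g" shows "prim_rec (\<lambda>n. f n div 2 ^ g n)"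
proof -
  have iter: "((\<lambda>m. m div 2) ^^ k) a = a div 2 ^ k" for k a :: nat
    by (induction k) (simp_all add: div_mult2_eq[symmetric] mult.commute)
  have "prim_rec (\<lambda>n. ((\<lambda>m. m div 2) ^^ g n) (f n))"
    by (intro prim_rec_funpow prim_rec_half prim_rec_id assms)
  then show ?thesis unfolding iter .
qed

lemma prim_rec_mod2: assumes "prim_rec f" shows "prim_rec (\<lambda>n. f n mod 2)"
proof -
  have "prim_rec (\<lambda>n. f n - (f n div 2 + f n div 2))"
    by (intro prim_rec_minus prim_rec_plus prim_rec_half assms)
  moreover have "k - (k div 2 + k div 2) = k mod 2" for k :: nat by presburger
  ultimately show ?thesis by simp
qed

lemmas prim_rec_rules = prim_rec_const prim_rec_id prim_rec_Suc prim_rec_pfst prim_rec_psnd prim_rec_pair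
  prim_rec_plus prim_rec_minus prim_rec_if_eq

text \<open>Predicates decided in finitely many steps from an oracle \<open>y\<close> and a tape \<open>X\<close>.\<close>

inductive finitary :: "(nat set \<Rightarrow> nat set \<Rightarrow> nat \<Rightarrow> bool) \<Rightarrow> bool" where
  finitary_tape: "prim_rec f \<Longrightarrow> finitary (\<lambda>y X n. f n \<in> X)"
| finitary_oracle: "prim_rec f \<Longrightarrow> finitary (\<lambda>y X n. f n \<in> y)"
| finitary_eq_zero: "prim_rec f \<Longrightarrow> finitary (\<lambda>y X n. f n = 0)"
| finitary_not: "finitary Q \<Longrightarrow> finitary (\<lambda>y X n. \<not> Q y X n)"
| finitary_conj: "finitary Q \<Longrightarrow> finitary R \<Longrightarrow> finitary (\<lambda>y X n. Q y X n \<and> R y X n)"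

definition finitary_op :: "(nat set \<Rightarrow> nat set \<Rightarrow> nat set) \<Rightarrow> bool" where
  "finitary_op F \<longleftrightarrow> finitary (\<lambda>y X n. n \<in> F y X)"

lemma finitary_opI: "finitary (\<lambda>y X n. Q y X n) \<Longrightarrow> finitary_op (\<lambda>y X. {n. Q y X n})"
  unfolding finitary_op_def by simp

lemma finitary_comp:
  assumes "finitary Q" "prim_rec f"
  shows "finitary (\<lambda>y X n. Q y X (f n))"
  using assms
proof (induction rule: finitary.induct)
  case (finitary_tape g)
  then show ?case using finitary.finitary_tape[OF prim_rec_comp] by blast
next
  case (finitary_oracle g)
  then show ?case using finitary.finitary_oracle[OF prim_rec_comp] by blast
next
  case (finitary_eq_zero g)
  then show ?case using finitary.finitary_eq_zero[OF prim_rec_comp] by blast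
next
  case (finitary_not Q)
  then show ?case using finitary.finitary_not by blast
next
  case (finitary_conj Q R)
  then show ?case using finitary.finitary_conj by blast
qed

lemma finitary_mem: "finitary_op F \<Longrightarrow> prim_rec f \<Longrightarrow> finitary (\<lambda>y X n. f n \<in> F y X)"
  unfolding finitary_op_def by (rule finitary_comp)

lemma finitary_subst:
  assumes "finitary Q" "finitary_op E" "finitary_op F"
  shows "finitary (\<lambda>y X n. Q (E y X) (F y X) n)"
  using assms by (induction rule: finitary.induct) (auto intro: finitary.intros finitary_mem)

lemma finitary_op_comp:
  assumes "finitary_op G" "finitary_op E" "finitary_op F"
  shows "finitary_op (\<lambda>y X. G (E y X) (F y X))"
  using finitary_subst[of "\<lambda>y X n. n \<in> G y X" E F] assms unfolding finitary_op_def by blast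

lemma finitary_disj: assumes "finitary Q" "finitary R" shows "finitary (\<lambda>y X n. Q y X n \<or> R y X n)"
proof -
  have "finitary (\<lambda>y X n. \<not> (\<not> Q y X n \<and> \<not> R y X n))" by (intro finitary_not finitary_conj assms)
  then show ?thesis by simp
qed

lemma finitary_le: assumes "prim_rec f" "prim_rec g" shows "finitary (\<lambda>y X n. f n \<le> g n)"
proof -
  have "finitary (\<lambda>y X n. f n - g n = 0)" by (intro finitary_eq_zero prim_rec_minus assms)
  then show ?thesis by simp
qed

lemma finitary_less: assumes "prim_rec f" "prim_rec g" shows "finitary (\<lambda>y X n. f n < g n)"
  using finitary_le[OF prim_rec_Suc[OF assms(1)] assms(2)] by (simp add: Suc_le_eq)

lemma finitary_eq: assumes "prim_rec f" "prim_rec g" shows "finitary (\<lambda>y X n. f n = g n)"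
  unfolding order_eq_iff by (intro finitary_conj finitary_le assms)

lemma finitary_bit: assumes "prim_rec f" "prim_rec g" shows "finitary (\<lambda>y X n. bit (f n) (g n))"
  unfolding bit_iff_odd odd_iff_mod_2_eq_one
  by (intro finitary_eq prim_rec_mod2 prim_rec_div_power2 prim_rec_const assms)

lemma finitary_const: "finitary (\<lambda>y X n. b)"
  using finitary_eq_zero[OF prim_rec_const[of 0]] finitary_not[OF finitary_eq_zero[OF prim_rec_const[of 0]]]
  by (cases b) auto

lemma finitary_imp: assumes "finitary Q" "finitary R" shows "finitary (\<lambda>y X n. Q y X n \<longrightarrow> R y X n)"
  unfolding imp_conv_disj by (rule finitary_disj[OF finitary_not[OF assms(1)] assms(2)])

lemma finitary_if:
  assumes "finitary C" "finitary Q" "finitary R"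
  shows "finitary (\<lambda>y X n. if C y X n then Q y X n else R y X n)"
proof -
  have "finitary (\<lambda>y X n. (C y X n \<longrightarrow> Q y X n) \<and> (\<not> C y X n \<longrightarrow> R y X n))"
    by (intro finitary_conj finitary_imp finitary_not assms)
  then show ?thesis unfolding if_bool_eq_conj .
qed

lemma finitary_op_if:
  assumes "finitary (\<lambda>y X n. C y X)" "finitary_op F" "finitary_op G"
  shows "finitary_op (\<lambda>y X. if C y X then F y X else G y X)"
  using finitary_if[OF assms[unfolded finitary_op_def]] unfolding finitary_op_def
  by (simp add: if_distrib)

lemma finitary_op_Un: "finitary_op F \<Longrightarrow> finitary_op G \<Longrightarrow> finitary_op (\<lambda>y X. F y X \<union> G y X)"
  unfolding finitary_op_def Un_iff by (rule finitary_disj)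

lemma finitary_op_empty: "finitary_op (\<lambda>y X. {})"
  unfolding finitary_op_def by (simp add: finitary_const)

lemma finitary_op_insert: "finitary_op F \<Longrightarrow> finitary_op (\<lambda>y X. insert k (F y X))"
  unfolding finitary_op_def insert_iff by (intro finitary_disj finitary_eq prim_rec_id prim_rec_const)

lemma finitary_op_tape: "finitary_op (\<lambda>y X. X)"
  unfolding finitary_op_def by (intro finitary_tape prim_rec_id)

lemma finitary_op_oracle: "finitary_op (\<lambda>y X. y)"
  unfolding finitary_op_def by (intro finitary_oracle prim_rec_id)

text \<open>Loop programs on registers: \<open>Query b\<close> adds to register 1 the bit of the oracle (if \<open>b\<close>) or of the tape (if not)
  at the address in register 0, and \<open>Put\<close> writes a bit at that address to another tape, not modelled by \<open>exec\<close>.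
  A loop counts its register down and must not touch it otherwise.\<close>

datatype com = Skip | Inc nat | Dec nat | Seq com com | Cond nat com com | Loop nat com | Query bool
| Put bool

fun exec :: "nat set \<Rightarrow> nat set \<Rightarrow> com \<Rightarrow> (nat \<Rightarrow> nat) \<Rightarrow> nat \<Rightarrow> nat" where
  "exec y X Skip s = s"
| "exec y X (Inc i) s = s(i := Suc (s i))"
| "exec y X (Dec i) s = s(i := s i - 1)"
| "exec y X (Seq c d) s = exec y X d (exec y X c s)"
| "exec y X (Cond i c d) s = (if s i \<noteq> 0 then exec y X c s else exec y X d s)"
| "exec y X (Loop i c) s = ((\<lambda>s. exec y X c (s(i := s i - 1))) ^^ s i) s"
| "exec y X (Query b) s = (if s 0 \<in> (if b then y else X) then s(1 := Suc (s 1)) else s)"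
| "exec y X (Put b) s = s"

fun writes :: "com \<Rightarrow> nat set" where
  "writes (Inc i) = {i}" | "writes (Dec i) = {i}" | "writes (Seq c d) = writes c \<union> writes d"
| "writes (Cond i c d) = writes c \<union> writes d" | "writes (Loop i c) = insert i (writes c)"
| "writes (Query b) = {1}" | "writes _ = {}"

fun wf_com :: "com \<Rightarrow> bool" where
  "wf_com (Seq c d) \<longleftrightarrow> wf_com c \<and> wf_com d" | "wf_com (Cond i c d) \<longleftrightarrow> wf_com c \<and> wf_com d"
| "wf_com (Loop i c) \<longleftrightarrow> i \<notin> writes c \<and> wf_com c" | "wf_com (Put b) \<longleftrightarrow> False" | "wf_com _ \<longleftrightarrow> True"

lemma exec_unchanged: "i \<notin> writes c \<Longrightarrow> exec y X c s i = s i"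
proof (induction c arbitrary: s)
  case (Loop j c)
  have "((\<lambda>s. exec y X c (s(j := s j - 1))) ^^ k) s i = s i" for k
    by (induction k) (use Loop in auto)
  then show ?case by simp
qed auto

definition clear :: "nat \<Rightarrow> com" where "clear i = Loop i Skip"
definition move :: "nat \<Rightarrow> nat \<Rightarrow> com" where "move i j = Loop i (Inc j)"
definition copy :: "nat \<Rightarrow> nat \<Rightarrow> nat \<Rightarrow> com" where
  "copy i j t = Seq (clear j) (Seq (clear t) (Seq (Loop i (Seq (Inc j) (Inc t))) (move t i)))"

lemma clear [simp]: "exec y X (clear i) s = s(i := 0)" "writes (clear i) = {i}" "wf_com (clear i)"
proof -
  have "((\<lambda>s. s(i := s i - Suc 0)) ^^ k) s = s(i := s i - k)" for k
    by (induction k) auto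
  then show "exec y X (clear i) s = s(i := 0)" by (simp add: clear_def)
qed (auto simp: clear_def)

lemma exec_move:
  assumes "i \<noteq> j"
  shows "exec y X (move i j) s = s(i := 0, j := s j + s i)"
proof -
  have "((\<lambda>s. exec y X (Inc j) (s(i := s i - 1))) ^^ k) s = s(i := s i - k, j := s j + k)" for k
  proof (induction k)
    case (Suc k)
    show ?case unfolding funpow.simps o_apply Suc.IH using assms by (simp add: fun_eq_iff)
  qed (use assms in \<open>simp add: fun_eq_iff\<close>)
  then show ?thesis by (simp add: move_def)
qed

lemma wf_move: "i \<noteq> j \<Longrightarrow> writes (move i j) = {i, j}" "i \<noteq> j \<Longrightarrow> wf_com (move i j)"
  by (auto simp: move_def)

lemma exec_copy:
  assumes "i \<noteq> j" "i \<noteq> t" "j \<noteq> t"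
  shows "exec y X (copy i j t) s = s(j := s i, t := 0)"
proof -
  have "((\<lambda>s. exec y X (Seq (Inc j) (Inc t)) (s(i := s i - 1))) ^^ k) s =
      s(i := s i - k, j := s j + k, t := s t + k)" for k s
  proof (induction k)
    case (Suc k)
    show ?case unfolding funpow.simps o_apply Suc.IH using assms by (simp add: fun_eq_iff)
  qed (use assms in \<open>simp add: fun_eq_iff\<close>)
  then have loop: "exec y X (Loop i (Seq (Inc j) (Inc t))) s =
      s(i := 0, j := s j + s i, t := s t + s i)" for s
    by (simp only: exec.simps diff_self_eq_0)
  show ?thesis
    unfolding copy_def exec.simps(4) clear loop exec_move[OF assms(2)[symmetric]] using assms
    by (simp add: fun_eq_iff)
qed

lemma wf_copy:
  assumes "i \<noteq> j" "i \<noteq> t" "j \<noteq> t"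
  shows "writes (copy i j t) = {i, j, t}" "wf_com (copy i j t)"
  using assms by (auto simp: copy_def wf_move)

text \<open>Computes \<open>m + triangle (m + n)\<close> by repeatedly adding an increasing counter.\<close>

definition encode_pair :: "nat \<Rightarrow> com" where
  "encode_pair m = Seq (copy m (m+2) (m+3)) (Seq (move (m+1) (m+2))
     (Loop (m+2) (Seq (Inc (m+1)) (Seq (copy (m+1) (m+3) (m+4)) (move (m+3) m)))))"

lemma exec_encode_pair: "exec y X (encode_pair m) s m = pair (s m) (s (m+1))"
proof -
  define B where "B =
      (\<lambda>s. exec y X (Seq (Inc (m+1)) (Seq (copy (m+1) (m+3) (m+4)) (move (m+3) m))) (s(m+2 := s (m+2) - 1)))"
  have B: "B s m = s m + Suc (s (m+1))" "B s (m+1) = Suc (s (m+1))" for s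
    unfolding B_def by (simp_all add: exec_copy exec_move)
  have B_funpow: "(B ^^ k) s m = s m + triangle k + k * s (m+1) \<and> (B ^^ k) s (m+1) = s (m+1) + k" for k s
    by (induction k) (simp_all add: B del: One_nat_def add_Suc_right)
  define s' where "s' = exec y X (move (m+1) (m+2)) (exec y X (copy m (m+2) (m+3)) s)"
  have s': "s' m = s m" "s' (m+1) = 0" "s' (m+2) = s m + s (m+1)" unfolding s'_def
    by (simp_all add: exec_copy exec_move)
  have "exec y X (encode_pair m) s = (B ^^ (s' (m+2))) s'"
    by (simp only: encode_pair_def exec.simps B_def s'_def)
  then have "exec y X (encode_pair m) s m = s m + triangle (s m + s (m+1))"
    using B_funpow[of _ s'] s' by simp
  then show ?thesis by (simp add: prod_encode_def)
qed

lemma wf_encode_pair: "j < m \<Longrightarrow> j \<notin> writes (encode_pair m)" "wf_com (encode_pair m)"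
  by (auto simp: encode_pair_def wf_move wf_copy)

text \<open>Walks along the enumeration of pairs by \<open>pfst_Suc\<close> and \<open>psnd_Suc\<close>.\<close>

definition decode_pair :: "nat \<Rightarrow> com" where
  "decode_pair m = Seq (clear (m+2)) (Seq (move m (m+2)) (Seq (clear (m+1))
     (Loop (m+2) (Cond (m+1) (Seq (Dec (m+1)) (Inc m)) (Seq (move m (m+1)) (Inc (m+1)))))))"

lemma exec_decode_pair: "exec y X (decode_pair m) s m = pfst (s m)"
  "exec y X (decode_pair m) s (m+1) = psnd (s m)"
proof -
  define B where "B =
      (\<lambda>s. exec y X (Cond (m+1) (Seq (Dec (m+1)) (Inc m)) (Seq (move m (m+1)) (Inc (m+1)))) (s(m+2 := s (m+2) - 1)))"
  have B: "B s m = (if s (m+1) = 0 then 0 else Suc (s m))"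
    "B s (m+1) = (if s (m+1) = 0 then Suc (s m) else s (m+1) - 1)" for s
    unfolding B_def by (simp_all add: exec_move)
  have B_funpow: "s m = 0 \<Longrightarrow> s (m+1) = 0 \<Longrightarrow> (B ^^ k) s m = pfst k \<and> (B ^^ k) s (m+1) = psnd k" for k s
    by (induction k) (simp_all add: B pfst_Suc psnd_Suc del: One_nat_def add_Suc_right)
  define s' where "s' = exec y X (clear (m+1)) (exec y X (move m (m+2)) (exec y X (clear (m+2)) s))"
  have s': "s' m = 0" "s' (m+1) = 0" "s' (m+2) = s m" unfolding s'_def by (simp_all add: exec_move)
  have "exec y X (decode_pair m) s = (B ^^ (s' (m+2))) s'"
    by (simp only: decode_pair_def exec.simps B_def s'_def)
  then show "exec y X (decode_pair m) s m = pfst (s m)" "exec y X (decode_pair m) s (m+1) = psnd (s m)"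
    using B_funpow[of s', OF s'(1,2)] s'(3) by simp_all
qed

lemma wf_decode_pair: "j < m \<Longrightarrow> j \<notin> writes (decode_pair m)" "wf_com (decode_pair m)"
  by (auto simp: decode_pair_def wf_move)

definition computes :: "nat \<Rightarrow> com \<Rightarrow> (nat \<Rightarrow> nat) \<Rightarrow> bool" where
  "computes m c f \<longleftrightarrow> wf_com c \<and> (\<forall>j<m. j \<notin> writes c) \<and> (\<forall>y X s. exec y X c s m = f (s m))"

lemma computes_pair:
  assumes "computes (m+2) c f" "computes (m+1) d g"
  shows "computes m (Seq (copy m (m+1) (m+2)) (Seq d (Seq (copy m (m+2) (m+3)) (Seq c
    (Seq (clear m) (Seq (move (m+2) m) (encode_pair m))))))) (\<lambda>n. pair (f n) (g n))"
proof -
  have "m \<notin> writes d" "m \<notin> writes c" "m+1 \<notin> writes c" using assms unfolding computes_def by auto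
  then show ?thesis using assms unfolding computes_def
    by (auto simp: exec_copy wf_copy exec_move wf_move exec_encode_pair wf_encode_pair exec_unchanged simp del: One_nat_def)
qed

lemma computes_funpow:
  assumes "computes (m+2) b h" "computes (m+2) c f" "computes (m+1) d g"
  shows "computes m (Seq (copy m (m+1) (m+2)) (Seq d (Seq (copy m (m+2) (m+3)) (Seq c
    (Seq (Loop (m+1) b) (Seq (clear m) (move (m+2) m))))))) (\<lambda>n. (h ^^ g n) (f n))"
proof -
  have "m \<notin> writes d" "m \<notin> writes c" "m+1 \<notin> writes c" "m \<notin> writes b" "m+1 \<notin> writes b"
    using assms unfolding computes_def by auto
  moreover have "((\<lambda>s. exec y X b (s(m+1 := s (m+1) - 1))) ^^ k) s (m+2) = (h ^^ k) (s (m+2))"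
      for y X k s
    by (induction k) (use assms(1) in \<open>auto simp: computes_def\<close>)
  ultimately show ?thesis using assms unfolding computes_def
    by (auto simp: exec_copy wf_copy exec_move wf_move exec_unchanged simp del: One_nat_def)
qed

lemma prim_rec_computes: "prim_rec f \<Longrightarrow> \<exists>c. computes m c f"
proof (induction arbitrary: m rule: prim_rec.induct)
  case prim_rec_id
  show ?case by (rule exI[of _ Skip]) (simp add: computes_def)
next
  case prim_rec_zero
  show ?case by (rule exI[of _ "clear m"]) (simp add: computes_def)
next
  case (prim_rec_Suc f)
  then obtain c where "computes m c f" by meson
  then show ?case by (intro exI[of _ "Seq c (Inc m)"]) (auto simp: computes_def)
next
  case (prim_rec_pfst f)
  then obtain c where "computes m c f" by meson
  then show ?case
    by (intro exI[of _ "Seq c (decode_pair m)"])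
       (auto simp: computes_def exec_decode_pair wf_decode_pair)
next
  case (prim_rec_psnd f)
  then obtain c where "computes m c f" by meson
  then show ?case using exec_decode_pair(2)[of _ _ m]
    by (intro exI[of _ "Seq c (Seq (decode_pair m) (Seq (clear m) (move (m+1) m)))"])
      (auto simp: computes_def wf_decode_pair exec_move wf_move)
next
  case (prim_rec_pair f g)
  then show ?case using computes_pair by meson
next
  case (prim_rec_funpow h f g)
  then show ?case using computes_funpow by meson
qed

definition evaluates :: "nat \<Rightarrow> com \<Rightarrow> (nat set \<Rightarrow> nat set \<Rightarrow> nat \<Rightarrow> bool) \<Rightarrow> bool" where
  "evaluates m c Q \<longleftrightarrow> wf_com c \<and> (\<forall>j\<ge>2. j < m \<longrightarrow> j \<notin> writes c) \<and>
     (\<forall>y X s. s 0 = 0 \<longrightarrow> s 1 = 0 \<longrightarrow>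
        exec y X c s m = of_bool (Q y X (s m)) \<and> exec y X c s 0 = 0 \<and> exec y X c s 1 = 0)"

lemma evaluates_query:
  assumes c: "computes m c f" and m: "2 \<le> m"
  shows "evaluates m (Seq c (Seq (move m 0) (Seq (Query b) (Seq (clear 0) (move 1 m)))))
    (\<lambda>y X n. f n \<in> (if b then y else X))"
proof -
  have "exec y X c s 0 = s 0" "exec y X c s (Suc 0) = s (Suc 0)" for y X s
    using c m by (simp_all add: computes_def exec_unchanged)
  then show ?thesis using c m unfolding evaluates_def computes_def by (auto simp: wf_move exec_move)
qed

lemma evaluates_eq_zero:
  assumes c: "computes m c f" and m: "2 \<le> m"
  shows "evaluates m (Seq c (Cond m (clear m) (Inc m))) (\<lambda>y X n. f n = 0)"
proof -
  have "exec y X c s 0 = s 0" "exec y X c s (Suc 0) = s (Suc 0)" for y X s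
    using c m by (simp_all add: computes_def exec_unchanged)
  then show ?thesis using c m unfolding evaluates_def computes_def by auto
qed

lemma evaluates_not:
  "evaluates m c Q \<Longrightarrow> 2 \<le> m \<Longrightarrow> evaluates m (Seq c (Cond m (clear m) (Inc m))) (\<lambda>y X n. \<not> Q y X n)"
  unfolding evaluates_def by auto

lemma evaluates_conj:
  assumes c: "evaluates (m+1) c Q" and d: "evaluates m d R" and m: "2 \<le> m"
  shows "evaluates m (Seq (copy m (m+1) (m+2)) (Seq c (Cond (m+1) d (clear m)))) (\<lambda>y X n. Q y X n \<and>
      R y X n)"
    (is "evaluates m ?c _")
  unfolding evaluates_def
proof (intro conjI allI impI)
  show "wf_com ?c" "\<And>j. 2 \<le> j \<Longrightarrow> j < m \<Longrightarrow> j \<notin> writes ?c"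
    using c d unfolding evaluates_def by (simp_all add: wf_copy)
  fix y X and s :: "nat \<Rightarrow> nat" assume s: "s 0 = 0" "s 1 = 0"
  define s1 where "s1 = s(m+1 := s m, m+2 := 0)"
  define s2 where "s2 = exec y X c s1"
  have "s1 0 = 0" "s1 1 = 0" "s1 m = s m" "s1 (m+1) = s m" unfolding s1_def using s m by simp_all
  moreover have "s2 m = s1 m" unfolding s2_def using c m by (simp add: evaluates_def exec_unchanged)
  ultimately have s2: "s2 0 = 0" "s2 1 = 0" "s2 m = s m" "s2 (m+1) = of_bool (Q y X (s m))"
    unfolding s2_def using c unfolding evaluates_def by simp_all
  have "exec y X ?c s = (if s2 (m+1) \<noteq> 0 then exec y X d s2 else s2(m := 0))"
    unfolding exec.simps clear by (simp add: exec_copy s1_def s2_def)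
  then show "exec y X ?c s m = of_bool (Q y X (s m) \<and> R y X (s m))" "exec y X ?c s 0 = 0"
    "exec y X ?c s 1 = 0"
    using s2 d m unfolding evaluates_def by simp_all
qed

lemma finitary_evaluates: "finitary Q \<Longrightarrow> 2 \<le> m \<Longrightarrow> \<exists>c. evaluates m c Q"
proof (induction arbitrary: m rule: finitary.induct)
  case (finitary_tape f)
  then show ?case using prim_rec_computes[of f m] evaluates_query[of m _ f False] by auto
next
  case (finitary_oracle f)
  then show ?case using prim_rec_computes[of f m] evaluates_query[of m _ f True] by auto
next
  case (finitary_eq_zero f)
  then show ?case using prim_rec_computes[of f m] evaluates_eq_zero by blast
next
  case (finitary_not Q)
  then show ?case using evaluates_not by blast
next
  case (finitary_conj Q R)
  then show ?case using evaluates_conj by (meson trans_le_add1)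
qed

section \<open>The Turing machine of a loop program\<close>

definition bits_code :: "bool \<Rightarrow> bool \<Rightarrow> bool \<Rightarrow> bool \<Rightarrow> nat" where
  "bits_code a b c d = of_bool a + 2 * of_bool b + 4 * of_bool c + 8 * of_bool d"

lemma bit_bits_code [simp]:
  "bit (bits_code a b c d) 0 = a" "bit (bits_code a b c d) (Suc 0) = b"
  "bit (bits_code a b c d) 2 = c" "bit (bits_code a b c d) 3 = d"
  by (cases a; cases b; cases c; cases d; simp add: bits_code_def bit_iff_odd)+

lemma bits_code_inject: "bits_code a b c d = bits_code a' b' c' d' \<longleftrightarrow> a = a' \<and> b = b' \<and> c = c' \<and> d = d'"
  by (cases a; cases b; cases c; cases d; cases a'; cases b'; cases c'; cases d')
     (simp_all add: bits_code_def)

lemma eq_bits_code_iff: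
  "r = bits_code a b c d \<longleftrightarrow> r div 2 ^ 4 = 0 \<and> (bit r 0 \<longleftrightarrow> a) \<and> (bit r 1 \<longleftrightarrow> b) \<and> (bit r 2 \<longleftrightarrow> c) \<and>
    (bit r 3 \<longleftrightarrow> d)"
proof
  assume "r = bits_code a b c d"
  then show "r div 2 ^ 4 = 0 \<and> (bit r 0 \<longleftrightarrow> a) \<and> (bit r 1 \<longleftrightarrow> b) \<and> (bit r 2 \<longleftrightarrow> c) \<and> (bit r 3 \<longleftrightarrow> d)"
    by (cases a; cases b; cases c; cases d; simp add: bits_code_def bit_iff_odd)
next
  assume bits: "r div 2 ^ 4 = 0 \<and> (bit r 0 \<longleftrightarrow> a) \<and> (bit r 1 \<longleftrightarrow> b) \<and> (bit r 2 \<longleftrightarrow> c) \<and> (bit r 3 \<longleftrightarrow> d)"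
  have "r < 16" using bits by (simp add: div_eq_0_iff)
  have "bits_code (bit r 0) (bit r 1) (bit r 2) (bit r 3) =
      r mod 2 + 2 * (r div 2 mod 2) + 4 * (r div 4 mod 2) + 8 * (r div 8 mod 2)"
    unfolding bits_code_def bit_iff_odd of_bool_odd_eq_mod_2 by simp
  also have "\<dots> = r"
    using \<open>r < 16\<close> mod_mult2_eq[of r 2 8] mod_mult2_eq[of "r div 2" 2 4] mod_mult2_eq[of "r div 4" 2 2]
    by (simp add: div_mult2_eq[symmetric])
  finally show "r = bits_code a b c d" using bits by simp
qed

lemma readcode_eq_bits_code:
  "readcode y C = bits_code (cfg.hd C \<in> y) (tin C (cfg.hd C)) (tsc C (cfg.hd C)) (tout C (cfg.hd C))"
  unfolding readcode_def bits_code_def by simp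

lemma surj_P: "\<exists>i. P i = p"
proof -
  have "decode_instr (prod_encode (q, prod_encode (r, prod_encode (q', prod_encode (w, m))))) =
      (q, r, q', w, m)"
    for q r q' w m by (simp add: decode_instr_def)
  then have "\<exists>n. decode_instr n = a" for a by (metis prod_cases5)
  then obtain g where "\<And>a. decode_instr (g a) = a" by metis
  then have "P (list_encode (map g p)) = p" unfolding P_def by (simp add: o_def)
  then show ?thesis by blast
qed

text \<open>The machine evaluates a loop program \<open>main\<close> for ever.  Its \<open>k\<close> registers are marks on the scratch tape,
  register \<open>i\<close> being the gap before mark \<open>i\<close>; the tape \<open>X\<close> is the output tape, and \<open>Put\<close> writes to the input
  tape.  \<open>Return 1 K\<close> on the first mark executes the stack \<open>K\<close>.  At a limit the bits of the scratch and input tape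
  at cell 0 tell what just ended: an evaluation phase (1,0), a limit of phases (1,1), a sweep (0,1), or the final
  sweep (0,0).\<close>

datatype control = Init | Limit | Return nat "com list" | Seek nat "com list" | Test "com list"
  | SeekLast nat nat "com list" | Insert bool nat "com list" | Delete bool nat nat "com list"
  | Back control
  | Mark nat | GoRight nat | GoLeft bool nat | NoHalt | Sweep bool

text \<open>The next state, the bits written to the input, scratch and output tape, and whether to move right.\<close>

type_synonym action = "(control \<times> bool \<times> bool \<times> bool \<times> bool) option"

fun counter :: "com \<Rightarrow> nat" where
  "counter (Inc i) = i" | "counter (Dec i) = i" | "counter (Cond i c d) = i"
  | "counter (Loop i c) = i" | "counter _ = 0"

fun dispatch :: "com \<Rightarrow> com list \<Rightarrow> bool \<Rightarrow> bool \<Rightarrow> control" where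
  "dispatch main [] bo bx = Return 1 [main]"
| "dispatch main (Skip # K) bo bx = Return 1 K"
| "dispatch main (Put b # K) bo bx = Return 1 K"
| "dispatch main (Seq c d # K) bo bx = Return 1 (c # d # K)"
| "dispatch main (Query b # K) bo bx = Return 1 (if (if b then bo else bx) then Inc 1 # K else K)"
| "dispatch main (c # K) bo bx = Seek (Suc (counter c)) (c # K)"

definition put_bit :: "com list \<Rightarrow> bool \<Rightarrow> bool" where
  "put_bit K bi = (case K of Put b # _ \<Rightarrow> b | _ \<Rightarrow> bi)"

fun transition :: "nat \<Rightarrow> com \<Rightarrow> control \<Rightarrow> bool \<Rightarrow> bool \<Rightarrow> bool \<Rightarrow> bool \<Rightarrow> action" where
  "transition k main (Return r K) bo bi bs bx = (if bs \<and> r \<le> 1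
     then Some (Back (dispatch main K bo bx), put_bit K bi, bs, bx, True)
     else Some (Return (if bs then r - 1 else r) K, bi, bs, bx, False))"
| "transition k main (Seek j L) bo bi bs bx = (if bs \<and> j \<le> 1
     then (case L of Inc i # K \<Rightarrow> Some (Insert True (k - i) K, bi, False, bx, True)
           | _ \<Rightarrow> Some (Test L, bi, bs, bx, False))
     else Some (Seek (if bs then j - 1 else j) L, bi, bs, bx, True))"
| "transition k main (Test L) bo bi bs bx = (case L of
       Cond i c d # K \<Rightarrow> (if bs then Some (Back (Return (max 1 i) (d # K)), bi, bs, bx, True)
          else Some (Return (Suc i) (c # K), bi, bs, bx, True))
     | Loop i c # K \<Rightarrow> (if bs then Some (Back (Return (max 1 i) K), bi, bs, bx, True)
          else Some (Return (Suc i) (Dec i # c # Loop i c # K), bi, bs, bx, True))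
     | Dec i # K \<Rightarrow> (if bs then Some (Back (Return (max 1 i) K), bi, bs, bx, True)
          else Some (SeekLast (k - i) i K, bi, bs, bx, True))
     | _ \<Rightarrow> None)"
| "transition k main (SeekLast j i K) bo bi bs bx = (if bs \<and> j \<le> 1 then Some (Delete True (k - i) i K, bi, False, bx, False)
     else Some (SeekLast (if bs then j - 1 else j) i K, bi, bs, bx, True))"
| "transition k main (Insert b r K) bo bi bs bx = (if r - of_bool b = 0 then Some (Back (Return k K), bi, b, bx, True)
     else Some (Insert bs (r - of_bool b) K, bi, b, bx, True))"
| "transition k main (Delete b r i K) bo bi bs bx = (if r - of_bool b = 0 then Some (Back (Return (Suc i) K), bi, b, bx, True)
     else Some (Delete bs (r - of_bool b) i K, bi, b, bx, False))"
| "transition k main (Back s) bo bi bs bx = Some (s, bi, bs, bx, False)"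
| "transition k main Init bo bi bs bx = Some (Mark (k - 1), False, True, bx, True)"
| "transition k main (Mark j) bo bi bs bx = (if j \<le> 1 then Some (Back (Return k []), bi, True, bx, True)
     else Some (Mark (j - 1), bi, True, bx, True))"
| "transition k main Limit bo bi bs bx =
     (if bs then (if bi then Some (Sweep False, True, False, bx, True) else Some (GoRight 0, bi, bs, bx, True))
      else if bi then Some (Mark (k - 1), False, True, bx, True) else None)"
| "transition k main (GoRight j) bo bi bs bx =
     (if j = 0 then (if bx then Some (GoRight 1, bi, bs, bx, True) else Some (NoHalt, bi, bs, bx, False))
      else if j = 1 then Some (GoRight 2, bi, bs, bx, True) else Some (GoLeft bx 1, bi, bs, bx, False))"
| "transition k main (GoLeft b j) bo bi bs bx = (if j = 1 then Some (GoLeft b 2, bi, bs, bx, False)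
     else if j = 2 then Some (GoLeft b 3, bi, bs, bx, False) else Some (Sweep True, False, False, b, True))"
| "transition k main NoHalt bo bi bs bx = Some (Sweep True, True, False, bx, True)"
| "transition k main (Sweep cp) bo bi bs bx = Some (Sweep cp, bi, False, if cp then bi else bx, True)"

definition apply_action :: "(control \<Rightarrow> nat) \<Rightarrow> action \<Rightarrow> cfg \<Rightarrow> cfg" where
  "apply_action f a c = (case a of None \<Rightarrow> c\<lparr>st := 1\<rparr> | Some (q', wi, ws, wo, r) \<Rightarrow>
     \<lparr>st = f q', hd = (if r then Suc (hd c) else hd c - 1), tin = (tin c)(hd c := wi),
      tsc = (tsc c)(hd c := ws), tout = (tout c)(hd c := wo)\<rparr>)"

definition action_instr :: "(control \<Rightarrow> nat) \<Rightarrow> nat \<Rightarrow> nat \<Rightarrow> action \<Rightarrow> instr" where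
  "action_instr f q r a =
    (case a of None \<Rightarrow> undefined | Some (q', wi, ws, wo, m) \<Rightarrow> (q, r, f q', bits_code wi ws wo False, of_bool m))"

lemma find_map_filter_unique:
  assumes "\<And>x. x \<in> set xs \<Longrightarrow> D x \<Longrightarrow> R (row x) \<longleftrightarrow> x = t"
  shows "find R (map row (filter D xs)) = (if t \<in> set xs \<and> D t then Some (row t) else None)"
  using assms by (induction xs) auto

lemma step_eq_apply_action:
  assumes "st c \<noteq> 1"
    and "find (\<lambda>(q, r, _). q = st c \<and> r = readcode y c) p =
        map_option (\<lambda>_. action_instr f (st c) (readcode y c) a) a"
  shows "step p y c = apply_action f a c"
proof (cases a)
  case None
  then show ?thesis using assms unfolding step_def apply_action_def by simp
next
  case (Some act)
  obtain q' wi ws wo m where "act = (q', wi, ws, wo, m)" by (cases act)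
  moreover have "odd (bits_code wi ws wo False) = wi" "odd (bits_code wi ws wo False div 2) = ws"
    "odd (bits_code wi ws wo False div 4) = wo"
    by (cases wi; cases ws; cases wo; simp add: bits_code_def)+
  ultimately show ?thesis
    using assms Some unfolding step_def apply_action_def action_instr_def by simp
qed

lemma ex_program_of_transitions:
  fixes \<delta> :: "control \<Rightarrow> bool \<Rightarrow> bool \<Rightarrow> bool \<Rightarrow> bool \<Rightarrow> action"
  assumes "finite S"
  shows "\<exists>i f. f Init = 0 \<and> f Limit = 2 \<and> (\<forall>s. f s \<noteq> (1::nat)) \<and>
    (\<forall>y c s. s \<in> S \<longrightarrow> st c = f s \<longrightarrow>
      step (P i) y c = apply_action f (\<delta> s (hd c \<in> y) (tin c (hd c)) (tsc c (hd c)) (tout c (hd c))) c)"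
proof -
  obtain g :: "control \<Rightarrow> nat" where g: "inj_on g S" using finite_imp_inj_to_nat_seg[OF assms] by blast
  define f where "f s = (if s = Init then 0 else if s = Limit then 2 else g s + 3)" for s
  have inj: "inj_on f S" using g unfolding inj_on_def f_def by auto
  define T where "T = S \<times> (UNIV :: (bool \<times> bool \<times> bool \<times> bool) set)"
  obtain ts where ts: "set ts = T" unfolding T_def using finite_list assms
    by (metis finite_SigmaI finite)
  define act where "act = (\<lambda>(s, a, b, c, d). \<delta> s a b c d)"
  define row where "row = (\<lambda>(s, a, b, c, d). action_instr f (f s) (bits_code a b c d) (\<delta> s a b c d))"
  define p where "p = map row (filter (\<lambda>t. act t \<noteq> None) ts)"
  have step: "step p y C =
      apply_action f (\<delta> s (hd C \<in> y) (tin C (hd C)) (tsc C (hd C)) (tout C (hd C))) C"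
    if s: "s \<in> S" "st C = f s" for y C s
  proof (rule step_eq_apply_action)
    show "st C \<noteq> 1" using s unfolding f_def by auto
    define t where "t = (s, hd C \<in> y, tin C (hd C), tsc C (hd C), tout C (hd C))"
    let ?R = "\<lambda>(q, r, _). q = st C \<and> r = readcode y C"
    have act_t: "act t = \<delta> s (hd C \<in> y) (tin C (hd C)) (tsc C (hd C)) (tout C (hd C))"
      and row_t: "row t = action_instr f (st C) (readcode y C) (act t)"
      unfolding t_def act_def row_def readcode_eq_bits_code s(2) by simp_all
    have "?R (row t') \<longleftrightarrow> t' = t" if t': "t' \<in> set ts" "act t' \<noteq> None" for t'
    proof -
      obtain s' a b c d where t'_eq: "t' = (s', a, b, c, d)" by (cases t')
      obtain q' wi ws wo m where "\<delta> s' a b c d = Some (q', wi, ws, wo, m)"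
        using t'(2) unfolding t'_eq act_def by auto
      then have "?R (row t') \<longleftrightarrow> f s' = f s \<and> bits_code a b c d = readcode y C"
        unfolding t'_eq row_def action_instr_def s(2) by simp
      also have "f s' = f s \<longleftrightarrow> s' = s" using t'(1) s(1) inj_on_eq_iff[OF inj]
        unfolding ts T_def t'_eq by auto
      finally show ?thesis unfolding t'_eq t_def readcode_eq_bits_code bits_code_inject by simp
    qed
    then have "find ?R p = (if t \<in> set ts \<and> act t \<noteq> None then Some (row t) else None)"
      unfolding p_def by (rule find_map_filter_unique)
    moreover have "t \<in> set ts" unfolding ts T_def t_def using s(1) by simp
    ultimately show "find ?R p = map_option (\<lambda>_. action_instr f (st C) (readcode y C)
        (\<delta> s (hd C \<in> y) (tin C (hd C)) (tsc C (hd C)) (tout C (hd C))))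
        (\<delta> s (hd C \<in> y) (tin C (hd C)) (tsc C (hd C)) (tout C (hd C)))"
      unfolding act_t[symmetric] row_t by (cases "act t") simp_all
  qed
  obtain i where "P i = p" using surj_P by blast
  then show ?thesis using step by (intro exI[of _ i] exI[of _ f]) (auto simp: f_def)
qed

text \<open>The stacks that can occur while \<open>c\<close> is executed with \<open>K\<close> to be executed afterwards.\<close>

fun stacks :: "com \<Rightarrow> com list \<Rightarrow> com list set" where
  "stacks (Seq c d) K = insert (Seq c d # K) (stacks c (d # K) \<union> stacks d K)"
| "stacks (Cond i c d) K = insert (Cond i c d # K) (stacks c K \<union> stacks d K)"
| "stacks (Loop i c) K =
    insert (Loop i c # K) (insert (Dec i # c # Loop i c # K) (stacks c (Loop i c # K)))"
| "stacks (Query b) K = {Query b # K, Inc 1 # K}"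
| "stacks c K = {c # K}"

lemma finite_stacks: "finite (stacks c K)"
  by (induction c K rule: stacks.induct) auto

lemma Cons_in_stacks: "c # K \<in> stacks c K"
  by (cases c) auto

fun registers :: "com \<Rightarrow> nat set" where
  "registers (Inc i) = {i}" | "registers (Dec i) = {i}"
  | "registers (Seq c d) = registers c \<union> registers d"
| "registers (Cond i c d) = insert i (registers c \<union> registers d)"
| "registers (Loop i c) = insert i (registers c)"
| "registers _ = {}"

lemma finite_registers: "finite (registers c)"
  by (induction c) auto

definition states :: "nat \<Rightarrow> com list set \<Rightarrow> control set" where
  "states k R = (let S = {Init, Limit, NoHalt} \<union> (\<lambda>(r, K). Return r K) ` ({..k} \<times> R) \<union> (\<lambda>(r, K). Seek r K) ` ({..k} \<times> R)
     \<union> Test ` R \<union> (\<lambda>(j, i, K). SeekLast j i K) ` ({..k} \<times> {..k} \<times> R)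
     \<union> (\<lambda>(b, r, K). Insert b r K) ` (UNIV \<times> {..k} \<times> R) \<union> (\<lambda>(b, r, i, K). Delete b r i K) ` (UNIV \<times> {..k} \<times> {..k} \<times> R)
     \<union> Mark ` {..k} \<union> GoRight ` {..3} \<union> (\<lambda>(b, r). GoLeft b r) ` (UNIV \<times> {..3}) \<union> range Sweep in S \<union> Back ` S)"

lemma finite_states: "finite R \<Longrightarrow> finite (states k R)"
  unfolding states_def Let_def by (intro finite_UnI finite_imageI) auto

lemma in_states [simp]:
  "Init \<in> states k R" "Limit \<in> states k R" "NoHalt \<in> states k R" "Sweep b \<in> states k R"
  "Return r K \<in> states k R \<longleftrightarrow> r \<le> k \<and> K \<in> R" "Seek r K \<in> states k R \<longleftrightarrow> r \<le> k \<and> K \<in> R"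
  "Test K \<in> states k R \<longleftrightarrow> K \<in> R" "SeekLast r i K \<in> states k R \<longleftrightarrow> r \<le> k \<and> i \<le> k \<and> K \<in> R"
  "Insert b r K \<in> states k R \<longleftrightarrow> r \<le> k \<and> K \<in> R" "Delete b r i K \<in> states k R \<longleftrightarrow> r \<le> k \<and> i \<le> k \<and> K \<in> R"
  "Mark r \<in> states k R \<longleftrightarrow> r \<le> k" "GoRight r \<in> states k R \<longleftrightarrow> r \<le> 3" "GoLeft b r \<in> states k R \<longleftrightarrow> r \<le> 3"
  "Back (Return r K) \<in> states k R \<longleftrightarrow> r \<le> k \<and> K \<in> R" "Back (Seek r K) \<in> states k R \<longleftrightarrow> r \<le> k \<and> K \<in> R"
  unfolding states_def Let_def by (auto simp: image_iff)

primrec mark_pos :: "(nat \<Rightarrow> nat) \<Rightarrow> nat \<Rightarrow> nat" where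
  "mark_pos s 0 = s 0"
| "mark_pos s (Suc i) = Suc (mark_pos s i + s (Suc i))"

lemma mark_pos_mono_iff: "mark_pos s i < mark_pos s j \<longleftrightarrow> i < j"
  by (rule lift_Suc_mono_less_iff) simp

lemma mark_pos_le_iff: "mark_pos s i \<le> mark_pos s j \<longleftrightarrow> i \<le> j"
  using mark_pos_mono_iff[of s j i] by auto

lemma mark_pos_eq_iff: "mark_pos s i = mark_pos s j \<longleftrightarrow> i = j"
  by (metis order_antisym mark_pos_le_iff order_refl)

definition marks :: "nat \<Rightarrow> (nat \<Rightarrow> nat) \<Rightarrow> nat set" where "marks k s = mark_pos s ` {..<k}"

lemma finite_marks [simp]: "finite (marks k s)" unfolding marks_def by simp

lemma mark_pos_in_marks [simp]: "mark_pos s i \<in> marks k s \<longleftrightarrow> i < k"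
  unfolding marks_def by (auto simp: mark_pos_eq_iff image_iff)

lemma marks_filter: "{m \<in> marks k s. Q m} = mark_pos s ` {i. i < k \<and> Q (mark_pos s i)}"
  unfolding marks_def by auto

lemma card_marks: "card {m \<in> marks k s. Q m} = card {i. i < k \<and> Q (mark_pos s i)}"
  unfolding marks_filter by (rule card_image) (auto simp: inj_on_def mark_pos_eq_iff)

lemma mark_pos_upd_less: "j < i \<Longrightarrow> mark_pos (s(i := v)) j = mark_pos s j"
  by (induction j) auto

lemma mark_pos_inc: "i \<le> j \<Longrightarrow> mark_pos (s(i := Suc (s i))) j = Suc (mark_pos s j)"
proof (induction j)
  case (Suc j)
  show ?case
  proof (cases "i = Suc j")
    case True
    then show ?thesis using mark_pos_upd_less[of j "Suc j" s "Suc (s (Suc j))"]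
      by (simp only: mark_pos.simps fun_upd_same)
  qed (use Suc in auto)
qed simp

lemma mark_pos_dec: "i \<le> j \<Longrightarrow> s i \<noteq> 0 \<Longrightarrow> Suc (mark_pos (s(i := s i - 1)) j) = mark_pos s j"
  using mark_pos_inc[of i j "s(i := s i - 1)"] by simp

lemma mark_pos_pred_zero: "0 < i \<Longrightarrow> s i = 0 \<Longrightarrow> mark_pos s i - 1 = mark_pos s (i - 1)"
  by (cases i) auto

lemma mark_pos_pred_notin: "s i \<noteq> 0 \<Longrightarrow> mark_pos s i - 1 \<notin> marks k s"
proof
  assume "s i \<noteq> 0" "mark_pos s i - 1 \<in> marks k s"
  moreover have "0 < mark_pos s i" using \<open>s i \<noteq> 0\<close> by (cases i) auto
  ultimately obtain j where j: "mark_pos s j = mark_pos s i - 1" "mark_pos s j < mark_pos s i"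
    unfolding marks_def by auto
  then have "j < i" using mark_pos_mono_iff[of s j i] by blast
  then obtain i' where i: "i = Suc i'" "j \<le> i'" by (cases i) auto
  then have "mark_pos s j \<le> mark_pos s i'" by (simp add: mark_pos_le_iff)
  then show False using j(1) i(1) \<open>s i \<noteq> 0\<close> by simp
qed

definition insert_cell :: "nat \<Rightarrow> nat set \<Rightarrow> nat set" where
  "insert_cell a M = {n. (n < a \<and> n \<in> M) \<or> (a < n \<and> n - 1 \<in> M)}"

definition delete_cell :: "nat \<Rightarrow> nat set \<Rightarrow> nat set" where
  "delete_cell a M = {n. (n < a \<and> n \<in> M) \<or> (a \<le> n \<and> Suc n \<in> M)}"

lemma marks_inc:
  assumes "i < k"
  shows "marks k (s(i := Suc (s i))) = insert_cell (mark_pos s i) (marks k s)"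
proof (rule set_eqI)
  fix n
  have mark_pos_upd: "mark_pos (s(i := Suc (s i))) j =
      (if j < i then mark_pos s j else Suc (mark_pos s j))" for j
    using mark_pos_inc[of i j s] mark_pos_upd_less[of j i s] by auto
  have "n \<in> marks k (s(i := Suc (s i))) \<longleftrightarrow> (\<exists>j<k. j < i \<and> n = mark_pos s j) \<or>
      (\<exists>j<k. i \<le> j \<and> n = Suc (mark_pos s j))"
    unfolding marks_def image_iff mark_pos_upd Bex_def lessThan_iff by (metis not_le)
  also have "(\<exists>j<k. j < i \<and> n = mark_pos s j) \<longleftrightarrow> n < mark_pos s i \<and> n \<in> marks k s"
    unfolding marks_def by (auto simp: mark_pos_mono_iff)
  also have "(\<exists>j<k. i \<le> j \<and> n = Suc (mark_pos s j)) \<longleftrightarrow> mark_pos s i < n \<and> n - 1 \<in> marks k s"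
    unfolding marks_def by (cases n) (auto simp: mark_pos_le_iff less_Suc_eq_le)
  finally show "n \<in> marks k (s(i := Suc (s i))) \<longleftrightarrow> n \<in> insert_cell (mark_pos s i) (marks k s)"
    unfolding insert_cell_def by blast
qed

lemma marks_dec:
  assumes "i < k" "s i \<noteq> 0"
  shows "marks k (s(i := s i - 1)) = delete_cell (mark_pos s i - 1) (marks k s)"
proof (rule set_eqI)
  fix n
  have mark_pos_upd: "j < i \<Longrightarrow> mark_pos (s(i := s i - 1)) j = mark_pos s j"
    "i \<le> j \<Longrightarrow> Suc (mark_pos (s(i := s i - 1)) j) = mark_pos s j" for j
    using mark_pos_dec[of i j s] mark_pos_upd_less[of j i s] assms by auto
  have pos: "0 < mark_pos s i" using assms by (cases i) auto
  have "n \<in> marks k (s(i := s i - 1)) \<longleftrightarrow> (\<exists>j<k. j < i \<and> n = mark_pos s j) \<or>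
      (\<exists>j<k. i \<le> j \<and> Suc n = mark_pos s j)"
    unfolding marks_def image_iff using mark_pos_upd by (metis lessThan_iff nat.inject not_le)
  also have "(\<exists>j<k. j < i \<and> n = mark_pos s j) \<longleftrightarrow> n < mark_pos s i \<and> n \<in> marks k s"
    unfolding marks_def by (auto simp: mark_pos_mono_iff)
  also have "\<dots> \<longleftrightarrow> n < mark_pos s i - 1 \<and> n \<in> marks k s"
    using mark_pos_pred_notin[of s i k] assms(2) by (cases "n = mark_pos s i - 1") auto
  also have "(\<exists>j<k. i \<le> j \<and> Suc n = mark_pos s j) \<longleftrightarrow> mark_pos s i \<le> Suc n \<and> Suc n \<in> marks k s"
    unfolding marks_def by (auto simp: mark_pos_le_iff)
  also have "mark_pos s i \<le> Suc n \<longleftrightarrow> mark_pos s i - 1 \<le> n" using pos by auto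
  finally show "n \<in> marks k (s(i := s i - 1)) \<longleftrightarrow> n \<in> delete_cell (mark_pos s i - 1) (marks k s)"
    unfolding delete_cell_def by blast
qed

inductive reaches :: "prog \<Rightarrow> nat set \<Rightarrow> (cfg \<Rightarrow> bool) \<Rightarrow> cfg \<Rightarrow> cfg \<Rightarrow> bool" for p y I where
  reaches_refl: "I c \<Longrightarrow> reaches p y I c c"
| reaches_step: "I c \<Longrightarrow> reaches p y I (step p y c) d \<Longrightarrow> reaches p y I c d"

lemma reaches_trans: "reaches p y I c d \<Longrightarrow> reaches p y I d e \<Longrightarrow> reaches p y I c e"
  by (induction rule: reaches.induct) (auto intro: reaches_step)

lemma reaches_mono: "reaches p y I c d \<Longrightarrow> (\<And>e. I e \<Longrightarrow> J e) \<Longrightarrow> reaches p y J c d"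
  by (induction rule: reaches.induct) (auto intro: reaches.intros)

lemma reaches_imp_funpow:
  "reaches p y I c d \<Longrightarrow> \<exists>n. d = (step p y ^^ n) c \<and> (\<forall>j\<le>n. I ((step p y ^^ j) c))"
proof (induction rule: reaches.induct)
  case (reaches_refl c)
  then show ?case by (intro exI[of _ 0]) simp
next
  case (reaches_step c d)
  then obtain n where n: "d = (step p y ^^ n) (step p y c)" "\<forall>j\<le>n. I ((step p y ^^ j) (step p y c))"
    by blast
  have "I ((step p y ^^ j) c)" if "j \<le> Suc n" for j
    using that n(2) reaches_step.hyps(1) by (cases j) (auto simp: funpow_swap1)
  then show ?case using n(1) by (intro exI[of _ "Suc n"]) (simp add: funpow_swap1)
qed

lemma reaches_time:
  assumes "reaches p y I (config p y z u) d"
  shows "\<exists>w\<ge>u. config p y z w = d \<and> (\<forall>v\<in>{u..w}. I (config p y z v))"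
  using assms
proof (induction "config p y z u" d arbitrary: u rule: reaches.induct)
  case reaches_refl
  then show ?case by (intro exI[of _ u]) auto
next
  case (reaches_step d)
  from reaches_step.hyps(3)[OF config_succ[symmetric]]
  obtain w where w: "succ u \<le> w" "config p y z w = d" "\<forall>v\<in>{succ u..w}. I (config p y z v)" by blast
  have "I (config p y z v)" if "v \<in> {u..w}" for v
    using that w(3) reaches_step.hyps(1) by (cases "v = u") (auto simp: succ_le_iff)
  then show ?case using w by (intro exI[of _ w]) (auto simp: succ_le_iff)
qed

definition frozen :: "(nat \<Rightarrow> bool) \<Rightarrow> (nat \<Rightarrow> bool) \<Rightarrow> cfg \<Rightarrow> bool" where
  "frozen Y X e \<longleftrightarrow> tin e = Y \<and> tout e = X \<and> st e \<noteq> 1"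

locale register_machine =
  fixes p :: prog and y :: "nat set" and f :: "control \<Rightarrow> nat" and k :: nat and main :: com
      and R :: "com list set"
  assumes step_eq: "\<And>c s. s \<in> states k R \<Longrightarrow> st c = f s \<Longrightarrow>
      step p y c = apply_action f (transition k main s (hd c \<in> y) (tin c (hd c)) (tsc c (hd c)) (tout c (hd c))) c"
    and f: "f Init = 0" "f Limit = 2" "\<And>s. f s \<noteq> 1"
    and k: "1 < k"
    and R: "[] \<in> R" "stacks main [] \<subseteq> R"
begin

abbreviation reaches_frozen :: "(nat \<Rightarrow> bool) \<Rightarrow> (nat \<Rightarrow> bool) \<Rightarrow> cfg \<Rightarrow> cfg \<Rightarrow> bool" where
  "reaches_frozen Y X \<equiv> reaches p y (frozen Y X)"

definition conf :: "(nat \<Rightarrow> bool) \<Rightarrow> (nat \<Rightarrow> bool) \<Rightarrow> control \<Rightarrow> nat \<Rightarrow> nat set \<Rightarrow> cfg" where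
  "conf Y X s h M = \<lparr>st = f s, hd = h, tin = Y, tsc = (\<lambda>n. n \<in> M), tout = X\<rparr>"

lemma conf_sel [simp]: "st (conf Y X s h M) = f s" "hd (conf Y X s h M) = h" "tin (conf Y X s h M) = Y"
  "tsc (conf Y X s h M) = (\<lambda>n. n \<in> M)" "tout (conf Y X s h M) = X"
  unfolding conf_def by auto

lemma frozen_conf [simp]: "frozen Y X (conf Y X s h M)"
  unfolding frozen_def using f by simp

lemma step_conf:
  assumes "s \<in> states k R" "transition k main s (h \<in> y) (Y h) (h \<in> M) (X h) = Some (s', wi, b, wo, r)"
  shows "step p y (conf Y X s h M) =
    conf (Y(h := wi)) (X(h := wo)) s' (if r then Suc h else h - 1) (if b then insert h M else M - {h})"
proof -
  have "step p y (conf Y X s h M) = apply_action f (Some (s', wi, b, wo, r)) (conf Y X s h M)"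
    using step_eq[of s "conf Y X s h M"] assms by simp
  then show ?thesis by (auto simp: apply_action_def conf_def fun_eq_iff)
qed

lemma reaches_frozen_step:
  assumes "s \<in> states k R" "transition k main s (h \<in> y) (Y h) (h \<in> M) (X h) = Some (s', Y h, b, X h, r)"
    "h' = (if r then Suc h else h - 1)" "M' = (if b then insert h M else M - {h})"
    "reaches_frozen Y X (conf Y X s' h' M') d"
  shows "reaches_frozen Y X (conf Y X s h M) d"
  by (rule reaches_step) (use step_conf[of s h Y M X s' "Y h" b "X h" r] assms in simp_all)

lemma reaches_frozen_move:
  assumes "s \<in> states k R" "transition k main s (h \<in> y) (Y h) (h \<in> M) (X h) =
      Some (s', Y h, h \<in> M, X h, r)"
    "reaches_frozen Y X (conf Y X s' (if r then Suc h else h - 1) M) d"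
  shows "reaches_frozen Y X (conf Y X s h M) d"
proof (rule reaches_step)
  have "(if h \<in> M then insert h M else M - {h}) = M" by auto
  then show "reaches_frozen Y X (step p y (conf Y X s h M)) d"
    using step_conf[of s h Y M X s' "Y h" "h \<in> M" "X h" r] assms by simp
qed simp

lemma back_step:
  assumes "Back s \<in> states k R" "reaches_frozen Y X (conf Y X s h M) d"
  shows "reaches_frozen Y X (conf Y X (Back s) (Suc h) M) d"
  by (rule reaches_frozen_move[OF assms(1), of _ _ _ _ s False]) (use assms(2) in auto)

lemma walk_left:
  assumes M: "finite M" and K: "K \<in> R" and t: "t \<in> M" "\<And>m. m \<in> M \<Longrightarrow> t \<le> m"
    and "card {m \<in> M. m \<le> h} = r" "t \<le> h" "r \<le> k"
    and target: "reaches_frozen Y X (conf Y X (Return 1 K) t M) d"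
  shows "reaches_frozen Y X (conf Y X (Return r K) h M) d"
  using assms(5-7)
proof (induction h arbitrary: r)
  case 0
  then have "{m \<in> M. m \<le> 0} = {0}" "t = 0" using t by auto
  then show ?case using 0 target by simp
next
  case (Suc h)
  have fin: "finite {m \<in> M. m \<le> h}" using M by simp
  have split: "{m \<in> M. m \<le> Suc h} = (if Suc h \<in> M then insert (Suc h) {m \<in> M. m \<le> h}
      else {m \<in> M. m \<le> h})"
    by (auto simp: le_Suc_eq)
  show ?case
  proof (cases "t = Suc h")
    case True
    then have "{m \<in> M. m \<le> Suc h} = {Suc h}" using t by (auto intro: order_antisym)
    then show ?thesis using Suc.prems target True by simp
  next
    case False
    then have th: "t \<le> h" using Suc.prems by simp
    then have "t \<in> {m \<in> M. m \<le> h}" using t(1) by simp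
    then have pos: "0 < card {m \<in> M. m \<le> h}" using fin card_gt_0_iff by blast
    show ?thesis
    proof (cases "Suc h \<in> M")
      case True
      then have count: "card {m \<in> M. m \<le> h} = r - 1" "1 < r" using Suc.prems(1) split fin pos by auto
      show ?thesis
        by (rule reaches_frozen_move[where s' = "Return (r - 1) K" and r = False])
           (use count True Suc.prems Suc.IH[OF count(1) th] K in auto)
    next
      case False
      then have count: "card {m \<in> M. m \<le> h} = r" using Suc.prems(1) split by auto
      show ?thesis
        by (rule reaches_frozen_move[where s' = "Return r K" and r = False])
           (use count False Suc.prems Suc.IH[OF count th] K in auto)
    qed
  qed
qed

lemma walk_right:
  assumes M: "finite M" and t: "t \<in> M"
    and q: "\<And>j. j \<le> k \<Longrightarrow> q j \<in> states k R"
    and move: "\<And>j bo bi bs bx. \<not> (bs \<and> j \<le> 1) \<Longrightarrow>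
      transition k main (q j) bo bi bs bx = Some (q (if bs then j - 1 else j), bi, bs, bx, True)"
    and "card {m \<in> M. h \<le> m \<and> m \<le> t} = j" "h \<le> t" "j \<le> k"
    and target: "reaches_frozen Y X (conf Y X (q 1) t M) d"
  shows "reaches_frozen Y X (conf Y X (q j) h M) d"
  using assms(5-7)
proof (induction "t - h" arbitrary: h j)
  case 0
  then have "h = t" by simp
  then have "{m \<in> M. h \<le> m \<and> m \<le> t} = {t}" using t by auto
  then show ?case using 0 target \<open>h = t\<close> by simp
next
  case (Suc n)
  then have ht: "h < t" "n = t - Suc h" by auto
  let ?rest = "{m \<in> M. Suc h \<le> m \<and> m \<le> t}"
  have fin: "finite ?rest" using M by simp
  have split: "{m \<in> M. h \<le> m \<and> m \<le> t} = (if h \<in> M then insert h ?rest else ?rest)"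
    using ht by (auto simp: le_less Suc_le_eq)
  have "t \<in> ?rest" using t ht by simp
  then have pos: "0 < card ?rest" using fin card_gt_0_iff by blast
  show ?case
  proof (cases "h \<in> M")
    case True
    then have count: "card ?rest = j - 1" "1 < j" using Suc.prems(1) split fin pos by auto
    have IH: "reaches_frozen Y X (conf Y X (q (j - 1)) (Suc h) M) d"
      using Suc.hyps(1)[OF ht(2) count(1)] ht Suc.prems by simp
    show ?thesis
      by (rule reaches_frozen_move[where s' = "q (j - 1)" and r = True])
         (use q[OF Suc.prems(3)] move count(2) True IH in simp_all)
  next
    case False
    then have count: "card ?rest = j" using Suc.prems(1) split by auto
    have IH: "reaches_frozen Y X (conf Y X (q j) (Suc h) M) d"
      using Suc.hyps(1)[OF ht(2) count] ht Suc.prems by simp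
    show ?thesis
      by (rule reaches_frozen_move[where s' = "q j" and r = True])
         (use q[OF Suc.prems(3)] move False IH in simp_all)
  qed
qed

text \<open>The contents of the scratch tape when a cell has been inserted at \<open>a\<close> and the part up to \<open>c\<close> has been shifted.\<close>

definition shifted_up :: "nat \<Rightarrow> nat set \<Rightarrow> nat \<Rightarrow> nat set" where
  "shifted_up a M c = {n. (n < a \<and> n \<in> M) \<or> (a < n \<and> n \<le> c \<and> n - 1 \<in> M) \<or> (c < n \<and> n \<in> M)}"

lemma shifted_up_Suc:
  assumes "a \<le> c"
  shows "shifted_up a M (Suc c) = (if c \<in> M then insert (Suc c) (shifted_up a M c)
      else shifted_up a M c - {Suc c})"
proof (rule set_eqI)
  fix n
  show "n \<in> shifted_up a M (Suc c) \<longleftrightarrow>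
      n \<in> (if c \<in> M then insert (Suc c) (shifted_up a M c) else shifted_up a M c - {Suc c})"
  proof (cases "n = Suc c")
    case True
    then show ?thesis unfolding shifted_up_def using assms by simp
  next
    case False
    then have "n \<le> Suc c \<longleftrightarrow> n \<le> c" "Suc c < n \<longleftrightarrow> c < n" by auto
    then show ?thesis unfolding shifted_up_def using False by simp
  qed
qed

lemma Suc_in_shifted_up: "a \<le> c \<Longrightarrow> Suc c \<in> shifted_up a M c \<longleftrightarrow> Suc c \<in> M"
  unfolding shifted_up_def by simp

lemma shifted_up_end:
  assumes "\<And>m. m \<in> M \<Longrightarrow> m \<le> t"
  shows "shifted_up a M (Suc t) = insert_cell a M"
proof (rule set_eqI)
  fix n
  have "n \<notin> M" if "Suc t < n" using assms[of n] that by auto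
  moreover have "n - 1 \<notin> M" if "\<not> n \<le> Suc t" using assms[of "n - 1"] that by auto
  ultimately show "n \<in> shifted_up a M (Suc t) \<longleftrightarrow> n \<in> insert_cell a M"
    unfolding shifted_up_def insert_cell_def by blast
qed

lemma insert_mark:
  assumes M: "finite M" and K: "K \<in> R" and t: "t \<in> M" "\<And>m. m \<in> M \<Longrightarrow> m \<le> t"
    and "a \<le> c" "c \<le> t" "card {m \<in> M. c \<le> m} = r" "r \<le> k"
    and target: "reaches_frozen Y X (conf Y X (Return k K) (Suc t) (insert_cell a M)) d"
  shows "reaches_frozen Y X (conf Y X (Insert (c \<in> M) r K) (Suc c) (shifted_up a M c)) d"
  using assms(5-8)
proof (induction "t - c" arbitrary: c r)
  case 0
  then have at_end: "c = t" by simp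
  have "{m \<in> M. t \<le> m} = {t}" using t by (auto intro: order_antisym)
  then have r: "r = 1" using 0 at_end by simp
  have finish:
    "reaches_frozen Y X (conf Y X (Back (Return k K)) (Suc (Suc t)) (shifted_up a M (Suc t))) d"
    using back_step[of "Return k K" Y X "Suc t" "shifted_up a M (Suc t)" d] target K shifted_up_end[OF t(2)] by simp
  show ?case
    by (rule reaches_frozen_step[OF _ _ _ _ finish, where b = True and r = True])
       (use at_end r K t(1) shifted_up_Suc[OF 0(2)] k in simp_all)
next
  case (Suc n)
  then have ct: "c < t" "n = t - Suc c" by auto
  let ?rest = "{m \<in> M. Suc c \<le> m}"
  have fin: "finite ?rest" using M by simp
  have split: "{m \<in> M. c \<le> m} = (if c \<in> M then insert c ?rest else ?rest)"
    by (auto simp: le_less Suc_le_eq)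
  have "t \<in> ?rest" using t(1) ct by simp
  then have "card ?rest \<noteq> 0" using fin by auto
  moreover have count: "card ?rest = r - of_bool (c \<in> M)" using Suc.prems(3) split fin
    by (cases "c \<in> M") auto
  ultimately have nonzero: "r - of_bool (c \<in> M) \<noteq> 0" by metis
  have IH: "reaches_frozen Y X
      (conf Y X (Insert (Suc c \<in> M) (r - of_bool (c \<in> M)) K) (Suc (Suc c)) (shifted_up a M (Suc c))) d"
    using Suc.hyps(1)[OF ct(2) _ _ count] ct Suc.prems by simp
  show ?case
    by (rule reaches_frozen_step[OF _ _ _ _ IH, where b = "c \<in> M" and r = True])
       (use Suc.prems K Suc_in_shifted_up[OF Suc.prems(1)] shifted_up_Suc[OF Suc.prems(1)] nonzero in simp_all)
qed

definition shifted_down :: "nat set \<Rightarrow> nat \<Rightarrow> nat set" where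
  "shifted_down M c = {n. (n \<le> c \<and> n \<in> M) \<or> (c < n \<and> Suc n \<in> M)}"

lemma shifted_down_eq:
  "shifted_down M c =
     (if Suc (Suc c) \<in> M then insert (Suc c) (shifted_down M (Suc c)) else shifted_down M (Suc c) - {Suc c})"
proof (rule set_eqI)
  fix n
  show "n \<in> shifted_down M c \<longleftrightarrow>
    n \<in> (if Suc (Suc c) \<in> M then insert (Suc c) (shifted_down M (Suc c)) else shifted_down M (Suc c) - {Suc c})"
  proof (cases "n = Suc c")
    case False
    then have "n \<le> Suc c \<longleftrightarrow> n \<le> c" "Suc c < n \<longleftrightarrow> c < n" by auto
    then show ?thesis unfolding shifted_down_def using False by simp
  qed (simp add: shifted_down_def)
qed

lemma in_shifted_down: "c \<in> shifted_down M c \<longleftrightarrow> c \<in> M"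
  unfolding shifted_down_def by simp

lemma shifted_down_end: "Suc a \<in> M \<Longrightarrow> a \<notin> M \<Longrightarrow> insert a (shifted_down M a) = delete_cell a M"
  unfolding shifted_down_def delete_cell_def by (auto simp: le_less)

lemma delete_mark:
  assumes M: "finite M" and K: "K \<in> R" and a: "Suc a \<in> M" "a \<notin> M" and i: "i < k"
    and "a \<le> c" "card {m \<in> M. Suc a \<le> m \<and> m \<le> Suc c} = r" "r \<le> k"
    and target: "reaches_frozen Y X (conf Y X (Return (Suc i) K) a (delete_cell a M)) d"
  shows "reaches_frozen Y X (conf Y X (Delete (Suc c \<in> M) r i K) c (shifted_down M c)) d"
  using assms(6-8)
proof (induction "c - a" arbitrary: c r)
  case 0
  then have at_end: "c = a" by simp
  have "{m \<in> M. Suc a \<le> m \<and> m \<le> Suc a} = {Suc a}" using a(1) by auto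
  then have r: "r = 1" using 0 at_end by simp
  have finish:
    "reaches_frozen Y X (conf Y X (Back (Return (Suc i) K)) (Suc a) (insert a (shifted_down M a))) d"
    using back_step[of "Return (Suc i) K" Y X a "insert a (shifted_down M a)" d] i target K shifted_down_end[OF a] by simp
  show ?case
    by (rule reaches_frozen_step[OF _ _ _ _ finish, where b = True and r = True])
       (use at_end r K a(1) i k in simp_all)
next
  case (Suc n)
  then obtain c' where c': "c = Suc c'" "a \<le> c'" "n = c' - a" by (cases c) auto
  let ?rest = "{m \<in> M. Suc a \<le> m \<and> m \<le> Suc c'}"
  have fin: "finite ?rest" using M by simp
  have split: "{m \<in> M. Suc a \<le> m \<and> m \<le> Suc c} = (if Suc c \<in> M then insert (Suc c) ?rest else ?rest)"
    using c' by (auto simp: le_Suc_eq)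
  have "Suc a \<in> ?rest" using a(1) c' by simp
  then have "card ?rest \<noteq> 0" using fin by auto
  moreover have count: "card ?rest = r - of_bool (Suc c \<in> M)"
    using Suc.prems(2) split fin c' by (cases "Suc c \<in> M") auto
  ultimately have nonzero: "r - of_bool (Suc c \<in> M) \<noteq> 0" by metis
  have IH: "reaches_frozen Y X
      (conf Y X (Delete (Suc c' \<in> M) (r - of_bool (Suc c \<in> M)) i K) c' (shifted_down M c')) d"
    using Suc.hyps(1)[OF c'(3) c'(2) count] Suc.prems by simp
  show ?case
    by (rule reaches_frozen_step[OF _ _ _ _ IH, where b = "Suc c \<in> M" and r = False])
       (use Suc.prems i K in_shifted_down[of c] shifted_down_eq[of M c'] nonzero c' in simp_all)
qed

definition ready :: "(nat \<Rightarrow> bool) \<Rightarrow> (nat \<Rightarrow> bool) \<Rightarrow> com list \<Rightarrow> (nat \<Rightarrow> nat) \<Rightarrow> cfg" where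
  "ready Y X K s = conf Y X (Return 1 K) (s 0) (marks k s)"

lemma frozen_ready [simp]: "frozen Y X (ready Y X K s)"
  unfolding ready_def by simp

lemma first_mark: "s 0 \<in> marks k s" "m \<in> marks k s \<Longrightarrow> s 0 \<le> m"
  using mark_pos_in_marks[of s 0 k] k mark_pos_le_iff[of s 0] unfolding marks_def by auto

lemma last_mark: "mark_pos s (k - 1) \<in> marks k s" "m \<in> marks k s \<Longrightarrow> m \<le> mark_pos s (k - 1)"
  using k unfolding marks_def by (auto simp: mark_pos_le_iff)

lemma card_marks_le: "i < k \<Longrightarrow> card {m \<in> marks k s. m \<le> mark_pos s i} = Suc i"
proof -
  assume "i < k"
  then have "{j. j < k \<and> j \<le> i} = {..i}" by auto
  then show ?thesis unfolding card_marks mark_pos_le_iff by simp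
qed

lemma card_marks_ge: "card {m \<in> marks k s. mark_pos s i \<le> m} = k - i"
proof -
  have "{j. j < k \<and> i \<le> j} = {i..<k}" by auto
  then show ?thesis unfolding card_marks mark_pos_le_iff by simp
qed

lemma return_to_first:
  assumes "i < k" "K \<in> R" "reaches_frozen Y X (ready Y X K s) d"
  shows "reaches_frozen Y X (conf Y X (Return (Suc i) K) (mark_pos s i) (marks k s)) d"
proof (rule walk_left[where M = "marks k s" and t = "s 0"])
  show "s 0 \<le> m" if "m \<in> marks k s" for m using that by (rule first_mark(2))
  show "s 0 \<le> mark_pos s i" using mark_pos_le_iff[of s 0 i] by simp
qed (use assms first_mark(1)[of s] card_marks_le in \<open>simp_all add: ready_def\<close>)

lemma ready_step:
  assumes "K \<in> R" "put_bit K (Y (s 0)) = b" "dispatch main K (s 0 \<in> y) (X (s 0)) = q"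
  shows "step p y (ready Y X K s) = conf (Y(s 0 := b)) X (Back q) (Suc (s 0)) (marks k s)"
  unfolding ready_def
  by (subst step_conf[where s' = "Back q" and wi = b and wo = "X (s 0)" and b = True and r = True])
     (use assms k first_mark(1)[of s] in \<open>simp_all add: insert_absorb\<close>)

lemma put_bit_id: "(\<And>b. c \<noteq> Put b) \<Longrightarrow> put_bit (c # K) b = b"
  unfolding put_bit_def by (cases c) auto

lemma dispatch_step:
  assumes "K \<in> R" "put_bit K (Y (s 0)) = Y (s 0)"
    "Back (dispatch main K (s 0 \<in> y) (X (s 0))) \<in> states k R"
    "reaches_frozen Y X (conf Y X (dispatch main K (s 0 \<in> y) (X (s 0))) (s 0) (marks k s)) d"
  shows "reaches_frozen Y X (ready Y X K s) d"
proof (rule reaches_step)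
  show "reaches_frozen Y X (step p y (ready Y X K s)) d"
    using ready_step[of K Y s "Y (s 0)" X] back_step[OF assms(3,4)] assms(1,2) by simp
qed simp

lemma skip_instr:
  assumes "c # K \<in> R" "K' \<in> R" "dispatch main (c # K) (s 0 \<in> y) (X (s 0)) = Return 1 K'" "\<And>b. c \<noteq> Put b"
    "reaches_frozen Y X (ready Y X K' s) d"
  shows "reaches_frozen Y X (ready Y X (c # K) s) d"
  by (rule dispatch_step) (use assms k put_bit_id[OF assms(4)] in \<open>auto simp: ready_def\<close>)

lemma seek_instr:
  assumes "c # K \<in> R" "dispatch main (c # K) (s 0 \<in> y) (X (s 0)) = Seek (Suc i) (c # K)" "i < k"
    "reaches_frozen Y X (conf Y X (Seek 1 (c # K)) (mark_pos s i) (marks k s)) d"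
  shows "reaches_frozen Y X (ready Y X (c # K) s) d"
proof (rule dispatch_step)
  have "{m \<in> marks k s. s 0 \<le> m \<and> m \<le> mark_pos s i} = {m \<in> marks k s. m \<le> mark_pos s i}"
    using first_mark(2) by auto
  then have card: "card {m \<in> marks k s. s 0 \<le> m \<and> m \<le> mark_pos s i} = Suc i"
    using card_marks_le[OF assms(3)] by simp
  have "reaches_frozen Y X (conf Y X (Seek (Suc i) (c # K)) (s 0) (marks k s)) d"
    by (rule walk_right[where t = "mark_pos s i" and q = "\<lambda>j. Seek j (c # K)"])
       (use assms card mark_pos_le_iff[of s 0 i] in auto)
  then show
    "reaches_frozen Y X (conf Y X (dispatch main (c # K) (s 0 \<in> y) (X (s 0))) (s 0) (marks k s)) d"
    unfolding assms(2) .
  show "put_bit (c # K) (Y (s 0)) = Y (s 0)" by (rule put_bit_id) (use assms(2) in auto)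
qed (use assms in simp_all)

lemma inc_instr:
  assumes R: "Inc i # K \<in> R" "K \<in> R" and i: "i < k"
      and target: "reaches_frozen Y X (ready Y X K (s(i := Suc (s i)))) d"
  shows "reaches_frozen Y X (ready Y X (Inc i # K) s) d"
proof (rule seek_instr[of "Inc i" K s X i])
  let ?M = "marks k s" and ?s = "s(i := Suc (s i))"
  have "mark_pos ?s (k - 1) = Suc (mark_pos s (k - 1))" using mark_pos_inc[of i "k - 1" s] i by simp
  moreover have
    "reaches_frozen Y X (conf Y X (Return (Suc (k - 1)) K) (mark_pos ?s (k - 1)) (marks k ?s)) d"
    by (rule return_to_first) (use R target k in auto)
  ultimately have return:
    "reaches_frozen Y X (conf Y X (Return k K) (Suc (mark_pos s (k - 1))) (insert_cell (mark_pos s i) ?M)) d"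
    using k marks_inc[OF i, of s] by (simp only: Suc_diff_1)
  have "reaches_frozen Y X
      (conf Y X (Insert (mark_pos s i \<in> ?M) (k - i) K) (Suc (mark_pos s i)) (shifted_up (mark_pos s i) ?M (mark_pos s i))) d"
    by (rule insert_mark[OF _ _ last_mark(1) last_mark(2)])
       (use R i card_marks_ge return in \<open>auto simp: mark_pos_le_iff\<close>)
  moreover have "shifted_up (mark_pos s i) ?M (mark_pos s i) = ?M - {mark_pos s i}"
    unfolding shifted_up_def by auto
  ultimately have insert:
    "reaches_frozen Y X (conf Y X (Insert True (k - i) K) (Suc (mark_pos s i)) (?M - {mark_pos s i})) d"
    using i by simp
  show "reaches_frozen Y X (conf Y X (Seek 1 (Inc i # K)) (mark_pos s i) ?M) d"
    by (rule reaches_frozen_step[OF _ _ _ _ insert, where b = False and r = True])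
       (use R i k in simp_all)
qed (use assms in auto)

text \<open>Moving left from mark \<open>i\<close> lands on a mark iff register \<open>i\<close> is zero; for \<open>i = 0\<close> this uses that the head
  cannot leave cell 0.\<close>

lemma left_of_zero_mark:
  assumes "s i = 0" "i < k" "K \<in> R" "reaches_frozen Y X (ready Y X K s) d"
  shows "mark_pos s i - 1 \<in> marks k s"
    and "reaches_frozen Y X (conf Y X (Return (max 1 i) K) (mark_pos s i - 1) (marks k s)) d"
proof -
  have "mark_pos s i - 1 \<in> marks k s \<and>
    reaches_frozen Y X (conf Y X (Return (max 1 i) K) (mark_pos s i - 1) (marks k s)) d"
  proof (cases "i = 0")
    case True
    then show ?thesis using assms(1,4) first_mark(1)[of s] by (simp add: ready_def)
  next
    case False
    then have "mark_pos s i - 1 = mark_pos s (i - 1)" "max 1 i = Suc (i - 1)"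
      using mark_pos_pred_zero[of i s] assms(1) by auto
    then show ?thesis using return_to_first[of "i - 1" K Y X s d] assms by simp
  qed
  then show "mark_pos s i - 1 \<in> marks k s"
    "reaches_frozen Y X (conf Y X (Return (max 1 i) K) (mark_pos s i - 1) (marks k s)) d" by blast+
qed

lemma test_instr:
  assumes c: "c # K \<in> R" "dispatch main (c # K) (s 0 \<in> y) (X (s 0)) = Seek (Suc i) (c # K)" "i < k"
    "\<And>i. c \<noteq> Inc i"
    and zero: "\<And>bo bi bx. transition k main (Test (c # K)) bo bi True bx =
        Some (Back (Return (max 1 i) K0), bi, True, bx, True)"
      "K0 \<in> R" "s i = 0 \<Longrightarrow> reaches_frozen Y X (ready Y X K0 s) d"
    and nonzero: "\<And>bo bi bx. transition k main (Test (c # K)) bo bi False bx =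
        Some (q, bi, False, bx, True)"
      "s i \<noteq> 0 \<Longrightarrow> reaches_frozen Y X (conf Y X q (mark_pos s i) (marks k s)) d"
  shows "reaches_frozen Y X (ready Y X (c # K) s) d"
proof (rule seek_instr[of c K s X i])
  let ?M = "marks k s"
  have test: "reaches_frozen Y X (conf Y X (Test (c # K)) (mark_pos s i - 1) ?M) d"
  proof (cases "s i = 0")
    case True
    note left = left_of_zero_mark[OF True c(3) zero(2) zero(3)[OF True]]
    have returned:
      "reaches_frozen Y X (conf Y X (Back (Return (max 1 i) K0)) (Suc (mark_pos s i - 1)) ?M) d"
      by (rule back_step[OF _ left(2)]) (use c(3) k zero(2) in auto)
    show ?thesis
      by (rule reaches_frozen_move[where r = True]) (use c(1) zero(1) left(1) returned in simp_all)
  next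
    case False
    have pos: "0 < mark_pos s i" using False by (cases i) auto
    have gap: "mark_pos s i - 1 \<notin> ?M" using mark_pos_pred_notin False by blast
    show ?thesis
      by (rule reaches_frozen_move[where r = True])
         (use c(1) nonzero(1) nonzero(2)[OF False] pos gap in simp_all)
  qed
  show "reaches_frozen Y X (conf Y X (Seek 1 (c # K)) (mark_pos s i) ?M) d"
  proof (rule reaches_frozen_step[OF _ _ _ _ test, where b = True and r = False])
    show "transition k main (Seek 1 (c # K)) (mark_pos s i \<in> y) (Y (mark_pos s i)) (mark_pos s i \<in> ?M) (X (mark_pos s i))
        = Some (Test (c # K), Y (mark_pos s i), True, X (mark_pos s i), False)"
      by (cases c) (use c(3,4) in force)+
  qed (use c(1,3) k in \<open>simp_all add: insert_absorb\<close>)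
qed (fact c)+

lemma seek_last_mark:
  assumes R: "Dec i # K \<in> R" "K \<in> R" and i: "i < k" "s i \<noteq> 0"
    and target: "reaches_frozen Y X (ready Y X K (s(i := s i - 1))) d"
  shows "reaches_frozen Y X (conf Y X (SeekLast (k - i) i K) (mark_pos s i) (marks k s)) d"
proof -
  let ?M = "marks k s" and ?s = "s(i := s i - 1)"
  define a where "a = mark_pos s i - 1"
  define t where "t = mark_pos s (k - 1)"
  have a: "mark_pos s i = Suc a" unfolding a_def using i by (cases i) auto
  have before_last: "mark_pos s i \<le> t" unfolding t_def using i by (simp add: mark_pos_le_iff)
  then have t: "t = Suc (t - 1)" using a by auto
  have "mark_pos ?s i = a" using mark_pos_dec[of i i s] i a by simp
  moreover have "reaches_frozen Y X (conf Y X (Return (Suc i) K) (mark_pos ?s i) (marks k ?s)) d"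
    by (rule return_to_first) (use R i target in auto)
  ultimately have return: "reaches_frozen Y X (conf Y X (Return (Suc i) K) a (delete_cell a ?M)) d"
    unfolding marks_dec[of i k s, OF i] a_def[symmetric] by simp
  have last: "t \<in> ?M" "m \<in> ?M \<Longrightarrow> m \<le> t" for m unfolding t_def using last_mark by blast+
  then have "{m \<in> ?M. mark_pos s i \<le> m \<and> m \<le> t} = {m \<in> ?M. mark_pos s i \<le> m}" by auto
  then have card: "card {m \<in> ?M. mark_pos s i \<le> m \<and> m \<le> t} = k - i" using card_marks_ge by simp
  have "reaches_frozen Y X
      (conf Y X (Delete (Suc (t - 1) \<in> ?M) (k - i) i K) (t - 1) (shifted_down ?M (t - 1))) d"
  proof (rule delete_mark[where a = a])
    show "Suc a \<in> ?M" unfolding a[symmetric] using i(1) by simp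
    show "a \<notin> ?M" unfolding a_def using mark_pos_pred_notin i(2) by blast
    show "card {m \<in> ?M. Suc a \<le> m \<and> m \<le> Suc (t - 1)} = k - i" using card a t by metis
  qed (use R i return before_last a in auto)
  moreover have "shifted_down ?M (t - 1) = ?M - {t}"
  proof (rule set_eqI)
    fix n
    have "Suc n \<notin> ?M" if "t - 1 < n" using last(2)[of "Suc n"] that t by auto
    moreover have "n \<le> t - 1 \<longleftrightarrow> n \<noteq> t" if "n \<in> ?M" using last(2)[of n] that t by auto
    ultimately show "n \<in> shifted_down ?M (t - 1) \<longleftrightarrow> n \<in> ?M - {t}" unfolding shifted_down_def by blast
  qed
  ultimately have delete: "reaches_frozen Y X (conf Y X (Delete True (k - i) i K) (t - 1) (?M - {t})) d"
    using t last(1) by simp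
  have found: "reaches_frozen Y X (conf Y X (SeekLast 1 i K) t ?M) d"
    by (rule reaches_frozen_step[OF _ _ _ _ delete, where b = False and r = False])
       (use R i k last(1) in simp_all)
  show ?thesis
    by (rule walk_right[where t = t and q = "\<lambda>j. SeekLast j i K"])
       (use R i card before_last last(1) found in auto)
qed

lemma dec_instr:
  assumes "Dec i # K \<in> R" "K \<in> R" "i < k" "reaches_frozen Y X (ready Y X K (s(i := s i - 1))) d"
  shows "reaches_frozen Y X (ready Y X (Dec i # K) s) d"
proof (rule test_instr[where i = i and ?K0.0 = K and q = "SeekLast (k - i) i K"])
  show "reaches_frozen Y X (ready Y X K s) d" if "s i = 0" using assms(4) that
    by (simp add: fun_upd_idem)
  show "reaches_frozen Y X (conf Y X (SeekLast (k - i) i K) (mark_pos s i) (marks k s)) d" if "s i \<noteq> 0"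
    using assms(1-3) that assms(4) by (rule seek_last_mark)
qed (use assms in auto)

lemma loop_instr:
  assumes R: "Loop i c # K \<in> R" "Dec i # c # Loop i c # K \<in> R" "c # Loop i c # K \<in> R"
    "K \<in> R" and i: "i < k" "i \<notin> writes c"
    and body: "\<And>s d. reaches_frozen Y X (ready Y X (Loop i c # K) (exec y (Collect X) c s)) d \<Longrightarrow>
      reaches_frozen Y X (ready Y X (c # Loop i c # K) s) d"
    and "reaches_frozen Y X (ready Y X K (exec y (Collect X) (Loop i c) s)) d"
  shows "reaches_frozen Y X (ready Y X (Loop i c # K) s) d"
  using assms(8)
proof (induction "s i" arbitrary: s)
  case 0
  show ?case
    by (rule test_instr[where i = i and ?K0.0 = K and q = "Return (Suc i) (Dec i # c # Loop i c # K)"]) (use R i 0 in auto)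
next
  case (Suc n)
  let ?B = "\<lambda>s. exec y (Collect X) c (s(i := s i - 1))"
  have Bi: "?B s i = n" using Suc.hyps(2) i(2) by (simp add: exec_unchanged)
  have "(?B ^^ s i) s = (?B ^^ n) (?B s)" using Suc.hyps(2) funpow_Suc_right[of n ?B]
    by (simp del: funpow.simps)
  then have "reaches_frozen Y X (ready Y X K (exec y (Collect X) (Loop i c) (?B s))) d"
    using Suc.prems Bi by simp
  then have "reaches_frozen Y X (ready Y X (Loop i c # K) (?B s)) d" using Suc.hyps(1)[of "?B s"] Bi
    by simp
  then have "reaches_frozen Y X (ready Y X (c # Loop i c # K) (s(i := s i - 1))) d" by (rule body)
  then have round: "reaches_frozen Y X (ready Y X (Dec i # c # Loop i c # K) s) d"
    by (rule dec_instr[OF R(2,3) i(1)])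
  have "s i \<noteq> 0" using Suc.hyps(2) by simp
  show ?case
    by (rule test_instr[where i = i and ?K0.0 = K and q = "Return (Suc i) (Dec i # c # Loop i c # K)"])
       (use R i round \<open>s i \<noteq> 0\<close> in \<open>auto intro: return_to_first\<close>)
qed

lemma cond_instr:
  assumes "Cond i c1 c2 # K \<in> R" "c1 # K \<in> R" "c2 # K \<in> R" "i < k"
    and "s i \<noteq> 0 \<Longrightarrow> reaches_frozen Y X (ready Y X (c1 # K) s) d"
    and "s i = 0 \<Longrightarrow> reaches_frozen Y X (ready Y X (c2 # K) s) d"
  shows "reaches_frozen Y X (ready Y X (Cond i c1 c2 # K) s) d"
  by (rule test_instr[where i = i and ?K0.0 = "c2 # K" and q = "Return (Suc i) (c1 # K)"])
     (use assms in \<open>auto intro: return_to_first\<close>)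

lemma query_instr:
  assumes R: "Query b # K \<in> R" "Inc 1 # K \<in> R" "K \<in> R" and "1 < k"
    and target: "reaches_frozen Y X (ready Y X K (exec y (Collect X) (Query b) s)) d"
  shows "reaches_frozen Y X (ready Y X (Query b # K) s) d"
proof (cases "s 0 \<in> (if b then y else Collect X)")
  case True
  then have inc: "reaches_frozen Y X (ready Y X (Inc 1 # K) s) d"
    using target R \<open>1 < k\<close> by (intro inc_instr) (simp_all add: fun_upd_def)
  show ?thesis by (rule skip_instr[where K' = "Inc 1 # K"]) (use True R inc in auto)
next
  case False
  then show ?thesis using target R by (intro skip_instr[where K' = K]) auto
qed

lemma reaches_exec:
  assumes "wf_com c" "registers c \<subseteq> {..<k}" "stacks c K \<subseteq> R" "K \<in> R"
    "reaches_frozen Y X (ready Y X K (exec y (Collect X) c s)) d"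
  shows "reaches_frozen Y X (ready Y X (c # K) s) d"
  using assms
proof (induction c arbitrary: K s d)
  case Skip
  then show ?case by (intro skip_instr[where K' = K]) auto
next
  case (Inc i)
  then show ?case by (intro inc_instr) (simp_all add: fun_upd_def)
next
  case (Dec i)
  then show ?case by (intro dec_instr) (simp_all add: fun_upd_def)
next
  case (Seq c1 c2)
  have R: "c2 # K \<in> R" "c1 # c2 # K \<in> R" "Seq c1 c2 # K \<in> R"
    using Seq.prems(3) Cons_in_stacks[of c1 "c2 # K"] Cons_in_stacks[of c2 K] by auto
  have second: "reaches_frozen Y X (ready Y X (c2 # K) (exec y (Collect X) c1 s)) d"
    by (rule Seq.IH(2)) (use Seq.prems in auto)
  have first: "reaches_frozen Y X (ready Y X (c1 # c2 # K) s) d"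
    by (rule Seq.IH(1)) (use Seq.prems R second in auto)
  show ?case by (rule skip_instr[where K' = "c1 # c2 # K"]) (use R first in auto)
next
  case (Cond i c1 c2)
  have R: "c2 # K \<in> R" "c1 # K \<in> R" "Cond i c1 c2 # K \<in> R"
    using Cond.prems(3) Cons_in_stacks[of c1 K] Cons_in_stacks[of c2 K] by auto
  have nonzero: "reaches_frozen Y X (ready Y X (c1 # K) s) d" if "s i \<noteq> 0"
    by (rule Cond.IH(1)) (use Cond.prems that in auto)
  have zero: "reaches_frozen Y X (ready Y X (c2 # K) s) d" if "s i = 0"
    by (rule Cond.IH(2)) (use Cond.prems that in auto)
  show ?case by (rule cond_instr) (use Cond.prems R nonzero zero in auto)
next
  case (Loop i c)
  have R: "Loop i c # K \<in> R" "Dec i # c # Loop i c # K \<in> R" "c # Loop i c # K \<in> R"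
    using Loop.prems(3) Cons_in_stacks[of c "Loop i c # K"] by auto
  show ?case
  proof (rule loop_instr[OF R])
    show "reaches_frozen Y X (ready Y X (c # Loop i c # K) s) d"
      if "reaches_frozen Y X (ready Y X (Loop i c # K) (exec y (Collect X) c s)) d" for s d
      by (rule Loop.IH) (use Loop.prems R(1) that in simp_all)
  qed (use Loop.prems in auto)
next
  case (Query b)
  then show ?case using k by (intro query_instr) auto
qed auto

end

section \<open>Iterating a finitary operator on the Turing machine\<close>

text \<open>Register 2 holds an address; \<open>c\<close> evaluates a predicate at the address in register 3, and the result is put
  at the address in register 0.\<close>

definition prepare_com :: "com \<Rightarrow> com" where
  "prepare_com c = Seq (Inc 2) (Seq (copy 2 3 4) (Seq c (copy 2 0 4)))"

definition put_com :: com where "put_com = Cond 3 (Put True) (Put False)"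

definition main_com :: "com \<Rightarrow> com" where
  "main_com c = Seq (prepare_com c) (Seq put_com (clear 0))"

lemma tape_config_limit:
  assumes "v \<in> {tin, tsc, tout}" "is_limit t"
  shows "v (config p y z t) n \<longleftrightarrow> n \<in> limsup (\<lambda>u. Collect (v (config p y z u))) t"
  using assms by (auto simp: config_limit_sel)

lemma tape_next_limit_eventually:
  assumes "v \<in> {tin, tsc, tout}" "\<And>j. k \<le> j \<Longrightarrow> v ((step p y ^^ j) (config p y z u)) n = b"
  shows "v (config p y z (next_limit u)) n = b"
  unfolding tape_config_limit[OF assms(1) is_limit_next_limit]
  by (rule in_limsup_next_limit_eventually[where k = k]) (simp add: config_funpow_succ assms(2))

lemma tsc_next_limit_cofinal:
  assumes "\<And>k. \<exists>j\<ge>k. tsc ((step p y ^^ j) (config p y z u)) n"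
  shows "tsc (config p y z (next_limit u)) n"
  unfolding tsc_config_limit[OF is_limit_next_limit] in_limsup_next_limit using assms
  by (simp add: config_funpow_succ)

lemma config_before_next_limit:
  assumes "\<And>j. I ((step p y ^^ j) (config p y z u))" "u \<le> v" "v < next_limit u"
  shows "I (config p y z v)"
  using ex_funpow_succ_eq[OF assms(2,3)] assms(1) by (auto simp: config_funpow_succ)

lemma increasing_covers:
  fixes J :: "nat \<Rightarrow> nat"
  assumes "\<And>n. J n < J (Suc n)" "J m \<le> i"
  obtains n where "m \<le> n" "J n \<le> i" "i \<le> J (Suc n)"
proof -
  have "\<exists>n\<ge>m. J n \<le> i \<and> i \<le> J (Suc n)"
    using assms(2)
  proof (induction i rule: dec_induct)
    case base
    show ?case using assms(1)[of m] by (intro exI[of _ m]) simp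
  next
    case (step i)
    then obtain n where n: "m \<le> n" "J n \<le> i" "i \<le> J (Suc n)" by blast
    show ?case
    proof (cases "i = J (Suc n)")
      case True
      then show ?thesis using n(1) assms(1)[of "Suc n"] by (intro exI[of _ "Suc n"]) simp
    next
      case False
      then show ?thesis using n by (intro exI[of _ n]) simp
    qed
  qed
  then show ?thesis using that by blast
qed

lemma increasing_imp_ge: "(\<And>n. J n < J (Suc n)) \<Longrightarrow> n \<le> (J n :: nat)"
  by (induction n) (auto intro: Suc_leI le_less_trans)

locale evaluator = register_machine p y f k "main_com c" R for p y f k c R +
  fixes Q :: "nat set \<Rightarrow> nat set \<Rightarrow> nat \<Rightarrow> bool"
  assumes k_bound: "4 < k" and registers: "registers c \<subseteq> {..<k}" and evaluates: "evaluates 3 c Q"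
begin

lemma exec_prepare_com:
  fixes s X
  assumes "s 0 = 0" "s 1 = 0" "s 2 = n"
  defines "s' \<equiv> exec y X (prepare_com c) s"
  shows "s' 0 = Suc n" "s' 1 = 0" "s' 2 = Suc n" "s' 3 = of_bool (Q y X (Suc n))"
proof -
  define t where "t = s(2 := Suc n, 3 := Suc n, 4 := 0)"
  have t: "t 0 = 0" "t 1 = 0" "t 3 = Suc n" "t 2 = Suc n" unfolding t_def using assms(1-3) by simp_all
  have "s' = (exec y X c t)(0 := exec y X c t 2, 4 := 0)"
    unfolding s'_def prepare_com_def exec.simps exec_copy[of 2 3 4, simplified] exec_copy[of 2 0 4, simplified] t_def
    using assms(3) by (simp add: fun_upd_def)
  moreover have "exec y X c t 2 = t 2" using evaluates
    by (intro exec_unchanged) (simp add: evaluates_def)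
  moreover have "exec y X c t 3 = of_bool (Q y X (t 3))" "exec y X c t 1 = 0"
    using evaluates t unfolding evaluates_def by blast+
  ultimately show "s' 0 = Suc n" "s' 1 = 0" "s' 2 = Suc n" "s' 3 = of_bool (Q y X (Suc n))" using t
    by simp_all
qed

lemma main_stacks:
  "[main_com c] \<in> R" "[prepare_com c, Seq put_com (clear 0)] \<in> R"
    "stacks (prepare_com c) [Seq put_com (clear 0)] \<subseteq> R"
  "[Seq put_com (clear 0)] \<in> R" "[put_com, clear 0] \<in> R" "[Put b, clear 0] \<in> R" "[clear 0] \<in> R"
    "stacks (clear 0) [] \<subseteq> R"
proof -
  have "stacks (main_com c) [] = insert [main_com c]
      (stacks (prepare_com c) [Seq put_com (clear 0)] \<union> stacks (Seq put_com (clear 0)) [])"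
    unfolding main_com_def by simp
  then have main: "[main_com c] \<in> R" and prepare: "stacks (prepare_com c) [Seq put_com (clear 0)] \<subseteq> R"
    and put: "stacks (Seq put_com (clear 0)) [] \<subseteq> R"
    using R(2) by auto
  show "[main_com c] \<in> R" by (rule main)
  show "stacks (prepare_com c) [Seq put_com (clear 0)] \<subseteq> R" by (rule prepare)
  then show "[prepare_com c, Seq put_com (clear 0)] \<in> R" using Cons_in_stacks by blast
  show "[Seq put_com (clear 0)] \<in> R" "[put_com, clear 0] \<in> R" using put by (auto simp: put_com_def)
  show "[Put b, clear 0] \<in> R" using put by (cases b) (auto simp: put_com_def)
  show "stacks (clear 0) [] \<subseteq> R" using put by auto
  then show "[clear 0] \<in> R" using Cons_in_stacks by blast
qed

lemma round_evaluates:
  fixes s X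
  defines "s1 \<equiv> exec y (Collect X) (prepare_com c) s"
  assumes "s1 3 = of_bool b"
  shows "reaches_frozen Y X (ready Y X [main_com c] s) (ready Y X [Put b, clear 0] s1)"
proof -
  let ?target = "ready Y X [Put b, clear 0] s1"
  have wf: "wf_com (prepare_com c)" "registers (prepare_com c) \<subseteq> {..<k}"
    using evaluates registers k_bound unfolding evaluates_def prepare_com_def
    by (auto simp: wf_copy) (auto simp: copy_def clear_def move_def)
  have refl: "reaches_frozen Y X ?target ?target" by (rule reaches_refl) simp
  have put: "reaches_frozen Y X (ready Y X [put_com, clear 0] s1) ?target" unfolding put_com_def
  proof (rule test_instr[where i = 3 and ?K0.0 = "[Put False, clear 0]" and q = "Return (Suc 3) [Put True, clear 0]"])
    show "reaches_frozen Y X (ready Y X [Put False, clear 0] s1) ?target" if "s1 3 = 0"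
      using refl that assms(2) by simp
    show "reaches_frozen Y X (conf Y X (Return (Suc 3) [Put True, clear 0]) (mark_pos s1 3) (marks k s1)) ?target" if "s1 3 \<noteq> 0"
      by (rule return_to_first) (use refl that assms(2) k_bound main_stacks in simp_all)
  qed (use main_stacks(5,6) k_bound in \<open>simp_all add: put_com_def\<close>)
  have seq: "reaches_frozen Y X (ready Y X [Seq put_com (clear 0)] s1) ?target"
    by (rule skip_instr[where K' = "[put_com, clear 0]"]) (use main_stacks put in simp_all)
  have prepare: "reaches_frozen Y X (ready Y X [prepare_com c, Seq put_com (clear 0)] s) ?target"
    by (rule reaches_exec) (use wf main_stacks seq in \<open>simp_all only: s1_def\<close>)
  show ?thesis
    by (rule skip_instr[where K' = "[prepare_com c, Seq put_com (clear 0)]"])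
       (use main_stacks prepare in \<open>simp_all add: main_com_def\<close>)
qed

definition in_round :: "(nat \<Rightarrow> bool) \<Rightarrow> (nat \<Rightarrow> bool) \<Rightarrow> nat \<Rightarrow> cfg \<Rightarrow> bool" where
  "in_round Y X n e \<longleftrightarrow> tout e = X \<and> st e \<noteq> 1 \<and> (\<forall>m. m \<noteq> n \<longrightarrow> tin e m = Y m)"

lemma frozen_imp_in_round: "frozen Y X e \<Longrightarrow> in_round Y X n e" "frozen (Y(n := b)) X e \<Longrightarrow> in_round Y X n e"
  unfolding frozen_def in_round_def by auto

lemma round_puts:
  assumes "s 0 = n"
  shows "reaches p y (in_round Y X n) (ready Y X [Put b, clear 0] s) (ready (Y(n := b)) X [] (s(0 := 0)))"
proof (rule reaches_step)
  let ?Y = "Y(n := b)"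
  show "in_round Y X n (ready Y X [Put b, clear 0] s)" by (rule frozen_imp_in_round(1)) simp
  have registers_clear: "registers (clear 0) = {0}" by (simp add: clear_def)
  have "reaches_frozen ?Y X (ready ?Y X [clear 0] s) (ready ?Y X [] (s(0 := 0)))"
    by (rule reaches_exec)
       (use main_stacks R k registers_clear in \<open>simp_all add: reaches_refl\<close>)
  then have
    "reaches_frozen ?Y X (conf ?Y X (Back (Return 1 [clear 0])) (Suc n) (marks k s)) (ready ?Y X [] (s(0 := 0)))"
    using back_step[of "Return 1 [clear 0]"] main_stacks k assms by (simp add: ready_def)
  moreover have "step p y (ready Y X [Put b, clear 0] s) =
      conf ?Y X (Back (Return 1 [clear 0])) (Suc n) (marks k s)"
    using ready_step[of "[Put b, clear 0]" Y s b X] main_stacks assms by (simp add: put_bit_def)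
  ultimately show
    "reaches p y (in_round Y X n) (step p y (ready Y X [Put b, clear 0] s)) (ready ?Y X [] (s(0 := 0)))"
    using reaches_mono frozen_imp_in_round(2) by (metis (no_types, lifting))
qed

lemma one_round:
  assumes s: "s 0 = 0" "s 1 = 0" "s 2 = n"
  shows "\<exists>s'. s' 0 = 0 \<and> s' 1 = 0 \<and> s' 2 = Suc n \<and>
    reaches p y (in_round Y X (Suc n)) (step p y (ready Y X [] s)) (ready (Y(Suc n := Q y (Collect X) (Suc n))) X [] s')"
proof -
  define s1 where "s1 = exec y (Collect X) (prepare_com c) s"
  note s1 = exec_prepare_com[OF s, of "Collect X", folded s1_def]
  have "step p y (ready Y X [] s) = conf Y X (Back (Return 1 [main_com c])) (Suc (s 0)) (marks k s)"
    using ready_step[of "[]" Y s "Y (s 0)" X] R by (simp add: put_bit_def)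
  moreover have
    "reaches_frozen Y X (conf Y X (Return 1 [main_com c]) (s 0) (marks k s)) (ready Y X [main_com c] s)"
    unfolding ready_def by (rule reaches_refl) simp
  ultimately have "reaches_frozen Y X (step p y (ready Y X [] s)) (ready Y X [main_com c] s)"
    using back_step[of "Return 1 [main_com c]"] main_stacks k by simp
  then have
    "reaches_frozen Y X (step p y (ready Y X [] s)) (ready Y X [Put (Q y (Collect X) (Suc n)), clear 0] s1)"
    unfolding s1_def by (rule reaches_trans) (rule round_evaluates, fold s1_def, rule s1(4))
  then have
    "reaches p y (in_round Y X (Suc n)) (step p y (ready Y X [] s)) (ready Y X [Put (Q y (Collect X) (Suc n)), clear 0] s1)"
    by (rule reaches_mono) (rule frozen_imp_in_round(1))
  then have "reaches p y (in_round Y X (Suc n)) (step p y (ready Y X [] s))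
      (ready (Y(Suc n := Q y (Collect X) (Suc n))) X [] (s1(0 := 0)))"
    by (rule reaches_trans) (rule round_puts, rule s1(1))
  then show ?thesis using s1 by (intro exI[of _ "s1(0 := 0)"]) simp
qed

definition round_input :: "(nat \<Rightarrow> bool) \<Rightarrow> (nat \<Rightarrow> bool) \<Rightarrow> nat \<Rightarrow> nat \<Rightarrow> bool" where
  "round_input Y X n m = (if m = 0 then False else if m \<le> n then Q y (Collect X) m else Y m)"

definition after_round :: "(nat \<Rightarrow> bool) \<Rightarrow> (nat \<Rightarrow> bool) \<Rightarrow> nat \<Rightarrow> cfg \<Rightarrow> bool" where
  "after_round Y X n e \<longleftrightarrow> (\<exists>s. s 0 = 0 \<and> s 1 = 0 \<and> s 2 = n \<and> e = ready (round_input Y X n) X [] s)"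

lemma after_round_Suc:
  assumes "after_round Y X n e"
  shows "\<exists>N>0. after_round Y X (Suc n) ((step p y ^^ N) e) \<and>
    (\<forall>j\<le>N. in_round (round_input Y X n) X (Suc n) ((step p y ^^ j) e))"
proof -
  obtain s where s: "s 0 = 0" "s 1 = 0" "s 2 = n" and e: "e = ready (round_input Y X n) X [] s"
    using assms unfolding after_round_def by blast
  have "(round_input Y X n)(Suc n := Q y (Collect X) (Suc n)) = round_input Y X (Suc n)"
    by (auto simp: round_input_def fun_eq_iff)
  then obtain s' where s': "s' 0 = 0" "s' 1 = 0" "s' 2 = Suc n"
    and "reaches p y (in_round (round_input Y X n) X (Suc n)) (step p y e) (ready (round_input Y X (Suc n)) X [] s')"
    using one_round[OF s, of "round_input Y X n" X] unfolding e by auto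
  then obtain N where N: "ready (round_input Y X (Suc n)) X [] s' = (step p y ^^ N) (step p y e)"
    "\<forall>j\<le>N. in_round (round_input Y X n) X (Suc n) ((step p y ^^ j) (step p y e))"
    using reaches_imp_funpow by blast
  have "in_round (round_input Y X n) X (Suc n) e" unfolding e by (rule frozen_imp_in_round(1)) simp
  then have "in_round (round_input Y X n) X (Suc n) ((step p y ^^ j) e)" if "j \<le> Suc N" for j
    using that N(2) by (cases j) (auto simp: funpow_swap1)
  moreover have "after_round Y X (Suc n) ((step p y ^^ Suc N) e)"
    unfolding after_round_def using s' N(1) by (intro exI[of _ s']) (simp add: funpow_swap1)
  ultimately show ?thesis by (intro exI[of _ "Suc N"]) simp
qed

lemma start_phase:
  assumes "s = Init \<or> s = Limit \<and> Y 0"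
  shows "tsc (step p y (conf Y X s 0 {})) 0"
    and "reaches_frozen (Y(0 := False)) X (step p y (conf Y X s 0 {})) (ready (Y(0 := False)) X [] (\<lambda>_. 0))"
proof -
  define Y' where "Y' = Y(0 := False)"
  let ?target = "ready Y' X [] (\<lambda>_. 0)"
  have pos: "mark_pos (\<lambda>_. 0) i = i" for i by (induction i) auto
  have marks: "marks k (\<lambda>_. 0) = {..<k}" unfolding marks_def pos by simp
  have step: "step p y (conf Y X s 0 {}) = conf Y' X (Mark (k - 1)) 1 {0}"
    by (subst step_conf[where s' = "Mark (k - 1)" and wi = False and wo = "X 0" and b = True and r = True])
       (use assms in \<open>auto simp: Y'_def\<close>)
  then show "tsc (step p y (conf Y X s 0 {})) 0" by simp
  have finish: "reaches_frozen Y' X (conf Y' X (Back (Return k [])) (Suc (k - 1)) {..<k}) ?target"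
  proof (rule back_step)
    have "reaches_frozen Y' X (conf Y' X (Return (Suc (k - 1)) []) (mark_pos (\<lambda>_. 0) (k - 1)) (marks k (\<lambda>_. 0))) ?target"
      by (rule return_to_first) (use R k in \<open>simp_all add: reaches_refl\<close>)
    then show "reaches_frozen Y' X (conf Y' X (Return k []) (k - 1) {..<k}) ?target" using k
      by (simp add: pos marks)
  qed (use R in simp)
  have mark: "reaches_frozen Y' X (conf Y' X (Mark j) (k - j) {..<k - j}) ?target" if "0 < j"
    "j < k" for j
    using that
  proof (induction j)
    case (Suc j)
    have insert: "insert (k - Suc j) {..<k - Suc j} = {..<k - j}" "Suc (k - Suc j) = k - j"
      using Suc.prems by auto
    show ?case
    proof (cases "j = 0")
      case True
      show ?thesis
        by (rule reaches_frozen_step[OF _ _ _ _ finish, where b = True and r = True])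
           (use True Suc.prems insert in simp_all)
    next
      case False
      then have IH: "reaches_frozen Y' X (conf Y' X (Mark j) (k - j) {..<k - j}) ?target" using Suc
        by simp
      show ?thesis
        by (rule reaches_frozen_step[OF _ _ _ _ IH, where b = True and r = True])
           (use False Suc.prems insert in simp_all)
    qed
  qed simp
  have "k - (k - 1) = 1" "{..<1::nat} = {0}" using k by auto
  then show
    "reaches_frozen (Y(0 := False)) X (step p y (conf Y X s 0 {})) (ready (Y(0 := False)) X [] (\<lambda>_. 0))"
    unfolding step Y'_def[symmetric] using mark[of "k - 1"] k by simp
qed

lemma ex_rounds:
  fixes Y X s
  assumes "s = Init \<or> s = Limit \<and> Y 0"
  defines "g j \<equiv> (step p y ^^ j) (conf Y X s 0 {})"
  obtains J where "\<And>n. J n < J (Suc n)" "\<And>n. after_round Y X n (g (J n))"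
    "\<And>n j. J n \<le> j \<Longrightarrow> j \<le> J (Suc n) \<Longrightarrow> in_round (round_input Y X n) X (Suc n) (g j)"
    "\<And>j. j \<le> J 0 \<Longrightarrow> tout (g j) = X \<and> st (g j) \<noteq> 1"
proof -
  have g_add: "(step p y ^^ i) (g j) = g (i + j)" for i j unfolding g_def by (simp add: funpow_add)
  have first: "reaches p y (\<lambda>e. tout e = X \<and> st e \<noteq> 1)
      (conf Y X s 0 {}) (ready (Y(0 := False)) X [] (\<lambda>_. 0))"
    by (rule reaches_step[OF _ reaches_mono[OF start_phase(2)[of s Y X, OF assms(1)]]])
       (use f in \<open>auto simp: frozen_def\<close>)
  obtain N where N: "g N = ready (Y(0 := False)) X [] (\<lambda>_. 0)" "\<forall>j\<le>N. tout (g j) = X \<and> st (g j) \<noteq> 1"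
    using reaches_imp_funpow[OF first] unfolding g_def by auto
  have "round_input Y X 0 = Y(0 := False)" unfolding round_input_def by (auto simp: fun_eq_iff)
  then have zero: "after_round Y X 0 (g N)" unfolding after_round_def N(1)
    by (intro exI[of _ "\<lambda>_. 0"]) simp
  define next_round where "next_round n j j' \<longleftrightarrow> j < j' \<and>
      (\<forall>i. j \<le> i \<longrightarrow> i \<le> j' \<longrightarrow> in_round (round_input Y X n) X (Suc n) (g i))" for n j j'
  have "\<exists>j'. after_round Y X (Suc n) (g j') \<and> next_round n j j'" if at: "after_round Y X n (g j)" for n j
  proof -
    obtain M where M: "0 < M" "after_round Y X (Suc n) (g (M + j))"
      "\<forall>i\<le>M. in_round (round_input Y X n) X (Suc n) (g (i + j))"
      using after_round_Suc[OF at] unfolding g_add by blast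
    have "in_round (round_input Y X n) X (Suc n) (g i)" if "j \<le> i" "i \<le> M + j" for i
      using M(3)[rule_format, of "i - j"] that by simp
    then show ?thesis using M(1,2) unfolding next_round_def by (intro exI[of _ "M + j"]) simp
  qed
  then have "\<exists>J. \<forall>n. (after_round Y X n (g (J n)) \<and> (n = 0 \<longrightarrow> J n = N)) \<and> next_round n (J n) (J (Suc n))"
    using dependent_nat_choice[of "\<lambda>n j. after_round Y X n (g j) \<and> (n = 0 \<longrightarrow> j = N)" next_round] zero
    by simp
  then obtain J where "\<And>n. after_round Y X n (g (J n))" "J 0 = N"
    "\<And>n. next_round n (J n) (J (Suc n))" by blast
  then show ?thesis using that[of J] N(2) unfolding next_round_def by blast
qed

lemma eval_phase_steps:
  fixes Y X s
  assumes s: "s = Init \<or> s = Limit \<and> Y 0"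
  defines "g j \<equiv> (step p y ^^ j) (conf Y X s 0 {})"
  shows "tout (g j) = X \<and> st (g j) \<noteq> 1"
    and "\<exists>i. \<forall>j\<ge>i. tin (g j) m = (m \<noteq> 0 \<and> Q y (Collect X) m)"
    and "\<exists>j\<ge>i. tsc (g j) 0"
proof -
  obtain J where J: "\<And>n. J n < J (Suc n)" "\<And>n. after_round Y X n (g (J n))"
    "\<And>n j. J n \<le> j \<Longrightarrow> j \<le> J (Suc n) \<Longrightarrow> in_round (round_input Y X n) X (Suc n) (g j)"
    "\<And>j. j \<le> J 0 \<Longrightarrow> tout (g j) = X \<and> st (g j) \<noteq> 1"
    unfolding g_def using ex_rounds[of s Y X, OF s] by metis
  show "tout (g j) = X \<and> st (g j) \<noteq> 1"
  proof (cases "j \<le> J 0")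
    case False
    then obtain n where "J n \<le> j" "j \<le> J (Suc n)" using increasing_covers[of J 0 j, OF J(1)] by auto
    then show ?thesis using J(3) unfolding in_round_def by blast
  qed (rule J(4))
  have "tin (g j) m = (m \<noteq> 0 \<and> Q y (Collect X) m)" if j: "J m \<le> j" for j
  proof -
    obtain n where n: "m \<le> n" "J n \<le> j" "j \<le> J (Suc n)" using increasing_covers[of J m j, OF J(1) j]
      by blast
    then have "tin (g j) m = round_input Y X n m" using J(3)[OF n(2,3)] unfolding in_round_def by simp
    then show ?thesis using n(1) unfolding round_input_def by simp
  qed
  then show "\<exists>i. \<forall>j\<ge>i. tin (g j) m = (m \<noteq> 0 \<and> Q y (Collect X) m)" by blast
  obtain s' where "s' 0 = 0" "g (J i) = ready (round_input Y X i) X [] s'" using J(2)[of i]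
    unfolding after_round_def by blast
  then have "tsc (g (J i)) 0" using first_mark(1)[of s'] by (simp add: ready_def)
  then show "\<exists>j\<ge>i. tsc (g j) 0" using increasing_imp_ge[of J, OF J(1)] by blast
qed

lemma eval_phase:
  assumes s: "s = Init \<or> s = Limit \<and> Y 0" and u: "config p y {} u = conf Y X s 0 {}"
  shows "\<exists>M. config p y {} (next_limit u) = conf (\<lambda>m. m \<noteq> 0 \<and> Q y (Collect X) m) X Limit 0 M \<and> 0 \<in> M"
    and "v \<in> {u..next_limit u} \<Longrightarrow> tout (config p y {} v) = X \<and> st (config p y {} v) \<noteq> 1"
proof -
  let ?C = "config p y {} (next_limit u)"
  note steps = eval_phase_steps[where s = s and Y = Y and X = X, OF s, folded u]
  have "tout ?C = X"
    by (rule ext, rule tape_next_limit_eventually[of _ 0]) (use steps(1) in simp_all)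
  moreover have "tin ?C = (\<lambda>m. m \<noteq> 0 \<and> Q y (Collect X) m)"
  proof
    fix m
    obtain i where "\<And>j. i \<le> j \<Longrightarrow> tin ((step p y ^^ j) (config p y {} u)) m = (m \<noteq> 0 \<and> Q y (Collect X) m)"
      using steps(2) by blast
    then show "tin ?C m = (m \<noteq> 0 \<and> Q y (Collect X) m)"
      by (rule tape_next_limit_eventually[of tin, OF insertI1])
  qed
  moreover have "tsc ?C 0" by (rule tsc_next_limit_cofinal) (rule steps(3))
  moreover have "st ?C = f Limit" "cfg.hd ?C = 0"
    using f by (simp_all add: config_limit_sel[OF is_limit_next_limit])
  ultimately show "\<exists>M. ?C = conf (\<lambda>m. m \<noteq> 0 \<and> Q y (Collect X) m) X Limit 0 M \<and> 0 \<in> M"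
    by (intro exI[of _ "Collect (tsc ?C)"]) (auto simp: conf_def intro: cfg.equality)
  show "tout (config p y {} v) = X \<and> st (config p y {} v) \<noteq> 1" if v: "v \<in> {u..next_limit u}"
  proof (cases "v = next_limit u")
    case True
    then show ?thesis using \<open>tout ?C = X\<close> \<open>st ?C = f Limit\<close> f by simp
  next
    case False
    then have "u \<le> v" "v < next_limit u" using v by auto
    then show ?thesis using config_before_next_limit[of "\<lambda>e. tout e = X \<and> st e \<noteq> 1", OF steps(1)]
      by blast
  qed
qed

definition swept :: "bool \<Rightarrow> (nat \<Rightarrow> bool) \<Rightarrow> (nat \<Rightarrow> bool) \<Rightarrow> nat \<Rightarrow> bool" where
  "swept cp Y X m = (if cp \<and> m \<noteq> 0 then Y m else X m)"

lemma funpow_step_sweep: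
  assumes "0 \<notin> M"
  shows "(step p y ^^ j) (conf Y X (Sweep cp) 1 M) =
    conf Y (\<lambda>m. if m < Suc j then swept cp Y X m else X m) (Sweep cp) (Suc j) (M - {..j})"
proof (induction j)
  case 0
  have "(\<lambda>m. if m < Suc 0 then swept cp Y X m else X m) = X" "M - {..0} = M"
    using assms by (auto simp: swept_def)
  then show ?case by simp
next
  case (Suc j)
  let ?X = "\<lambda>j m. if m < Suc j then swept cp Y X m else X m"
  have tape: "(?X j)(Suc j := (if cp then Y (Suc j) else X (Suc j))) = ?X (Suc j)"
    by (auto simp: fun_eq_iff less_Suc_eq swept_def)
  have marks: "M - {..j} - {Suc j} = M - {..Suc j}" by auto
  have "step p y (conf Y (?X j) (Sweep cp) (Suc j) (M - {..j})) =
      conf Y (?X (Suc j)) (Sweep cp) (Suc (Suc j)) (M - {..Suc j})"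
    by (subst step_conf[where s' = "Sweep cp" and wi = "Y (Suc j)" and wo = "if cp then Y (Suc j)
        else X (Suc j)"
          and b = False and r = True])
       (auto simp only: tape marks transition.simps in_states fun_upd_triv if_True if_False less_irrefl simp_thms split: if_splits)
  then show ?case using Suc.IH by simp
qed

lemma sweep_phase:
  assumes u: "config p y {} u = conf Y X (Sweep cp) 1 M" "0 \<notin> M"
  shows "config p y {} (next_limit u) = conf Y (swept cp Y X) Limit 0 {}"
    and "v \<in> {u..next_limit u} \<Longrightarrow> st (config p y {} v) \<noteq> 1 \<and>
      (\<forall>m. tout (config p y {} v) m = X m \<or> tout (config p y {} v) m = swept cp Y X m)"
proof -
  note steps = funpow_step_sweep[OF u(2), of _ Y X cp, folded u(1)]
  let ?C = "config p y {} (next_limit u)"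
  have out: "tout ?C = swept cp Y X"
  proof
    show "tout ?C m = swept cp Y X m" for m by (rule tape_next_limit_eventually[of _ m])
        (auto simp: steps)
  qed
  moreover have "tin ?C = Y"
    by (rule ext, rule tape_next_limit_eventually[of _ 0]) (auto simp: steps)
  moreover have "tsc ?C m = False" for m
    by (rule tape_next_limit_eventually[of _ m]) (auto simp: steps)
  moreover have st: "st ?C = f Limit" "cfg.hd ?C = 0"
    using f by (simp_all add: config_limit_sel[OF is_limit_next_limit])
  ultimately show "?C = conf Y (swept cp Y X) Limit 0 {}"
    by (auto simp: conf_def fun_eq_iff intro: cfg.equality)
  show "st (config p y {} v) \<noteq> 1 \<and> (\<forall>m. tout (config p y {} v) m = X m \<or> tout (config p y {} v) m =
      swept cp Y X m)"
    if v: "v \<in> {u..next_limit u}"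
  proof (cases "v = next_limit u")
    case True
    then show ?thesis using out st f by simp
  next
    case False
    then show ?thesis
      using config_before_next_limit[of "\<lambda>e. st e \<noteq> 1 \<and>
          (\<forall>m. tout e m = X m \<or> tout e m = swept cp Y X m)" p y "{}" u v] v steps f
      by (simp add: less_le)
  qed
qed

text \<open>From the limit of an evaluation phase the machine inspects cells 1 and 3 of the tape, which tell whether to stop
  and with which bit at cell 0, and starts a sweep.\<close>

lemma reaches_sweep:
  assumes M: "0 \<in> M"
  shows "\<exists>e. reaches_frozen Y X (conf Y X Limit 0 M) e \<and>
    step p y e = conf (Y(0 := Y 0 \<or> \<not> X 1)) (X(0 := (if \<not> Y 0 \<and> X 1 then X 3 else X 0))) (Sweep (\<not> Y 0)) 1 (M - {0})"
proof (cases "Y 0")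
  case True
  have "step p y (conf Y X Limit 0 M) = conf (Y(0 := True)) (X(0 := X 0)) (Sweep False) 1 (M - {0})"
    by (subst step_conf[where s' = "Sweep False" and wi = True and wo = "X 0" and b = False and r = True])
       (use True M in simp_all)
  then show ?thesis using True by (intro exI[of _ "conf Y X Limit 0 M"]) (simp add: reaches_refl)
next
  case not_clean: False
  show ?thesis
  proof (cases "X 1")
    case False
    have "reaches_frozen Y X (conf Y X NoHalt 0 M) (conf Y X NoHalt 0 M)" by (rule reaches_refl) simp
    then have "reaches_frozen Y X (conf Y X (GoRight 0) 1 M) (conf Y X NoHalt 0 M)"
      by - (rule reaches_frozen_move[where s' = NoHalt and r = False], use False in simp_all)
    then have "reaches_frozen Y X (conf Y X Limit 0 M) (conf Y X NoHalt 0 M)"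
      by - (rule reaches_frozen_move[where s' = "GoRight 0" and r = True], use not_clean M in simp_all)
    moreover have "step p y (conf Y X NoHalt 0 M) =
        conf (Y(0 := True)) (X(0 := X 0)) (Sweep True) 1 (M - {0})"
      by (subst step_conf[where s' = "Sweep True" and wi = True and wo = "X 0" and b = False and r = True]) simp_all
    ultimately show ?thesis using not_clean False by auto
  next
    case True
    let ?e = "conf Y X (GoLeft (X 3) 3) 0 M"
    have "reaches_frozen Y X ?e ?e" by (rule reaches_refl) simp
    then have "reaches_frozen Y X (conf Y X (GoLeft (X 3) 2) 1 M) ?e"
      by - (rule reaches_frozen_move[where s' = "GoLeft (X 3) 3" and r = False], simp_all)
    then have "reaches_frozen Y X (conf Y X (GoLeft (X 3) 1) 2 M) ?e"
      by - (rule reaches_frozen_move[where s' = "GoLeft (X 3) 2" and r = False], simp_all)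
    then have "reaches_frozen Y X (conf Y X (GoRight 2) 3 M) ?e"
      by - (rule reaches_frozen_move[where s' = "GoLeft (X 3) 1" and r = False], simp_all)
    then have "reaches_frozen Y X (conf Y X (GoRight 1) 2 M) ?e"
      by - (rule reaches_frozen_move[where s' = "GoRight 2" and r = True], simp_all)
    then have "reaches_frozen Y X (conf Y X (GoRight 0) 1 M) ?e"
      by - (rule reaches_frozen_move[where s' = "GoRight 1" and r = True], use True in \<open>simp_all add: numeral_2_eq_2\<close>)
    then have "reaches_frozen Y X (conf Y X Limit 0 M) ?e"
      by - (rule reaches_frozen_move[where s' = "GoRight 0" and r = True], use not_clean M in simp_all)
    moreover have "step p y ?e = conf (Y(0 := False)) (X(0 := X 3)) (Sweep True) 1 (M - {0})"
      by (subst step_conf[where s' = "Sweep True" and wi = False and wo = "X 3" and b = False and r = True]) simp_all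
    ultimately show ?thesis using not_clean True by auto
  qed
qed

lemma goto_sweep:
  assumes "config p y {} u = conf Y X Limit 0 M" "0 \<in> M"
  shows "\<exists>w>u. config p y {} w =
      conf (Y(0 := Y 0 \<or> \<not> X 1)) (X(0 := (if \<not> Y 0 \<and> X 1 then X 3 else X 0))) (Sweep (\<not> Y 0)) 1 (M - {0}) \<and>
    (\<forall>v\<in>{u..<w}. tout (config p y {} v) = X \<and> st (config p y {} v) \<noteq> 1)"
proof -
  obtain e where e: "reaches_frozen Y X (config p y {} u) e"
    "step p y e =
      conf (Y(0 := Y 0 \<or> \<not> X 1)) (X(0 := (if \<not> Y 0 \<and> X 1 then X 3 else X 0))) (Sweep (\<not> Y 0)) 1
          (M - {0})"
    using reaches_sweep[OF assms(2)] unfolding assms(1) by blast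
  then obtain w where "u \<le> w" "config p y {} w = e" "\<forall>v\<in>{u..w}. frozen Y X (config p y {} v)"
    using reaches_time by blast
  then show ?thesis using e(2)
    by (intro exI[of _ "succ w"]) (auto simp: frozen_def less_succ_iff)
qed

definition next_tape :: "(nat \<Rightarrow> bool) \<Rightarrow> nat \<Rightarrow> bool" where
  "next_tape X m = (if m \<noteq> 0 then Q y (Collect X) m else if X 1 then X 3 else X 0)"

lemma macro_step:
  assumes s: "s = Init \<or> s = Limit \<and> Y 0" and u: "config p y {} u = conf Y X s 0 {}"
  shows "\<exists>w>u. \<exists>Y'. config p y {} w = conf Y' (next_tape X) Limit 0 {} \<and> Y' 0 = (\<not> X 1) \<and>
     (\<forall>v\<in>{u..w}. st (config p y {} v) \<noteq> 1 \<and>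
        (\<not> X 1 \<longrightarrow> (\<forall>m. tout (config p y {} v) m = X m \<or> tout (config p y {} v) m = next_tape X m)))"
proof -
  define w1 where "w1 = next_limit u"
  define Y1 where "Y1 m = (m \<noteq> 0 \<and> Q y (Collect X) m)" for m
  obtain M where w1: "config p y {} w1 = conf Y1 X Limit 0 M" "0 \<in> M"
    using eval_phase(1)[OF s u] unfolding w1_def Y1_def by blast
  define Y2 X2 where "Y2 = Y1(0 := \<not> X 1)" and "X2 = X(0 := (if X 1 then X 3 else X 0))"
  obtain w2 where w2: "w1 < w2" "config p y {} w2 = conf Y2 X2 (Sweep True) 1 (M - {0})"
    "\<forall>v\<in>{w1..<w2}. tout (config p y {} v) = X \<and> st (config p y {} v) \<noteq> 1"
    using goto_sweep[OF w1] unfolding Y2_def X2_def by (auto simp: Y1_def)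
  define w3 where "w3 = next_limit w2"
  have swept: "swept True Y2 X2 = next_tape X"
    unfolding swept_def next_tape_def Y2_def X2_def Y1_def by (auto simp: fun_eq_iff)
  have "0 \<notin> M - {0}" by simp
  note sweep = sweep_phase[OF w2(2) this, folded w3_def, unfolded swept]
  have "st (config p y {} v) \<noteq> 1 \<and>
      (\<not> X 1 \<longrightarrow> (\<forall>m. tout (config p y {} v) m = X m \<or> tout (config p y {} v) m = next_tape X m))"
    if v: "v \<in> {u..w3}" for v
  proof -
    consider "v \<in> {u..w1}" | "v \<in> {w1..<w2}" | "v \<in> {w2..w3}" using v by force
    then show ?thesis
    proof cases
      case 1
      then show ?thesis using eval_phase(2)[OF s u] unfolding w1_def by blast
    next
      case 2
      then show ?thesis using w2(3) by auto
    next
      case 3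
      moreover have "X2 = X" if "\<not> X 1" unfolding X2_def using that by auto
      ultimately show ?thesis using sweep(2) by metis
    qed
  qed
  moreover have "u < w3" using less_next_limit[of u] w2(1) less_next_limit[of w2]
    unfolding w1_def w3_def by order
  ultimately show ?thesis using sweep(1) by (intro exI[of _ w3]) (auto simp: Y2_def)
qed

lemma tsc_config_start:
  "s = Init \<or> s = Limit \<and> Y 0 \<Longrightarrow> config p y {} u = conf Y X s 0 {} \<Longrightarrow> tsc (config p y {} (succ u)) 0"
  using start_phase(1) by simp

lemma clean_step:
  assumes u: "config p y {} u = conf Y X Limit 0 M" "0 \<in> M" "Y 0"
  shows "\<exists>w\<ge>u. config p y {} w = conf Y X Limit 0 {} \<and>
    (\<forall>v\<in>{u..w}. st (config p y {} v) \<noteq> 1 \<and> tout (config p y {} v) = X)"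
proof -
  obtain w where w: "u < w" "config p y {} w = conf Y X (Sweep False) 1 (M - {0})"
    "\<forall>v\<in>{u..<w}. tout (config p y {} v) = X \<and> st (config p y {} v) \<noteq> 1"
    using goto_sweep[OF u(1,2)] u(3) by (auto simp: fun_upd_idem)
  have swept: "swept False Y X = X" by (simp add: swept_def fun_eq_iff)
  have "0 \<notin> M - {0}" by simp
  note sweep = sweep_phase[OF w(2) this, unfolded swept]
  have "st (config p y {} v) \<noteq> 1 \<and> tout (config p y {} v) = X" if "v \<in> {u..next_limit w}" for v
    using w(3) sweep(2)[of v] that by (cases "v < w") (auto simp: fun_eq_iff)
  moreover have "u \<le> next_limit w" using w(1) less_next_limit[of w] by order
  ultimately show ?thesis using sweep(1) by blast
qed

end

text \<open>A state \<open>S\<close> of the iterated operator is kept on the tape shifted by one, since cell 0 is used for control.\<close>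

locale iterator = evaluator p y f k c R Q for p y f k c R Q +
  fixes G :: "nat set \<Rightarrow> nat set"
  assumes Q_eq: "\<And>X n. Q y X n = (if 1 \<in> X then Suc (pair 1 n) \<in> X else n - 1 \<in> G {m. Suc m \<in> X})"
begin

abbreviation tape :: "nat set \<Rightarrow> nat \<Rightarrow> bool" where "tape S \<equiv> (\<lambda>m. m \<in> Suc ` S)"

lemma Suc_vimage_image [simp]: "{m. Suc m \<in> Suc ` S} = S"
  by auto

lemma next_tape_running:
  assumes "0 \<notin> S"
  shows "next_tape (tape S) = tape (G S)"
proof
  fix m
  show "next_tape (tape S) m \<longleftrightarrow> m \<in> Suc ` G S"
    using assms by (cases m) (auto simp: next_tape_def Q_eq inj_image_mem_iff)
qed

lemma next_tape_stopped:
  assumes "0 \<in> S"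
  shows "next_tape (tape S) m \<longleftrightarrow> pair 1 m \<in> S"
proof -
  have "pair 1 0 = 2" by (simp add: prod_encode_def numeral_2_eq_2)
  then show ?thesis using assms
    by (auto simp: next_tape_def Q_eq inj_image_mem_iff numeral_3_eq_3 numeral_2_eq_2)
qed

definition completed :: "time \<Rightarrow> time \<Rightarrow> bool" where
  "completed u t \<longleftrightarrow> (\<exists>Y s. (u = 0 \<and> s = Init \<or> s = Limit \<and> Y 0) \<and> config p y {} u = conf Y (tape (iterate G {} t)) s 0 {})
     \<and> (\<forall>v\<le>u. st (config p y {} v) \<noteq> 1)"

lemma completed_succ:
  assumes "completed u t" "0 \<notin> iterate G {} t"
  shows "\<exists>u'>u. completed u' (succ t) \<and>
    (\<forall>w\<in>{u..u'}. mixture (\<lambda>t. Suc ` iterate G {} t) {t, succ t} (Collect (tout (config p y {} w))))"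
proof -
  let ?S = "iterate G {} t"
  obtain Y s where Y: "s = Init \<or> s = Limit \<and> Y 0" "config p y {} u = conf Y (tape ?S) s 0 {}"
    and running: "\<forall>v\<le>u. st (config p y {} v) \<noteq> 1"
    using assms(1) unfolding completed_def by blast
  have "1 \<notin> Suc ` ?S" using assms(2) by auto
  then obtain w Y' where w: "u < w" "config p y {} w =
      conf Y' (tape (iterate G {} (succ t))) Limit 0 {}" "Y' 0"
    and between: "\<forall>v\<in>{u..w}. st (config p y {} v) \<noteq> 1 \<and>
      (\<forall>m. tout (config p y {} v) m = tape ?S m \<or> tout (config p y {} v) m = tape (iterate G {} (succ t)) m)"
    using macro_step[OF Y] unfolding next_tape_running[OF assms(2)] iterate_succ by auto
  have "st (config p y {} v) \<noteq> 1" if "v \<le> w" for v using running between that by (cases "v \<le> u") auto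
  then have "completed w (succ t)" unfolding completed_def using w by blast
  moreover have "mixture (\<lambda>t. Suc ` iterate G {} t) {t, succ t} (Collect (tout (config p y {} v)))"
      if "v \<in> {u..w}" for v
    using between that unfolding mixture_def by auto
  ultimately show ?thesis using w(1) by blast
qed

lemma completed_limit:
  assumes u: "is_limit u" and cofinal: "\<And>b. b < u \<Longrightarrow> \<exists>w s. b \<le> w \<and> w < u \<and> completed w s"
    and out: "Collect (tout (config p y {} u)) = Suc ` iterate G {} t"
  shows "\<exists>u'\<ge>u. completed u' t \<and> (\<forall>w\<in>{u..u'}. Collect (tout (config p y {} w)) = Suc ` iterate G {} t)"
proof -
  define Y where "Y = tin (config p y {} u)"
  have clean: "\<exists>w\<ge>b. w < u \<and> tin (config p y {} w) 0 \<and> tsc (config p y {} (succ w)) 0 \<and>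
      (\<forall>v\<le>w. st (config p y {} v) \<noteq> 1)"
    if b: "b < u" for b
  proof -
    have "max b (succ 0) < u" using b is_limit_succ_less[OF u is_limit_pos[OF u]] by simp
    then obtain w s where w: "max b (succ 0) \<le> w" "w < u" "completed w s" using cofinal by blast
    then have "w \<noteq> 0" by auto
    then obtain Z where Z: "Z 0" "config p y {} w = conf Z (tape (iterate G {} s)) Limit 0 {}"
      using w(3) unfolding completed_def by auto
    then have "tsc (config p y {} (succ w)) 0" using tsc_config_start[of Limit Z w] by blast
    then show ?thesis using w Z unfolding completed_def by (intro exI[of _ w]) auto
  qed
  have "Y 0" unfolding Y_def tin_config_limit[OF u] by (rule in_limsupI) (use clean in blast)
  moreover have "tsc (config p y {} u) 0" unfolding tsc_config_limit[OF u]
  proof (rule in_limsupI)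
    fix b assume "b < u"
    then obtain w where "b \<le> w" "w < u" "tsc (config p y {} (succ w)) 0" using clean by blast
    then show "\<exists>d. b \<le> d \<and> d < u \<and> 0 \<in> Collect (tsc (config p y {} d))"
      using is_limit_succ_less[OF u] le_succ order_trans by blast
  qed
  moreover have "config p y {} u =
      conf Y (tape (iterate G {} t)) Limit 0 (Collect (tsc (config p y {} u)))"
    using out f
    by (auto simp: conf_def Y_def config_limit_sel(1,2)[OF u] fun_eq_iff set_eq_iff intro!: cfg.equality)
  ultimately obtain w where w: "w \<ge> u" "config p y {} w = conf Y (tape (iterate G {} t)) Limit 0 {}"
    "\<forall>v\<in>{u..w}. st (config p y {} v) \<noteq> 1 \<and> tout (config p y {} v) = tape (iterate G {} t)"
    using clean_step[of u Y] by blast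
  have "st (config p y {} v) \<noteq> 1" if "v \<le> w" for v
    using w(3) clean that by (cases "v < u") auto
  then have "completed w t" unfolding completed_def using w(2) \<open>Y 0\<close> by blast
  then show ?thesis using w(1,3) by auto
qed

lemma simulation_completed:
  "simulation completed (\<lambda>t. 0 \<in> iterate G {} t)
    (\<lambda>u. Collect (tout (config p y {} u))) (\<lambda>t. Suc ` iterate G {} t) 0"
proof
  show "completed 0 0" unfolding completed_def
    by (intro conjI exI[of _ "\<lambda>_. False"] exI[of _ Init]) (auto simp: init_cfg_def conf_def f)
  show "Suc ` iterate G {} t = limsup (\<lambda>t. Suc ` iterate G {} t) t" if t: "is_limit t" for t
  proof (rule set_eqI)
    fix n show "n \<in> Suc ` iterate G {} t \<longleftrightarrow> n \<in> limsup (\<lambda>t. Suc ` iterate G {} t) t"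
      using is_limit_pos[OF t] unfolding iterate_limit[OF t]
      by (cases n) (auto simp: limsup_def inj_image_mem_iff)
  qed
  show "Collect (tout (config p y {} u)) = limsup (\<lambda>u. Collect (tout (config p y {} u))) u"
      if "is_limit u" for u
    by (auto simp: tout_config_limit[OF that])
  show "Collect (tout (config p y {} u)) = Suc ` iterate G {} t" if "completed u t" for u t
    using that unfolding completed_def by auto
qed (use completed_succ completed_limit in blast)+

lemma halts_with_stopped:
  assumes "stops_at G {} t"
  shows "halts_with p y {} {n. pair 1 n \<in> iterate G {} t}"
proof -
  let ?S = "iterate G {} t"
  have "\<exists>u\<ge>t. completed u t"
    by (rule simulation.ex_stage_done[OF simulation_completed]) (use assms in \<open>auto simp: stops_at_def\<close>)
  then obtain u Y s where Y: "s = Init \<or> s = Limit \<and> Y 0" "config p y {} u = conf Y (tape ?S) s 0 {}"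
    and running: "\<forall>v\<le>u. st (config p y {} v) \<noteq> 1"
    unfolding completed_def by blast
  have "0 \<in> ?S" using assms unfolding stops_at_def by blast
  then obtain w Y' where w: "config p y {} w = conf Y' (next_tape (tape ?S)) Limit 0 {}" "\<not> Y' 0"
    and between: "\<forall>v\<in>{u..w}. st (config p y {} v) \<noteq> 1"
    using macro_step[OF Y] by auto
  have final: "config p y {} (succ w) = (conf Y' (next_tape (tape ?S)) Limit 0 {})\<lparr>st := 1\<rparr>"
    using step_eq[of Limit "config p y {} w"] w by (simp add: apply_action_def)
  have "st (config p y {} v) \<noteq> 1" if "v < succ w" for v
    using running between that by (cases "v \<le> u") (auto simp: less_succ_iff)
  then have "halts_at p y {} (succ w)" unfolding halts_at_def final by simp
  moreover have "{n. tout (config p y {} (succ w)) n} = {n. pair 1 n \<in> ?S}"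
    unfolding final using next_tape_stopped[OF \<open>0 \<in> ?S\<close>] by simp
  ultimately show ?thesis unfolding halts_with_iff by blast
qed

lemma displays_iterate:
  assumes "\<And>t. 0 \<notin> iterate G {} t"
  shows "displays (\<lambda>u. {n. tout (config p y {} u) (Suc n)}) (iterate G {})"
  using displays_vimage[OF simulation.displays_simulated[OF simulation_completed], of Suc] assms
  by (simp add: inj_image_mem_iff)

end

theorem finitary_op_compiles:
  assumes "finitary_op G"
  obtains i where "\<And>y t. stops_at (G y) {} t \<Longrightarrow> halts_with (P i) y {} {n. pair 1 n \<in> iterate (G y) {} t}"
    and "\<And>y. (\<And>t. 0 \<notin> iterate (G y) {} t) \<Longrightarrow>
      displays (\<lambda>u. {n. tout (config (P i) y {} u) (Suc n)}) (iterate (G y) {})"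
proof -
  define Q where "Q y X n = (if 1 \<in> X then Suc (pair 1 n) \<in> X else n - 1 \<in> G y {m. Suc m \<in> X})" for y X n
  have "finitary_op (\<lambda>y X. G y {m. Suc m \<in> X})"
    by (rule finitary_op_comp[OF assms finitary_op_oracle])
       (intro finitary_opI finitary_tape prim_rec_rules)
  then have "finitary Q" unfolding Q_def[abs_def]
    by (intro finitary_if finitary_mem finitary_tape prim_rec_pred prim_rec_rules)
  then obtain c where c: "evaluates 3 c Q" using finitary_evaluates[of Q 3] by auto
  obtain k0 where k0: "\<forall>x\<in>registers c. x \<le> k0" using finite_registers finite_nat_set_iff_bounded_le
    by meson
  define k where "k = k0 + 5"
  define R where "R = insert [] (stacks (main_com c) [])"
  have "finite (states k R)" unfolding R_def by (intro finite_states) (simp add: finite_stacks)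
  from ex_program_of_transitions[OF this, of "transition k (main_com c)"]
  obtain i f where f: "f Init = 0" "f Limit = 2" "\<forall>s. f s \<noteq> (1::nat)"
    and step: "\<forall>y c' s. s \<in> states k R \<longrightarrow> st c' = f s \<longrightarrow> step (P i) y c' =
      apply_action f (transition k (main_com c) s (hd c' \<in> y) (tin c' (hd c')) (tsc c' (hd c')) (tout c' (hd c'))) c'"
    by blast
  have iterator: "iterator (P i) y f k c R Q (G y)" for y
  proof
    show "step (P i) y c' =
        apply_action f (transition k (main_com c) s (hd c' \<in> y) (tin c' (hd c')) (tsc c' (hd c')) (tout c' (hd c'))) c'"
      if "s \<in> states k R" "st c' = f s" for c' s using step that by blast
    show "registers c \<subseteq> {..<k}" using k0 unfolding k_def by fastforce
  qed (use f c in \<open>auto simp: k_def R_def Q_def\<close>)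
  show ?thesis
    by (rule that[of i])
       (use iterator.halts_with_stopped[OF iterator] iterator.displays_iterate[OF iterator] in blast)+
qed

section \<open>Computable operators on reals\<close>

definition track :: "nat \<Rightarrow> nat set \<Rightarrow> nat set" where "track i S = {n. pair i n \<in> S}"

definition on_track :: "nat \<Rightarrow> nat set \<Rightarrow> nat set" where "on_track i A = {m. pfst m = i \<and> psnd m \<in> A}"

lemma in_track [simp]: "n \<in> track i S \<longleftrightarrow> pair i n \<in> S"
  unfolding track_def by simp

lemma pair_in_on_track [simp]: "pair j n \<in> on_track i A \<longleftrightarrow> i = j \<and> n \<in> A"
  unfolding on_track_def by auto

lemma zero_in_on_track [simp]: "0 \<in> on_track i A \<longleftrightarrow> i = 0 \<and> 0 \<in> A"
  unfolding on_track_def by auto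

lemma track_empty [simp]: "track i {} = {}" and on_track_empty [simp]: "on_track i {} = {}"
  and track_Un [simp]: "track i (S \<union> S') = track i S \<union> track i S'"
  and track_on_track [simp]: "track i (on_track j A) = (if i = j then A else {})"
  by (auto simp: track_def on_track_def)

lemma track_insert_zero [simp]: "i \<noteq> 0 \<Longrightarrow> track i (insert 0 S) = track i S"
  unfolding track_def by simp

lemma track_limsup: "track i (limsup f t) = limsup (\<lambda>u. track i (f u)) t"
  unfolding track_def by (rule limsup_vimage)

lemma track_iterate_limit: "is_limit t \<Longrightarrow> track i (iterate G X t) =
    limsup (\<lambda>u. track i (iterate G X u)) t"
  by (simp only: iterate_limit track_limsup)

lemma limsup_Un_on_track: "is_limit t \<Longrightarrow> limsup (\<lambda>u. K \<union> on_track i (f u)) t =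
    K \<union> on_track i (limsup f t)"
  using is_limit_pos[of t] unfolding limsup_def on_track_def by auto

lemma finitary_op_track: "finitary_op F \<Longrightarrow> finitary_op (\<lambda>y X. track i (F y X))"
  unfolding finitary_op_def[of "\<lambda>y X. track i (F y X)"] in_track by (intro finitary_mem prim_rec_rules)

lemma finitary_op_on_track: "finitary_op F \<Longrightarrow> finitary_op (\<lambda>y X. on_track i (F y X))"
  unfolding on_track_def by (intro finitary_opI finitary_conj finitary_eq finitary_mem prim_rec_rules)

lemmas finitary_op_rules = finitary_op_tape finitary_op_oracle finitary_op_empty finitary_op_Un finitary_op_insert
  finitary_op_if finitary_op_track finitary_op_on_track

text \<open>While \<open>G\<close> runs \<open>G1\<close> on a track of its own, the rest \<open>K\<close> of the state stays fixed.\<close>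

lemma iterate_subroutine:
  assumes start: "iterate G X u = K \<union> on_track i A"
    and step: "\<And>S. 0 \<notin> S \<Longrightarrow> G (K \<union> on_track i S) = K \<union> on_track i (G1 S)"
    and running: "\<forall>s<t. 0 \<notin> iterate G1 A s"
  shows "iterate G X (u + t) = K \<union> on_track i (iterate G1 A t)"
  using running
proof (induction t rule: time_induct)
  case (succ t)
  then show ?case using step[of "iterate G1 A t"] by (simp add: less_succ_iff)
next
  case (limit t)
  have "iterate G X (u + t) = limsup (\<lambda>s. iterate G X (u + s)) t"
    by (simp only: iterate_limit[OF is_limit_add[OF limit(1)]] limsup_add[OF limit(1)])
  also have "\<dots> = limsup (\<lambda>s. K \<union> on_track i (iterate G1 A s)) t"
    by (rule limsup_cong) (use limit(2,3) in \<open>simp add: order.strict_trans\<close>)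
  finally show ?case unfolding limsup_Un_on_track[OF limit(1)] iterate_limit[OF limit(1), of G1] .
qed (use start in simp)

lemma iterate_subroutine_stops:
  assumes "iterate G X u = K \<union> on_track i A" "\<And>S. 0 \<notin> S \<Longrightarrow> G (K \<union> on_track i S) = K \<union> on_track i (G1 S)"
    and stops: "stops_at G1 A t" and outside: "0 \<notin> K" "i \<noteq> 0" "track j K = B" "i \<noteq> j"
  obtains v where "u \<le> v" "iterate G X v = K \<union> on_track i (iterate G1 A t)"
    "\<And>w. u \<le> w \<Longrightarrow> w \<le> v \<Longrightarrow> 0 \<notin> iterate G X w" "\<And>w. u \<le> w \<Longrightarrow> w \<le> v \<Longrightarrow> track j (iterate G X w) = B"
proof (rule that[of "u + t"])
  have run: "iterate G X (u + s) = K \<union> on_track i (iterate G1 A s)" if "s \<le> t" for s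
    by (rule iterate_subroutine[OF assms(1,2)]) (use stops that in \<open>auto simp: stops_at_def\<close>)
  have "0 \<notin> iterate G X w \<and> track j (iterate G X w) = B" if w: "u \<le> w" "w \<le> u + t" for w
  proof -
    obtain s where "w = u + s" using ex_add_eq_time[OF w(1)] by blast
    then show ?thesis using run[of s] w(2) outside by (simp add: add_le_iff_time)
  qed
  then show "\<And>w. u \<le> w \<Longrightarrow> w \<le> u + t \<Longrightarrow> 0 \<notin> iterate G X w"
    "\<And>w. u \<le> w \<Longrightarrow> w \<le> u + t \<Longrightarrow> track j (iterate G X w) = B" by blast+
  show "iterate G X (u + t) = K \<union> on_track i (iterate G1 A t)" by (rule run) simp
  show "u \<le> u + t" by (rule le_add_time)
qed

definition computable_on :: "nat set set \<Rightarrow> (nat set \<Rightarrow> nat set) \<Rightarrow> bool" where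
  "computable_on D F \<longleftrightarrow> (\<exists>G. finitary_op G \<and>
     (\<forall>X\<in>D. \<exists>t. stops_at (G X) {} t \<and> track 1 (iterate (G X) {} t) = F X))"

abbreviation computable :: "(nat set \<Rightarrow> nat set) \<Rightarrow> bool" where "computable \<equiv> computable_on UNIV"

lemma computable_on_subset: "computable_on E F \<Longrightarrow> D \<subseteq> E \<Longrightarrow> computable_on D F"
  unfolding computable_on_def by blast

theorem computable_on_halts_with:
  assumes "computable_on D F"
  obtains i where "\<And>y. y \<in> D \<Longrightarrow> halts_with (P i) y {} (F y)"
proof -
  obtain G where G: "finitary_op G"
    "\<forall>X\<in>D. \<exists>t. stops_at (G X) {} t \<and> track 1 (iterate (G X) {} t) = F X"
    using assms unfolding computable_on_def by blast
  obtain i where "\<And>y t. stops_at (G y) {} t \<Longrightarrow> halts_with (P i) y {} (track 1 (iterate (G y) {} t))"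
    using finitary_op_compiles[OF G(1)] unfolding track_def by metis
  then show ?thesis using G(2) that by metis
qed

lemma computable_finitary:
  assumes "finitary_op (\<lambda>y X. F y)"
  shows "computable F"
  unfolding computable_on_def
proof (intro exI[of _ "\<lambda>y S. insert 0 (on_track 1 (F y))"] conjI ballI)
  show "finitary_op (\<lambda>y S. insert 0 (on_track 1 (F y)))" by (intro finitary_op_rules assms)
  show "\<exists>t. stops_at (\<lambda>S. insert 0 (on_track 1 (F X))) {} t \<and>
      track 1 (iterate (\<lambda>S. insert 0 (on_track 1 (F X))) {} t) = F X" for X
    by (rule exI[of _ "succ 0"]) (simp add: stops_at_def less_succ_iff)
qed

text \<open>Track 2 holds the running computation; between the two computations the result of the first one is put on
  track 3 and the flag 1 is set on track 0.\<close>

lemma computable_on_comp: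
  assumes "computable_on D F" "computable_on E F'" "finitary_op H" "\<And>X. X \<in> D \<Longrightarrow> H X (F X) \<in> E"
  shows "computable_on D (\<lambda>X. F' (H X (F X)))"
proof -
  obtain G1 where G1: "finitary_op G1"
    "\<forall>X\<in>D. \<exists>t. stops_at (G1 X) {} t \<and> track 1 (iterate (G1 X) {} t) = F X"
    using assms(1) unfolding computable_on_def by blast
  obtain G2 where G2: "finitary_op G2"
    "\<forall>X\<in>E. \<exists>t. stops_at (G2 X) {} t \<and> track 1 (iterate (G2 X) {} t) = F' X"
    using assms(2) unfolding computable_on_def by blast
  define G where "G X S =
    (if 1 \<notin> track 0 S then
       if 0 \<in> track 2 S then on_track 0 {1} \<union> on_track 3 (track 1 (track 2 S))
       else on_track 2 (G1 X (track 2 S))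
     else if 0 \<in> track 2 S then insert 0 (on_track 1 (track 1 (track 2 S)))
     else on_track 0 {1} \<union> on_track 3 (track 3 S) \<union> on_track 2 (G2 (H X (track 3 S)) (track 2 S)))" for X S
  have "finitary_op G" unfolding G_def
    by (intro finitary_op_rules finitary_not finitary_mem prim_rec_rules finitary_op_comp[OF G1(1)] finitary_op_comp[OF G2(1)]
        finitary_op_comp[OF assms(3)])
  moreover have "\<exists>t. stops_at (G X) {} t \<and> track 1 (iterate (G X) {} t) = F' (H X (F X))"
      if X: "X \<in> D" for X
  proof -
    let ?Y = "H X (F X)" and ?K = "on_track 0 {1} \<union> on_track 3 (F X)"
    obtain t1 where t1: "stops_at (G1 X) {} t1" "track 1 (iterate (G1 X) {} t1) = F X" using G1(2) X
      by blast
    obtain t2 where t2: "stops_at (G2 ?Y) {} t2" "track 1 (iterate (G2 ?Y) {} t2) = F' ?Y"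
      using G2(2) assms(4)[OF X] by blast
    obtain v where v: "iterate (G X) {} v = {} \<union> on_track 2 (iterate (G1 X) {} t1)"
      "\<And>w. w \<le> v \<Longrightarrow> 0 \<notin> iterate (G X) {} w"
      by (rule iterate_subroutine_stops[OF _ _ t1(1), of "G X" "{}" 0 "{}" 2 3 "{}"]) (auto simp: G_def)
    have "iterate (G X) {} (succ v) = ?K \<union> on_track 2 {}"
      using t1 unfolding iterate_succ v(1) by (simp add: G_def stops_at_def)
    then obtain w where w: "iterate (G X) {} w = ?K \<union> on_track 2 (iterate (G2 ?Y) {} t2)"
      "\<And>r. succ v \<le> r \<Longrightarrow> r \<le> w \<Longrightarrow> 0 \<notin> iterate (G X) {} r"
      by (rule iterate_subroutine_stops[OF _ _ t2(1), of "G X" "{}" "succ v" ?K 2 1 "{}"])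
         (auto simp: G_def)
    have final: "iterate (G X) {} (succ w) = insert 0 (on_track 1 (F' ?Y))"
      using t2 unfolding iterate_succ w(1) by (simp add: G_def stops_at_def)
    have "0 \<notin> iterate (G X) {} r" if "r < succ w" for r
      using that v(2)[of r] w(2)[of r] unfolding less_succ_iff succ_le_iff by fastforce
    then show ?thesis using final by (intro exI[of _ "succ w"]) (simp add: stops_at_def)
  qed
  ultimately show ?thesis unfolding computable_on_def by blast
qed

lemma computable_on_compose:
  assumes "computable_on D F" "computable_on E F'" "\<And>X. X \<in> D \<Longrightarrow> F X \<in> E"
  shows "computable_on D (\<lambda>X. F' (F X))"
  using computable_on_comp[OF assms(1,2) finitary_op_tape] assms(3) by blast

lemma computable_ident: "computable (\<lambda>X. X)"
  by (rule computable_finitary) (rule finitary_op_oracle)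

lemma computable_track: "computable_on D F \<Longrightarrow> computable_on D (\<lambda>X. track i (F X))"
  by (rule computable_on_compose[of _ _ UNIV "track i"])
     (auto intro!: computable_finitary finitary_op_rules)

lemma computable_on_binary:
  assumes "computable_on D F" "computable_on D F'" "finitary_op H"
  shows "computable_on D (\<lambda>X. H (F X) (F' X))"
proof -
  let ?join = "\<lambda>X Y. on_track 0 X \<union> on_track 1 Y" and ?D = "{Z. track 0 Z \<in> D}"
  have "computable_on D (\<lambda>X. ?join X (F' X))"
    using computable_on_comp[OF assms(2) computable_ident, of ?join] by (simp add: finitary_op_rules)
  moreover have "computable_on ?D (\<lambda>Z. F (track 0 Z))"
    by (rule computable_on_compose[OF computable_on_subset[OF computable_track[OF computable_ident]] assms(1)]) auto
  then have "computable_on ?D (\<lambda>Z. H (F (track 0 Z)) (track 1 Z))"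
    using computable_on_comp[OF _ computable_ident, of ?D "\<lambda>Z. F (track 0 Z)" "\<lambda>Z Y. H Y (track 1 Z)"]
    by (simp add: finitary_op_comp[OF assms(3)] finitary_op_rules)
  ultimately have "computable_on D (\<lambda>X. H (F (track 0 (?join X (F' X)))) (track 1 (?join X (F' X))))"
    by (rule computable_on_compose) simp
  then show ?thesis by simp
qed

text \<open>Track 2 holds the iterate and track 3 the computation of the next one; the flag 2 on track 0 is on between these
  computations, hence also at limits of them.\<close>

definition iteration_step :: "(nat set \<Rightarrow> nat set \<Rightarrow> nat set) \<Rightarrow> nat set \<Rightarrow> nat set \<Rightarrow> nat set" where
  "iteration_step G X S =
    (if 1 \<notin> track 0 S then on_track 0 {1, 2} \<union> on_track 2 X
     else if 2 \<in> track 0 S then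
       if 0 \<in> track 2 S then insert 0 (on_track 1 (track 2 S)) else on_track 0 {1} \<union> on_track 2 (track 2 S)
     else if 0 \<in> track 3 S then on_track 0 {1, 2} \<union> on_track 2 (track 1 (track 3 S))
     else on_track 0 {1} \<union> on_track 2 (track 2 S) \<union> on_track 3 (G (track 2 S) (track 3 S)))"

lemma finitary_op_iteration_step: assumes "finitary_op G" shows "finitary_op (iteration_step G)"
  unfolding iteration_step_def[abs_def]
  by (intro finitary_op_rules finitary_not finitary_mem prim_rec_rules finitary_op_comp[OF assms])

locale iteration_machine =
  fixes F :: "nat set \<Rightarrow> nat set" and G :: "nat set \<Rightarrow> nat set \<Rightarrow> nat set" and X :: "nat set"
  assumes computes: "\<exists>t. stops_at (G Y) {} t \<and> track 1 (iterate (G Y) {} t) = F Y"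
begin

abbreviation run :: "time \<Rightarrow> nat set" where "run \<equiv> iterate (iteration_step G X) {}"

definition stage :: "time \<Rightarrow> time \<Rightarrow> bool" where
  "stage u t \<longleftrightarrow> {1, 2} \<subseteq> track 0 (run u) \<and> track 2 (run u) = iterate F X t \<and> (\<forall>v\<le>u. 0 \<notin> run v)"

lemma stage_zero: "stage (succ 0) 0"
  unfolding stage_def by (auto simp: iteration_step_def le_succ_iff)

lemma stage_succ:
  assumes stage: "stage u t" and running: "0 \<notin> iterate F X t"
  shows "\<exists>u'>u. stage u' (succ t) \<and> (\<forall>w\<in>{u..u'}. mixture (iterate F X) {t, succ t} (track 2 (run w)))"
proof -
  let ?Y = "iterate F X t" and ?K = "on_track 0 {1} \<union> on_track 2 (iterate F X t)"
  obtain T where T: "stops_at (G ?Y) {} T" "track 1 (iterate (G ?Y) {} T) = F ?Y" using computes by blast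
  have "run (succ u) = ?K \<union> on_track 3 {}"
    using stage running unfolding stage_def by (simp add: iteration_step_def)
  then obtain v where v: "succ u \<le> v" "run v = ?K \<union> on_track 3 (iterate (G ?Y) {} T)"
    and between: "\<And>w. succ u \<le> w \<Longrightarrow> w \<le> v \<Longrightarrow> 0 \<notin> run w" "\<And>w. succ u \<le> w \<Longrightarrow> w \<le> v \<Longrightarrow> track 2 (run w) = ?Y"
    by (rule iterate_subroutine_stops[OF _ _ T(1), where j = 2 and B = ?Y])
       (auto simp: iteration_step_def)
  have next_state: "run (succ v) = on_track 0 {1, 2} \<union> on_track 2 (iterate F X (succ t))"
    using T unfolding iterate_succ v(2) by (simp add: iteration_step_def stops_at_def)
  have split: "w \<le> u \<or> succ u \<le> w \<and> w \<le> v \<or> w = succ v" if "w \<le> succ v" for w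
    using that unfolding le_succ_iff succ_le_iff by auto
  have "0 \<notin> run w" if "w \<le> succ v" for w
    using split[OF that] stage between(1)[of w] next_state unfolding stage_def by auto
  then have "stage (succ v) (succ t)" unfolding stage_def using next_state by auto
  moreover have "mixture (iterate F X) {t, succ t} (track 2 (run w))" if "w \<in> {u..succ v}" for w
  proof -
    have "track 2 (run w) = ?Y \<or> track 2 (run w) = iterate F X (succ t)"
      using split[of w] that stage between(2)[of w] next_state unfolding stage_def by auto
    then show ?thesis using mixture_self[of _ "{t, succ t}" "iterate F X"] by (metis insertI1 insertI2)
  qed
  moreover have "u < succ v" using v(1) by (simp add: succ_le_iff less_succ_iff)
  ultimately show ?thesis by blast
qed

lemma stage_limit:
  assumes u: "is_limit u" and cofinal: "\<And>b. b < u \<Longrightarrow> \<exists>w s. b \<le> w \<and> w < u \<and> stage w s"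
    and at: "track 2 (run u) = iterate F X t"
  shows "stage u t"
proof -
  have "0 \<notin> run v" if "v < u" for v using cofinal[OF that] unfolding stage_def by blast
  moreover have "0 \<notin> run u"
    using calculation is_limit_pos[OF u] unfolding iterate_limit[OF u] by (auto elim: in_limsupD)
  moreover have "pair 0 k \<in> run u" if "k \<in> {1, 2}" for k
    unfolding iterate_limit[OF u] by (rule in_limsupI)
        (drule cofinal, use that in \<open>auto simp: stage_def\<close>)
  ultimately show ?thesis unfolding stage_def using at by (auto simp: le_less)
qed

lemma simulation_stage:
  "simulation stage (\<lambda>t. 0 \<in> iterate F X t) (\<lambda>u. track 2 (run u)) (iterate F X) (succ 0)"
proof
  show "\<exists>u'\<ge>u. stage u' t \<and> (\<forall>w\<in>{u..u'}. track 2 (run w) = iterate F X t)"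
    if "is_limit u" "\<And>b. b < u \<Longrightarrow> \<exists>w s. b \<le> w \<and> w < u \<and> stage w s" "track 2 (run u) = iterate F X t"
        for u t
    using stage_limit[OF that] that(3) by (intro exI[of _ u]) auto
qed (use stage_zero stage_succ track_iterate_limit iterate_limit in \<open>auto simp: stage_def\<close>)

lemma iteration_stops:
  assumes "stops_at F X t"
  shows "\<exists>u. stops_at (iteration_step G X) {} u \<and> track 1 (run u) = iterate F X t"
proof -
  obtain u where "stage u t"
    using simulation.ex_stage_done[OF simulation_stage, of t] assms unfolding stops_at_def by blast
  then have u: "{1, 2} \<subseteq> track 0 (run u)" "track 2 (run u) = iterate F X t" "\<forall>v\<le>u. 0 \<notin> run v"
    unfolding stage_def by blast+
  have "run (succ u) = insert 0 (on_track 1 (iterate F X t))"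
    using u(1,2) assms unfolding iterate_succ by (simp add: iteration_step_def stops_at_def)
  then show ?thesis using u(3) by (intro exI[of _ "succ u"]) (auto simp: stops_at_def less_succ_iff)
qed

lemma iteration_runs_forever:
  assumes "\<And>t. 0 \<notin> iterate F X t"
  shows "0 \<notin> run u"
proof -
  obtain v where "u \<le> v" "stage v u" using simulation.ex_stage_done[OF simulation_stage, of u] assms
    by blast
  then show ?thesis unfolding stage_def by blast
qed

end

lemma computable_loop:
  assumes "computable F" "\<And>X. X \<in> D \<Longrightarrow> \<exists>t. stops_at F X t \<and> iterate F X t = L X"
  shows "computable_on D L"
proof -
  obtain G where G: "finitary_op G" "\<forall>X. \<exists>t. stops_at (G X) {} t \<and> track 1 (iterate (G X) {} t) = F X"
    using assms(1) unfolding computable_on_def by blast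
  have "iteration_machine F G" by unfold_locales (use G(2) in blast)
  then have "\<exists>u. stops_at (iteration_step G X) {} u \<and> track 1 (iterate (iteration_step G X) {} u) =
      L X" if "X \<in> D" for X
    using assms(2)[OF that] iteration_machine.iteration_stops by fastforce
  then show ?thesis unfolding computable_on_def using finitary_op_iteration_step[OF G(1)] by blast
qed

theorem computable_iteration_displayed:
  assumes "computable F" "\<And>t. 0 \<notin> iterate F {} t"
  obtains i where "displays (\<lambda>u. {n. tout (config (P i) {} {} u) (Suc (pair 2 n))}) (iterate F {})"
proof -
  obtain G where G: "finitary_op G" "\<forall>X. \<exists>t. stops_at (G X) {} t \<and> track 1 (iterate (G X) {} t) = F X"
    using assms(1) unfolding computable_on_def by blast
  interpret iteration_machine F G "{}" by unfold_locales (use G(2) in blast)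
  obtain i where "displays (\<lambda>u. {n. tout (config (P i) {} {} u) (Suc n)}) run"
    using finitary_op_compiles[OF finitary_op_iteration_step[OF G(1)]] iteration_runs_forever[OF assms(2)] by metis
  from displays_vimage[OF this, of "pair 2"]
  have "displays (\<lambda>u. {n. tout (config (P i) {} {} u) (Suc (pair 2 n))}) (\<lambda>u. track 2 (run u))"
    by (simp add: track_def)
  moreover have "displays (\<lambda>u. track 2 (run u)) (iterate F {})"
    by (rule simulation.displays_simulated[OF simulation_stage]) (rule assms(2))
  ultimately show ?thesis using that displays_trans by blast
qed

definition decidable :: "(nat set \<Rightarrow> nat \<Rightarrow> bool) \<Rightarrow> bool" where
  "decidable Q \<longleftrightarrow> computable (\<lambda>X. {n. Q X n})"

lemma computable_of_decidable: "decidable (\<lambda>X n. n \<in> F X) \<Longrightarrow> computable F"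
  unfolding decidable_def by simp

lemma computable_Collect: "decidable Q \<Longrightarrow> computable (\<lambda>X. {n. Q X n})"
  unfolding decidable_def .

lemma decidable_finitary: "finitary (\<lambda>y X n. Q y n) \<Longrightarrow> decidable Q"
  unfolding decidable_def by (intro computable_finitary finitary_opI)

lemma computable_compose: "computable_on D F \<Longrightarrow> computable F' \<Longrightarrow> computable_on D (\<lambda>X. F' (F X))"
  by (rule computable_on_compose) auto

lemma decidable_compose: "decidable Q \<Longrightarrow> computable F \<Longrightarrow> decidable (\<lambda>X n. Q (F X) n)"
  unfolding decidable_def by (rule computable_compose)

lemma decidable_mem:
  assumes "computable F" "prim_rec f"
  shows "decidable (\<lambda>X n. f n \<in> F X)"
proof -
  have "computable (\<lambda>X. {n. f n \<in> X})"
    by (intro computable_finitary finitary_opI finitary_oracle assms(2))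
  then show ?thesis unfolding decidable_def by (rule computable_compose[OF assms(1)])
qed

lemma decidable_subst: "decidable Q \<Longrightarrow> prim_rec f \<Longrightarrow> decidable (\<lambda>X n. Q X (f n))"
  using decidable_mem[of "\<lambda>X. {n. Q X n}" f] by (simp add: decidable_def)

lemma decidable_not:
  assumes "decidable Q"
  shows "decidable (\<lambda>X n. \<not> Q X n)"
proof -
  have "computable (\<lambda>X. {n. n \<notin> X})"
    by (intro computable_finitary finitary_opI finitary_not finitary_oracle prim_rec_id)
  from computable_compose[OF assms[unfolded decidable_def] this] show ?thesis
    by (simp add: decidable_def)
qed

lemma decidable_conj:
  assumes "decidable Q" "decidable R"
  shows "decidable (\<lambda>X n. Q X n \<and> R X n)"
proof -
  have "finitary_op (\<lambda>y X. {n. n \<in> y \<and> n \<in> X})"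
    by (intro finitary_opI finitary_conj finitary_oracle finitary_tape prim_rec_id)
  from computable_on_binary[OF assms[unfolded decidable_def] this] show ?thesis
    by (simp add: decidable_def)
qed

lemma decidable_disj: assumes "decidable Q" "decidable R" shows "decidable (\<lambda>X n. Q X n \<or> R X n)"
  using decidable_not[OF decidable_conj[OF decidable_not[OF assms(1)] decidable_not[OF assms(2)]]]
  by simp

lemma decidable_imp: assumes "decidable Q" "decidable R" shows "decidable (\<lambda>X n. Q X n \<longrightarrow> R X n)"
  unfolding imp_conv_disj by (rule decidable_disj[OF decidable_not[OF assms(1)] assms(2)])

lemma decidable_iff: assumes "decidable Q" "decidable R" shows "decidable (\<lambda>X n. Q X n \<longleftrightarrow> R X n)"
  unfolding iff_conv_conj_imp by (intro decidable_conj decidable_imp assms)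

lemma decidable_if:
  assumes "decidable C" "decidable Q" "decidable R"
  shows "decidable (\<lambda>X n. if C X n then Q X n else R X n)"
  unfolding if_bool_eq_conj by (intro decidable_conj decidable_imp decidable_not assms)

lemma decidable_const: "decidable (\<lambda>X n. b)"
  by (intro decidable_finitary finitary_const)

lemma decidable_eq: "prim_rec f \<Longrightarrow> prim_rec g \<Longrightarrow> decidable (\<lambda>X n. f n = g n)"
  and decidable_le: "prim_rec f \<Longrightarrow> prim_rec g \<Longrightarrow> decidable (\<lambda>X n. f n \<le> g n)"
  and decidable_less: "prim_rec f \<Longrightarrow> prim_rec g \<Longrightarrow> decidable (\<lambda>X n. f n < g n)"
  and decidable_bit: "prim_rec f \<Longrightarrow> prim_rec g \<Longrightarrow> decidable (\<lambda>X n. bit (f n) (g n))"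
  by (intro decidable_finitary finitary_eq finitary_le finitary_less finitary_bit, assumption+)+

text \<open>The flags 1 and 2 alternate, so that both are on exactly at the limit; track 2 holds \<open>{pair k m | pair k (m + n) \<in> Y}\<close>
  after \<open>n\<close> steps.\<close>

definition exists_step :: "nat set \<Rightarrow> nat set \<Rightarrow> nat set" where
  "exists_step Y S =
    (if 1 \<notin> track 0 S \<and> 2 \<notin> track 0 S then on_track 0 {1} \<union> on_track 2 Y
     else if 1 \<in> track 0 S \<and> 2 \<in> track 0 S then insert 0 (on_track 1 (track 3 S))
     else on_track 0 (if 1 \<in> track 0 S then {2} else {1}) \<union> on_track 2 {p. pair (pfst p) (Suc (psnd p)) \<in> track 2 S}
       \<union> on_track 3 (track 3 S \<union> {k. pair k 0 \<in> track 2 S}))"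

lemma exists_step_funpow:
  "iterate (exists_step Y) {} ((succ ^^ n) (succ 0)) = on_track 0 (if even n then {1} else {2}) \<union>
     on_track 2 {p. pair (pfst p) (psnd p + n) \<in> Y} \<union> on_track 3 {k. \<exists>m<n. pair k m \<in> Y}"
proof (induction n)
  case (Suc n)
  have shorter: "{k. \<exists>m<Suc n. pair k m \<in> Y} = {k. \<exists>m<n. pair k m \<in> Y} \<union> {k. pair k n \<in> Y}"
    by (auto simp: less_Suc_eq)
  show ?case
    unfolding funpow.simps comp_apply iterate_succ Suc.IH shorter
    by (cases "even n") (simp_all add: exists_step_def)
qed (simp add: exists_step_def)

lemma computable_exists: "computable (\<lambda>Y. {k. \<exists>m. pair k m \<in> Y})"
  unfolding computable_on_def
proof (intro exI[of _ exists_step] conjI ballI)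
  show "finitary_op exists_step" unfolding exists_step_def[abs_def]
    by (intro finitary_op_rules finitary_conj finitary_not finitary_mem finitary_opI prim_rec_rules)
  fix Y
  define w where "w = next_limit (succ 0)"
  let ?run = "iterate (exists_step Y) {}"
  have in_run_w: "p \<in> ?run w \<longleftrightarrow> (\<forall>k. \<exists>n\<ge>k. p \<in> ?run ((succ ^^ n) (succ 0)))" for p
    unfolding w_def iterate_limit[OF is_limit_next_limit] in_limsup_next_limit ..
  have "\<exists>n\<ge>k. even n" "\<exists>n\<ge>k. odd n" for k :: nat
    by (rule exI[of _ "2 * k"], simp, rule exI[of _ "Suc (2 * k)"], simp)
  then have flags: "pair 0 1 \<in> ?run w" "pair 0 2 \<in> ?run w"
    unfolding in_run_w exists_step_funpow by auto
  have "\<exists>n\<ge>j. \<exists>m<n. pair k m \<in> Y" if "pair k m \<in> Y" for j k m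
    using that by (intro exI[of _ "Suc (j + m)"] conjI exI[of _ m]) auto
  then have "pair 3 k \<in> ?run w \<longleftrightarrow> (\<exists>m. pair k m \<in> Y)" for k
    unfolding in_run_w exists_step_funpow by auto
  then have final: "?run (succ w) = insert 0 (on_track 1 {k. \<exists>m. pair k m \<in> Y})"
    using flags by (simp add: exists_step_def on_track_def)
  have "0 \<notin> ?run s" if s: "s < succ w" for s
  proof -
    consider "s = 0" | "s = w" | "s \<noteq> 0" "s < w"
      using s unfolding less_succ_iff le_less by blast
    then show ?thesis
    proof cases
      case 2
      then show ?thesis by (simp add: in_run_w exists_step_funpow)
    next
      case 3
      then have "succ 0 \<le> s" by (simp add: succ_le_iff zero_less_time_iff)
      then obtain n where "s = (succ ^^ n) (succ 0)" using 3(2) ex_funpow_succ_eq unfolding w_def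
        by blast
      then show ?thesis by (simp add: exists_step_funpow)
    qed simp
  qed
  then show "\<exists>t. stops_at (exists_step Y) {} t \<and> track 1 (?run t) = {k. \<exists>m. pair k m \<in> Y}"
    using final by (intro exI[of _ "succ w"]) (simp add: stops_at_def)
qed

lemma decidable_ex:
  assumes "decidable (\<lambda>X p. Q X (pfst p) (psnd p))"
  shows "decidable (\<lambda>X n. \<exists>m. Q X n m)"
  using computable_compose[OF assms[unfolded decidable_def] computable_exists]
  by (simp add: decidable_def)

lemma decidable_all:
  assumes "decidable (\<lambda>X p. Q X (pfst p) (psnd p))"
  shows "decidable (\<lambda>X n. \<forall>m. Q X n m)"
  using decidable_not[OF decidable_ex[OF decidable_not[OF assms]]] by simp

lemmas decidable_rules = decidable_const decidable_eq decidable_le decidable_less decidable_bit decidable_not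
  decidable_conj decidable_disj decidable_imp decidable_iff decidable_if decidable_ex decidable_all decidable_mem

lemma computable_empty: "computable (\<lambda>X. {})"
  by (intro computable_finitary finitary_op_empty)

lemma computable_Un: assumes "computable F" "computable F'" shows "computable (\<lambda>X. F X \<union> F' X)"
  by (rule computable_of_decidable, unfold Un_iff) (intro decidable_rules prim_rec_id assms)

lemma computable_insert: assumes "computable F" shows "computable (\<lambda>X. insert k (F X))"
  by (rule computable_of_decidable, unfold insert_iff) (intro decidable_rules prim_rec_rules assms)

lemma computable_on_track: "computable_on D F \<Longrightarrow> computable_on D (\<lambda>X. on_track i (F X))"
  by (rule computable_compose) (auto intro!: computable_finitary finitary_op_rules)

lemma computable_if:
  assumes "decidable (\<lambda>X n. C X)" "computable F" "computable F'"
  shows "computable (\<lambda>X. if C X then F X else F' X)"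
  by (rule computable_of_decidable, unfold if_distrib[of "(\<in>) _"])
     (intro decidable_rules prim_rec_id assms)

lemmas computable_rules = computable_empty computable_Un computable_on_track computable_track computable_ident

text \<open>The state of \<open>G\<close> is kept on track 1, as 0 may enter it.\<close>

lemma computable_while:
  assumes "computable G" "decidable (\<lambda>S n. H S)" "computable_on D J"
    "\<And>X. X \<in> D \<Longrightarrow> \<exists>t. H (iterate G (J X) t)"
  shows "computable_on D (\<lambda>X. iterate G (J X) (LEAST t. H (iterate G (J X) t)))"
proof -
  define F where "F S = (if H (track 1 S) then insert 0 S else on_track 1 (G (track 1 S)))" for S
  let ?T = "\<lambda>Y. LEAST t. H (iterate G Y t)" and ?E = "on_track 1 ` {Y. \<exists>t. H (iterate G Y t)}"
  have "computable F" unfolding F_def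
    by (intro computable_if computable_insert computable_rules decidable_compose[OF assms(2)] computable_compose[OF _ assms(1)])
  then have loop: "computable_on ?E (\<lambda>Z. insert 0 (on_track 1 (iterate G (track 1 Z) (?T (track 1 Z)))))"
  proof (rule computable_loop)
    fix Z assume "Z \<in> ?E"
    then obtain Y where Z: "Z = on_track 1 Y" and ex: "\<exists>t. H (iterate G Y t)" by blast
    have run: "iterate F Z t = on_track 1 (iterate G Y t)" if "t \<le> ?T Y" for t
      using that
    proof (induction t rule: time_induct)
      case (succ t)
      then have "t < ?T Y" by (simp add: succ_le_iff)
      then have "\<not> H (iterate G Y t)" by (rule not_less_Least)
      then show ?case using succ.IH \<open>t < ?T Y\<close> by (simp add: F_def)
    next
      case (limit t)
      have "iterate F Z t = limsup (\<lambda>u. {} \<union> on_track 1 (iterate G Y u)) t"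
        unfolding iterate_limit[OF limit(1)]
        by (rule limsup_cong) (use limit(2,3) in simp)
      then show ?case unfolding limsup_Un_on_track[OF limit(1)] iterate_limit[OF limit(1), of G] by simp
    qed (simp add: Z)
    have "iterate F Z (succ (?T Y)) = insert 0 (on_track 1 (iterate G Y (?T Y)))"
      unfolding iterate_succ run[OF order_refl] using LeastI_ex[OF ex] by (simp add: F_def)
    then show "\<exists>t. stops_at F Z t \<and> iterate F Z t =
        insert 0 (on_track 1 (iterate G (track 1 Z) (?T (track 1 Z))))"
      using run by (intro exI[of _ "succ (?T Y)"]) (auto simp: stops_at_def less_succ_iff Z)
  qed
  have "on_track 1 (J X) \<in> ?E" if "X \<in> D" for X using assms(4)[OF that] by blast
  from computable_on_compose[OF computable_on_track[OF assms(3)] loop this]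
  have "computable_on D (\<lambda>X. insert 0 (on_track 1 (iterate G (J X) (?T (J X)))))" by simp
  from computable_track[OF this, of 1] show ?thesis by simp
qed

lemma iterate_track:
  assumes "\<And>s. s < t \<Longrightarrow> track i (G (iterate G X s)) = G' (track i (iterate G X s))"
  shows "track i (iterate G X t) = iterate G' (track i X) t"
  using assms
proof (induction t rule: time_induct)
  case (limit t)
  then show ?case unfolding track_iterate_limit[OF limit(1)] iterate_limit[OF limit(1), of G']
    by (intro limsup_cong) (meson order.strict_trans)
qed (auto simp: less_succ_iff)

lemma iterate_ident: "iterate (\<lambda>S. S) X t = X"
proof (induction t rule: time_induct)
  case (limit t)
  then show ?case unfolding iterate_limit[OF limit(1)]
    by (intro limsup_eventually_const[OF is_limit_pos])
qed simp_all

lemma iterate_track_const: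
  "(\<And>s. s < t \<Longrightarrow> track i (G (iterate G X s)) = track i (iterate G X s)) \<Longrightarrow>
    track i (iterate G X t) = track i X"
  by (subst iterate_track[where G' = "\<lambda>S. S"]) (auto simp: iterate_ident)

lemma limsup_increasing_union:
  assumes "is_limit t"
  shows "limsup (\<lambda>u. \<Union>s<u. B s) t = (\<Union>s<t. B s)"
proof (intro set_eqI iffI)
  fix n assume "n \<in> limsup (\<lambda>u. \<Union>s<u. B s) t"
  then obtain d where "d < t" "n \<in> (\<Union>s<d. B s)" by (rule in_limsupD[OF _ is_limit_pos[OF assms]])
  then show "n \<in> (\<Union>s<t. B s)" by (auto intro: order.strict_trans)
next
  fix n assume "n \<in> (\<Union>s<t. B s)"
  then obtain s where s: "s < t" "n \<in> B s" by auto
  show "n \<in> limsup (\<lambda>u. \<Union>s<u. B s) t"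
  proof (rule in_limsupI)
    fix b assume "b < t"
    then have "max b (succ s) < t" using is_limit_succ_less[OF assms s(1)] by simp
    then show "\<exists>d. b \<le> d \<and> d < t \<and> n \<in> (\<Union>s<d. B s)"
      using s(2) less_succ[of s] by (intro exI[of _ "max b (succ s)"]) (auto simp: less_max_iff_disj)
  qed
qed

lemma increasing_union:
  assumes "f 0 = {}" "\<And>s. f (succ s) = f s \<union> B s" "\<And>s. is_limit s \<Longrightarrow> f s = limsup f s"
  shows "f t = (\<Union>s<t. B s)"
proof (induction t rule: time_induct)
  case (succ t)
  then show ?case by (auto simp: assms(2) lessThan_succ)
next
  case (limit t)
  then show ?case unfolding assms(3)[OF limit(1)] limsup_increasing_union[OF limit(1), symmetric]
    by (intro limsup_cong) blast
qed (use assms(1) not_less_zero_time in auto)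

lemma stays_constant:
  assumes "f T = c" "\<And>t. T \<le> t \<Longrightarrow> f t = c \<Longrightarrow> f (succ t) = c" "\<And>t. is_limit t \<Longrightarrow> f t = limsup f t" "T \<le> t"
  shows "f t = c"
  using assms(4)
proof (induction t rule: time_induct)
  case (succ t)
  then show ?case using assms(1,2) unfolding le_succ_iff by blast
next
  case (limit t)
  show ?case
  proof (cases "T = t")
    case False
    then have "T < t" using limit(3) by simp
    then show ?thesis unfolding assms(3)[OF limit(1)] by (rule limsup_eventually_const) (rule limit(2))
  qed (use assms(1) in simp)
qed (use assms(1) in simp)

lemma zero_notin_iterate:
  assumes "\<And>S. 0 \<notin> G S" "0 \<notin> X"
  shows "0 \<notin> iterate G X t"
proof (induction t rule: time_induct)
  case (limit t)
  then show ?case unfolding iterate_limit[OF limit(1)] using is_limit_pos[OF limit(1)]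
    by (auto elim: in_limsupD)
qed (use assms in simp_all)

section \<open>The universal step\<close>

text \<open>A list code being searched, and one more than the code of the first instruction found for the state and symbols
  given by the first component.\<close>

definition find_step :: "nat \<Rightarrow> nat" where
  "find_step z = (if pfst (psnd z) = 0 then z else
     let n = pfst (psnd z) - 1; c = pfst n in
     if pair (pfst c) (pfst (psnd c)) = pfst z then pair (pfst z) (pair 0 (Suc c)) else pair (pfst z) (pair (psnd n) 0))"

definition instr_at :: "nat \<Rightarrow> nat \<Rightarrow> nat \<Rightarrow> nat" where
  "instr_at e q r = psnd (psnd ((find_step ^^ e) (pair (pair q r) (pair e 0))))"

lemma prim_rec_instr_at: "prim_rec f \<Longrightarrow> prim_rec g \<Longrightarrow> prim_rec h \<Longrightarrow>
    prim_rec (\<lambda>n. instr_at (f n) (g n) (h n))"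
  unfolding instr_at_def find_step_def[abs_def] Let_def by (intro prim_rec_rules prim_rec_funpow)

lemma list_decode_Suc: "list_decode (Suc n) = pfst n # list_decode (psnd n)"
  by (simp add: pfst_def psnd_def case_prod_beta)

lemma find_step_funpow:
  "length (list_decode s) \<le> k \<Longrightarrow> (find_step ^^ k) (pair (pair q r) (pair s 0)) = pair (pair q r)
     (pair 0 (case find (\<lambda>c. pfst c = q \<and> pfst (psnd c) = r) (list_decode s) of None \<Rightarrow> 0 | Some c \<Rightarrow> Suc c))"
proof (induction k arbitrary: s)
  case 0
  then have "s = 0" by (cases s) (simp_all add: list_decode_Suc del: list_decode.simps(2))
  then show ?case by simp
next
  case (Suc k)
  have stop: "(find_step ^^ j) (pair z (pair 0 a)) = pair z (pair 0 a)" for j z a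
    by (induction j) (simp_all add: find_step_def)
  show ?case
  proof (cases s)
    case 0
    then show ?thesis using stop[of "Suc k"] by simp
  next
    case (Suc n)
    then have "length (list_decode (psnd n)) \<le> k"
      using Suc.prems by (simp add: list_decode_Suc del: list_decode.simps(2))
    moreover have "find_step (pair (pair q r) (pair (Suc n) 0)) =
        (if pfst (pfst n) = q \<and> pfst (psnd (pfst n)) = r then pair (pair q r) (pair 0 (Suc (pfst n)))
         else pair (pair q r) (pair (psnd n) 0))"
      by (simp add: find_step_def Let_def)
    ultimately show ?thesis using Suc.IH stop[of k]
      unfolding Suc funpow_Suc_right comp_apply list_decode_Suc by simp
  qed
qed

lemma psnd_le: "psnd n \<le> n"
  using le_prod_encode_2[of "psnd n" "pfst n"] by simp

lemma length_list_decode_le: "length (list_decode s) \<le> s"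
proof (induction s rule: less_induct)
  case (less s)
  show ?case
  proof (cases s)
    case (Suc n)
    then show ?thesis using less[of "psnd n"] psnd_le[of n]
      by (simp add: list_decode_Suc del: list_decode.simps(2))
  qed simp
qed

lemma instr_at_eq:
  "instr_at e q r =
    (case find (\<lambda>c. pfst c = q \<and> pfst (psnd c) = r) (list_decode e) of None \<Rightarrow> 0 | Some c \<Rightarrow> Suc c)"
  unfolding instr_at_def find_step_funpow[OF length_list_decode_le] by simp

definition instr_state :: "nat \<Rightarrow> nat" where "instr_state a = pfst (psnd (psnd (a - 1)))"
definition instr_write :: "nat \<Rightarrow> nat" where "instr_write a = pfst (psnd (psnd (psnd (a - 1))))"
definition instr_move :: "nat \<Rightarrow> nat" where "instr_move a = psnd (psnd (psnd (psnd (a - 1))))"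

definition local_view :: "nat set \<Rightarrow> cfg \<Rightarrow> nat" where
  "local_view y C = pair (st C) (pair (cfg.hd C) (readcode y C))"

definition next_instr :: "nat \<Rightarrow> nat \<Rightarrow> nat" where
  "next_instr e u = (if pfst u = 1 then 0 else instr_at e (pfst u) (psnd (psnd u)))"

definition next_st :: "nat \<Rightarrow> nat \<Rightarrow> nat" where
  "next_st e u = (if next_instr e u = 0 then 1 else instr_state (next_instr e u))"

definition next_hd :: "nat \<Rightarrow> nat \<Rightarrow> nat" where
  "next_hd e u = (if next_instr e u = 0 then pfst (psnd u)
     else if instr_move (next_instr e u) = 0 then pfst (psnd u) - 1 else Suc (pfst (psnd u)))"

definition next_cell :: "nat \<Rightarrow> nat \<Rightarrow> nat \<Rightarrow> nat \<Rightarrow> bool \<Rightarrow> bool" where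
  "next_cell e u k n b \<longleftrightarrow>
     (if next_instr e u \<noteq> 0 \<and> n = pfst (psnd u) then k < 3 \<and> bit (instr_write (next_instr e u)) k else b)"

definition tape_cell :: "cfg \<Rightarrow> nat \<Rightarrow> nat \<Rightarrow> bool" where
  "tape_cell C k n \<longleftrightarrow> (if k = 0 then tin C n else if k = 1 then tsc C n else k = 2 \<and> tout C n)"

lemma step_P:
  fixes a e y and C :: cfg
  defines "a \<equiv> next_instr e (local_view y C)"
  shows "step (P e) y C = (if a = 0 then C\<lparr>st := 1\<rparr> else C\<lparr>st := instr_state a,
     tin := (tin C)(cfg.hd C := odd (instr_write a)), tsc := (tsc C)(cfg.hd C := odd (instr_write a div 2)),
     tout := (tout C)(cfg.hd C := odd (instr_write a div 4)),
     cfg.hd := (if instr_move a = 0 then cfg.hd C - 1 else Suc (cfg.hd C))\<rparr>)"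
proof (cases "st C = 1")
  case True
  then show ?thesis unfolding a_def step_def next_instr_def local_view_def by simp
next
  case False
  have decode: "decode_instr c =
      (pfst c, pfst (psnd c), instr_state (Suc c), instr_write (Suc c), instr_move (Suc c))" for c
    unfolding decode_instr_def pfst_def psnd_def instr_state_def instr_write_def instr_move_def
    by (simp add: case_prod_beta)
  have find_map: "find Q (map g cs) = map_option g (find (\<lambda>c. Q (g c)) cs)" for Q
      and g :: "nat \<Rightarrow> instr" and cs
    by (induction cs) auto
  let ?found = "find (\<lambda>c. pfst c = st C \<and> pfst (psnd c) = readcode y C) (list_decode e)"
  have "find (\<lambda>(q, r, _). q = st C \<and> r = readcode y C) (P e) = map_option decode_instr ?found"
    unfolding P_def find_map decode by simp
  moreover have "a = (case ?found of None \<Rightarrow> 0 | Some c \<Rightarrow> Suc c)"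
    unfolding a_def next_instr_def local_view_def instr_at_eq using False by simp
  ultimately show ?thesis using False unfolding step_def by (cases ?found) (simp_all add: decode)
qed

lemma st_step_P: "st (step (P e) y C) = next_st e (local_view y C)"
  and hd_step_P: "cfg.hd (step (P e) y C) = next_hd e (local_view y C)"
  unfolding step_P next_st_def next_hd_def by (simp_all add: local_view_def)

lemma tape_cell_step_P: "tape_cell (step (P e) y C) k n \<longleftrightarrow>
    next_cell e (local_view y C) k n (tape_cell C k n)"
  unfolding step_P next_cell_def tape_cell_def
  by (auto simp: local_view_def bit_iff_odd numeral_3_eq_3 less_Suc_eq)

lemma tape_cell_cfg_limsup:
  "is_limit t \<Longrightarrow> tape_cell (cfg_limsup C t) k n \<longleftrightarrow> n \<in> limsup (\<lambda>d. Collect (tape_cell (C d) k)) t"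
  using is_limit_pos[of t] by (auto simp: tape_cell_def cfg_limsup_def limsup_def)

lemma prim_rec_next_instr: "prim_rec f \<Longrightarrow> prim_rec g \<Longrightarrow> prim_rec (\<lambda>n. next_instr (f n) (g n))"
  unfolding next_instr_def by (intro prim_rec_rules prim_rec_instr_at)

lemma prim_rec_next_st: "prim_rec f \<Longrightarrow> prim_rec g \<Longrightarrow> prim_rec (\<lambda>n. next_st (f n) (g n))"
  unfolding next_st_def instr_state_def by (intro prim_rec_rules prim_rec_next_instr)

lemma prim_rec_next_hd: "prim_rec f \<Longrightarrow> prim_rec g \<Longrightarrow> prim_rec (\<lambda>n. next_hd (f n) (g n))"
  unfolding next_hd_def instr_move_def by (intro prim_rec_rules prim_rec_next_instr)

lemma decidable_next_cell:
  assumes "prim_rec f" "prim_rec g" "prim_rec h" "prim_rec m" "decidable Q"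
  shows "decidable (\<lambda>X n. next_cell (f n) (g n) (h n) (m n) (Q X n))"
  unfolding next_cell_def instr_write_def
  by (intro decidable_rules prim_rec_rules prim_rec_next_instr assms)

text \<open>One step of all programs at once, with a common oracle on track 1.  Tracks 2, 3 and 4 hold the states, head
  positions and tapes.  As in \<^const>\<open>exists_step\<close>, both flags are on exactly at limits; the state and head tracks
  are then void and the programs are in state 2 at cell 0.\<close>

definition in_state :: "nat set \<Rightarrow> nat \<Rightarrow> nat \<Rightarrow> bool" where
  "in_state S e q \<longleftrightarrow> (if 1 \<in> track 0 S \<and> 2 \<in> track 0 S then q = 2
     else if 1 \<notin> track 0 S \<and> 2 \<notin> track 0 S then q = 0 else pair e q \<in> track 2 S)"

definition head_at :: "nat set \<Rightarrow> nat \<Rightarrow> nat \<Rightarrow> bool" where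
  "head_at S e h \<longleftrightarrow> (if 1 \<in> track 0 S \<longleftrightarrow> 2 \<in> track 0 S then h = 0 else pair e h \<in> track 3 S)"

definition reads :: "nat set \<Rightarrow> nat \<Rightarrow> nat \<Rightarrow> nat \<Rightarrow> bool" where
  "reads S e h r \<longleftrightarrow> r = bits_code (h \<in> track 1 S)
     (pair e (pair 0 h) \<in> track 4 S) (pair e (pair 1 h) \<in> track 4 S) (pair e (pair 2 h) \<in> track 4 S)"

definition sees :: "nat set \<Rightarrow> nat \<Rightarrow> nat \<Rightarrow> bool" where
  "sees S e u \<longleftrightarrow> in_state S e (pfst u) \<and> head_at S e (pfst (psnd u)) \<and>
    reads S e (pfst (psnd u)) (psnd (psnd u))"

definition universal_step :: "nat set \<Rightarrow> nat set" where
  "universal_step S = on_track 0 (if 1 \<in> track 0 S \<and> 2 \<notin> track 0 S then {2} else {1}) \<union> on_track 1 (track 1 S)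
     \<union> on_track 2 {m. \<exists>u. sees S (pfst m) u \<and> psnd m = next_st (pfst m) u}
     \<union> on_track 3 {m. \<exists>u. sees S (pfst m) u \<and> psnd m = next_hd (pfst m) u}
     \<union> on_track 4 {m. \<exists>u. sees S (pfst m) u \<and> next_cell (pfst m) u (pfst (psnd m)) (psnd (psnd m)) (m \<in> track 4 S)}"

lemma decidable_in_state: "prim_rec f \<Longrightarrow> prim_rec g \<Longrightarrow> decidable (\<lambda>S n. in_state S (f n) (g n))"
  unfolding in_state_def by (intro decidable_rules computable_rules prim_rec_rules)

lemma decidable_sees: "prim_rec f \<Longrightarrow> prim_rec g \<Longrightarrow> decidable (\<lambda>S n. sees S (f n) (g n))"
  unfolding sees_def head_at_def reads_def eq_bits_code_iff
  by (intro decidable_in_state decidable_rules computable_rules prim_rec_rules prim_rec_div_power2)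

lemma computable_universal_step: "computable universal_step"
  unfolding universal_step_def[abs_def]
  by (intro computable_rules computable_if computable_insert computable_Collect decidable_sees decidable_next_cell
      decidable_rules prim_rec_next_st prim_rec_next_hd prim_rec_rules)

definition simulates_all :: "nat set \<Rightarrow> nat set \<Rightarrow> (nat \<Rightarrow> cfg) \<Rightarrow> bool" where
  "simulates_all z S C \<longleftrightarrow> track 1 S = z \<and>
     (\<forall>e. (\<forall>q. in_state S e q \<longleftrightarrow> q = st (C e)) \<and> (\<forall>h. head_at S e h \<longleftrightarrow> h = cfg.hd (C e)) \<and>
          (\<forall>k n. pair e (pair k n) \<in> track 4 S \<longleftrightarrow> tape_cell (C e) k n))"

lemma universal_step_flags:
  "pair 0 1 \<in> universal_step S \<longleftrightarrow> \<not> (pair 0 1 \<in> S \<and> pair 0 2 \<notin> S)"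
  "pair 0 2 \<in> universal_step S \<longleftrightarrow> pair 0 1 \<in> S \<and> pair 0 2 \<notin> S"
  unfolding universal_step_def by simp_all

lemma simulates_all_step:
  assumes "simulates_all z S C"
  shows "simulates_all z (universal_step S) (\<lambda>e. step (P e) z (C e))"
proof -
  have S: "track 1 S = z" "in_state S e q \<longleftrightarrow> q = st (C e)" "head_at S e h \<longleftrightarrow> h = cfg.hd (C e)"
    "pair e (pair k n) \<in> track 4 S \<longleftrightarrow> tape_cell (C e) k n" for e q h k n
    using assms unfolding simulates_all_def by blast+
  have "reads S e (cfg.hd (C e)) r \<longleftrightarrow> r = readcode z (C e)" for e r
    unfolding reads_def readcode_eq_bits_code S by (simp add: tape_cell_def)
  then have sees: "sees S e u \<longleftrightarrow> u = local_view z (C e)" for e u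
    unfolding sees_def S(2,3) local_view_def by (metis pair_collapse pfst_pair psnd_pair)
  let ?S = "universal_step S" and ?C = "\<lambda>e. step (P e) z (C e)"
  have flags: "1 \<in> track 0 ?S \<longleftrightarrow> 2 \<notin> track 0 ?S" unfolding in_track universal_step_flags by blast
  have "in_state ?S e q \<longleftrightarrow> q = st (?C e)" for e q
    using flags unfolding in_state_def st_step_P by (auto simp: universal_step_def sees)
  moreover have "head_at ?S e h \<longleftrightarrow> h = cfg.hd (?C e)" for e h
    using flags unfolding head_at_def hd_step_P by (auto simp: universal_step_def sees)
  moreover have "pair e (pair k n) \<in> track 4 ?S \<longleftrightarrow> tape_cell (?C e) k n" for e k n
    unfolding tape_cell_step_P S(4)[symmetric] by (simp add: universal_step_def sees)
  moreover have "track 1 ?S = z" using S(1) by (simp add: universal_step_def)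
  ultimately show ?thesis unfolding simulates_all_def by blast
qed

lemma universal_step_flags_limit:
  assumes t: "is_limit t" and k: "k \<in> {1, 2}"
  shows "pair 0 k \<in> iterate universal_step S t"
  unfolding iterate_limit[OF t]
proof (rule in_limsupI)
  fix b assume "b < t"
  then have later: "succ b < t" "succ (succ b) < t" by (auto intro: is_limit_succ_less[OF t])
  have "pair 0 k \<in> iterate universal_step S (succ b) \<or>
      pair 0 k \<in> iterate universal_step S (succ (succ b))"
    using k universal_step_flags[of "iterate universal_step S b"]
      universal_step_flags[of "iterate universal_step S (succ b)"] by auto
  moreover have "b \<le> succ b" "b \<le> succ (succ b)" using le_succ order_trans by blast+
  ultimately show "\<exists>d. b \<le> d \<and> d < t \<and> pair 0 k \<in> iterate universal_step S d" using later by blast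
qed

theorem universal_step_simulates_all:
  "simulates_all z (iterate universal_step (on_track 1 z) t) (\<lambda>e. config (P e) z {} t)"
proof (induction t rule: time_induct)
  case zero
  show ?case unfolding simulates_all_def
    by (simp add: in_state_def head_at_def init_cfg_def tape_cell_def)
next
  case (succ t)
  then show ?case using simulates_all_step by simp
next
  case (limit t)
  let ?run = "iterate universal_step (on_track 1 z)"
  have IH: "track 1 (?run u) = z" "pair e (pair k n) \<in> track 4 (?run u) \<longleftrightarrow>
      tape_cell (config (P e) z {} u) k n"
    if "u < t" for u e k n
    using limit(2)[OF that] unfolding simulates_all_def by blast+
  have "track 1 (?run t) = z"
    unfolding track_iterate_limit[OF limit(1)]
    by (rule limsup_eventually_const[OF is_limit_pos[OF limit(1)] IH(1)])
  moreover have "pair e (pair k n) \<in> track 4 (?run t) \<longleftrightarrow> tape_cell (config (P e) z {} t) k n" for e k n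
  proof -
    have "limsup (\<lambda>u. {n. pair e (pair k n) \<in> track 4 (?run u)}) t =
        limsup (\<lambda>u. Collect (tape_cell (config (P e) z {} u) k)) t"
      by (rule limsup_cong) (use IH(2) in blast)
    then show ?thesis
      unfolding track_iterate_limit[OF limit(1)] config_limit[OF limit(1)] tape_cell_cfg_limsup[OF limit(1)]
        limsup_vimage[symmetric] by blast
  qed
  moreover have "pair 0 1 \<in> ?run t" "pair 0 2 \<in> ?run t"
    using universal_step_flags_limit[OF limit(1)] by blast+
  ultimately show ?case unfolding simulates_all_def
    by (simp add: in_state_def head_at_def config_limit_sel[OF limit(1)])
qed

section \<open>Ordinals of relations coded by reals\<close>

definition acc_step :: "nat set \<Rightarrow> nat set \<Rightarrow> nat set" where
  "acc_step c W = {b. \<forall>a. pair a b \<in> c \<longrightarrow> a \<in> W}"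

definition wf_stage :: "nat set \<Rightarrow> time \<Rightarrow> nat set" where
  "wf_stage c = iterate (\<lambda>W. W \<union> acc_step c W) {}"

definition wf_part :: "nat set \<Rightarrow> nat set" where "wf_part c = (\<Union>t. wf_stage c t)"

definition height :: "nat set \<Rightarrow> time" where "height c = (LEAST t. wf_part c \<subseteq> wf_stage c t)"

lemma in_acc_step: "b \<in> acc_step c W \<longleftrightarrow> (\<forall>a. pair a b \<in> c \<longrightarrow> a \<in> W)"
  unfolding acc_step_def by simp

lemma acc_step_mono: "W \<subseteq> W' \<Longrightarrow> acc_step c W \<subseteq> acc_step c W'"
  unfolding acc_step_def by blast

lemma wf_stage_eq: "wf_stage c t = (\<Union>s<t. acc_step c (wf_stage c s))"
  unfolding wf_stage_def by (rule increasing_union) (simp_all add: iterate_limit)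

lemma in_wf_stage: "b \<in> wf_stage c t \<longleftrightarrow> (\<exists>s<t. b \<in> acc_step c (wf_stage c s))"
  unfolding wf_stage_eq[of c t] by auto

lemma wf_stage_mono: "s \<le> t \<Longrightarrow> wf_stage c s \<subseteq> wf_stage c t"
  unfolding wf_stage_eq[of c s] wf_stage_eq[of c t] by (auto intro: less_le_trans)

lemma wf_stage_subset_wf_part: "wf_stage c t \<subseteq> wf_part c"
  unfolding wf_part_def by blast

lemma ex_wf_part_subset_wf_stage: "\<exists>t. wf_part c \<subseteq> wf_stage c t"
proof -
  obtain f where f: "\<And>n. n \<in> wf_part c \<Longrightarrow> n \<in> wf_stage c (f n)" unfolding wf_part_def by (metis UN_E)
  obtain t where "\<And>n. f n < t" using time_bounded_nat by blast
  then have "n \<in> wf_stage c t" if "n \<in> wf_part c" for n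
    using f[OF that] wf_stage_mono[of "f n" t c] less_imp_le by blast
  then show ?thesis by blast
qed

lemma height_le_iff: "height c \<le> t \<longleftrightarrow> wf_part c \<subseteq> wf_stage c t"
proof
  have "wf_part c \<subseteq> wf_stage c (height c)" unfolding height_def
    by (rule LeastI_ex[OF ex_wf_part_subset_wf_stage])
  then show "height c \<le> t \<Longrightarrow> wf_part c \<subseteq> wf_stage c t" using wf_stage_mono by blast
qed (unfold height_def, rule Least_le)

lemma wf_stage_height: "wf_stage c (height c) = wf_part c"
  using height_le_iff[of c "height c"] wf_stage_subset_wf_part by blast

lemma height_le_iff_acc_step: "height c \<le> t \<longleftrightarrow> acc_step c (wf_stage c t) \<subseteq> wf_stage c t"
proof
  assume "height c \<le> t"
  then have "wf_part c \<subseteq> wf_stage c t" unfolding height_le_iff .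
  moreover have "acc_step c (wf_stage c t) \<subseteq> wf_stage c (succ t)" 
    using less_succ[of t] unfolding wf_stage_eq[of c "succ t"] by blast
  ultimately show "acc_step c (wf_stage c t) \<subseteq> wf_stage c t" using wf_stage_subset_wf_part by blast
next
  assume closed: "acc_step c (wf_stage c t) \<subseteq> wf_stage c t"
  have "wf_stage c u \<subseteq> wf_stage c t" for u
  proof (induction u rule: less_induct)
    case (less u)
    then have "acc_step c (wf_stage c s) \<subseteq> wf_stage c t" if "s < u" for s
      using acc_step_mono closed that by blast
    then show ?case unfolding wf_stage_eq[of c u] by auto
  qed
  then show "height c \<le> t" unfolding height_le_iff wf_part_def by blast
qed

lemma wf_stage_embed:
  assumes "\<And>a b. pair a (h b) \<in> d \<longleftrightarrow> (\<exists>a'. a = h a' \<and> pair a' b \<in> c)"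
  shows "h b \<in> wf_stage d t \<longleftrightarrow> b \<in> wf_stage c t"
proof (induction t arbitrary: b rule: less_induct)
  case (less t)
  then have "h b \<in> acc_step d (wf_stage d s) \<longleftrightarrow> b \<in> acc_step c (wf_stage c s)" if "s < t" for s
    using that unfolding in_acc_step assms by auto
  then show ?case unfolding in_wf_stage[of _ _ t] by blast
qed

lemma height_le_embed:
  assumes "\<And>a b. pair a (h b) \<in> d \<longleftrightarrow> (\<exists>a'. a = h a' \<and> pair a' b \<in> c)"
  shows "height c \<le> height d"
proof -
  note embed = wf_stage_embed[of h d c, OF assms]
  have "b \<in> wf_stage c (height d)" if b: "b \<in> wf_part c" for b
  proof -
    obtain t where "b \<in> wf_stage c t" using b unfolding wf_part_def by blast
    then have "h b \<in> wf_part d" using embed wf_stage_subset_wf_part by blast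
    then show ?thesis unfolding wf_stage_height[symmetric] embed .
  qed
  then show ?thesis unfolding height_le_iff by blast
qed

definition succ_code :: "nat set \<Rightarrow> nat set" where
  "succ_code c =
    {m. 0 < pfst m \<and> (if psnd m = 0 then pfst m - 1 \<in> wf_part c else pair (pfst m - 1) (psnd m - 1) \<in> c)}"

lemma pair_in_succ_code:
  "pair a (Suc b) \<in> succ_code c \<longleftrightarrow> (\<exists>a'. a = Suc a' \<and> pair a' b \<in> c)"
  "pair a 0 \<in> succ_code c \<longleftrightarrow> (\<exists>a'. a = Suc a' \<and> a' \<in> wf_part c)"
  by (cases a; simp add: succ_code_def)+

lemma zero_in_wf_stage_succ_code: "0 \<in> wf_stage (succ_code c) t \<longleftrightarrow> height c < t"
proof -
  have "0 \<in> acc_step (succ_code c) (wf_stage (succ_code c) s) \<longleftrightarrow> height c \<le> s" for s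
    unfolding height_le_iff in_acc_step pair_in_succ_code
    using wf_stage_embed[of Suc "succ_code c" c, OF pair_in_succ_code(1)] by auto
  then show ?thesis unfolding in_wf_stage by (auto intro: le_less_trans)
qed

lemma height_succ_code: "height c < height (succ_code c)"
proof -
  have "0 \<in> wf_stage (succ_code c) (succ (height c))" using zero_in_wf_stage_succ_code less_succ by blast
  then have "0 \<in> wf_stage (succ_code c) (height (succ_code c))"
    using wf_stage_subset_wf_part unfolding wf_stage_height by blast
  then show ?thesis unfolding zero_in_wf_stage_succ_code .
qed

definition sum_code :: "(nat \<Rightarrow> nat set) \<Rightarrow> nat set" where
  "sum_code c = {k. pfst (pfst k) = pfst (psnd k) \<and>
    pair (psnd (pfst k)) (psnd (psnd k)) \<in> c (pfst (pfst k))}"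

lemma height_le_sum_code: "height (c e) \<le> height (sum_code c)"
proof (rule height_le_embed[of "pair e"])
  show "pair a (pair e b) \<in> sum_code c \<longleftrightarrow> (\<exists>a'. a = pair e a' \<and> pair a' b \<in> c e)" for a b
    unfolding sum_code_def by (auto intro!: exI[of _ "psnd a"])
qed

lemma decidable_subset: "computable A \<Longrightarrow> computable B \<Longrightarrow> decidable (\<lambda>X n. A X \<subseteq> B X)"
  unfolding subset_iff by (intro decidable_rules prim_rec_rules)

lemma computable_acc_step: "computable C \<Longrightarrow> computable W \<Longrightarrow> computable (\<lambda>X. acc_step (C X) (W X))"
  unfolding acc_step_def by (intro computable_Collect decidable_rules prim_rec_rules)

text \<open>The well-founded part is computed on track 3 to count the steps of the iteration on track 4.\<close>

lemma computable_iterate_height: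
  assumes "computable C" "computable J" "computable (\<lambda>Z. G (track 1 Z) (track 2 Z))"
  shows "computable (\<lambda>X. iterate (G X) (J X) (height (C X)))"
proof -
  define F where "F S = on_track 1 (track 1 S) \<union> on_track 2 (track 2 S)
      \<union> on_track 3 (track 3 S \<union> acc_step (track 2 S) (track 3 S)) \<union> on_track 4 (G (track 1 S) (track 4 S))" for S
  define start where "start X = on_track 1 X \<union> on_track 2 (C X) \<union> on_track 4 (J X)" for X
  define closed where "closed S \<longleftrightarrow> acc_step (track 2 S) (track 3 S) \<subseteq> track 3 S" for S
  have "computable (\<lambda>S. on_track 1 (track 1 S) \<union> on_track 2 (track 4 S))" by (intro computable_rules)
  from computable_compose[OF this assms(3)] have "computable F" unfolding F_def
    by (intro computable_rules computable_acc_step) simp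
  moreover have "decidable (\<lambda>S n. closed S)" unfolding closed_def
    by (intro decidable_subset computable_acc_step computable_rules)
  moreover have "computable start" unfolding start_def by (intro computable_rules assms(1,2))
  moreover have fixed: "track 1 (iterate F (start X) t) = X" "track 2 (iterate F (start X) t) = C X"
      for X t
    using iterate_track_const[of t 1 F "start X"] iterate_track_const[of t 2 F "start X"]
    by (simp_all add: F_def start_def)
  have stage: "track 3 (iterate F (start X) t) = wf_stage (C X) t" for X t
    unfolding wf_stage_def using fixed
    by (subst iterate_track[where G' = "\<lambda>W. W \<union> acc_step (C X) W"]) (simp_all add: F_def start_def)
  have run: "track 4 (iterate F (start X) t) = iterate (G X) (J X) t" for X t
    using fixed by (subst iterate_track[where G' = "G X"]) (simp_all add: F_def start_def)
  have closed: "closed (iterate F (start X) t) \<longleftrightarrow> height (C X) \<le> t" for X t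
    unfolding closed_def stage fixed height_le_iff_acc_step ..
  ultimately have "computable (\<lambda>X. iterate F (start X) (LEAST t. closed (iterate F (start X) t)))"
    by (intro computable_while) auto
  moreover have "(LEAST t. closed (iterate F (start X) t)) = height (C X)" for X
    unfolding closed by (rule Least_equality) simp_all
  ultimately have "computable (\<lambda>X. iterate F (start X) (height (C X)))" by simp
  from computable_track[OF this, of 4] show ?thesis unfolding run .
qed

lemma computable_wf_part: "computable wf_part"
proof -
  have "computable (\<lambda>Z. track 2 Z \<union> acc_step (track 1 Z) (track 2 Z))"
    by (intro computable_rules computable_acc_step)
  from computable_iterate_height[OF computable_ident computable_empty this] show ?thesis
    unfolding wf_stage_def[symmetric] wf_stage_height .
qed

lemma computable_succ_code: "computable succ_code"
  unfolding succ_code_def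
  by (intro computable_Collect decidable_rules computable_wf_part computable_ident prim_rec_rules)

section \<open>The ordinals written by all programs\<close>

abbreviation universal_run :: "time \<Rightarrow> nat set" where "universal_run \<equiv> iterate universal_step {}"

definition cells :: "time \<Rightarrow> nat set" where "cells t = track 4 (universal_run t)"

lemma in_cells: "pair e (pair k n) \<in> cells t \<longleftrightarrow> tape_cell (config (P e) {} {} t) k n"
  using universal_step_simulates_all[of "{}" t] unfolding simulates_all_def cells_def by simp

lemma cells_limit: "is_limit t \<Longrightarrow> cells t = limsup cells t"
  unfolding cells_def[abs_def] by (rule track_iterate_limit)

text \<open>The addresses are those at which \<open>computable_iteration_displayed\<close> shows a state.\<close>

definition shown_code :: "nat \<Rightarrow> nat set \<Rightarrow> nat set" where
  "shown_code e S = {m. pair e (pair 2 (Suc (pair 2 (pair 1 m)))) \<in> track 4 S}"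

definition shown_bound :: "nat set \<Rightarrow> nat set" where
  "shown_bound S = succ_code (sum_code (\<lambda>e. shown_code e S))"

definition shown_height :: "time \<Rightarrow> time" where "shown_height t = height (shown_bound (universal_run t))"

lemma computable_shown_bound: "computable shown_bound"
  unfolding shown_bound_def sum_code_def shown_code_def mem_Collect_eq
  by (intro computable_compose[OF _ computable_succ_code] computable_Collect decidable_rules computable_rules prim_rec_rules)

lemma height_shown_code: "height (shown_code e (universal_run t)) < shown_height t"
  unfolding shown_height_def shown_bound_def using height_le_sum_code height_succ_code
  by (rule le_less_trans)

lemma shown_code_displays:
  assumes "computable F" "\<And>t. 0 \<notin> iterate F {} t"
  obtains i where "displays (\<lambda>u. shown_code i (universal_run u)) (\<lambda>t. track 1 (iterate F {} t))"
proof -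
  obtain i where i: "displays (\<lambda>u. {n. tout (config (P i) {} {} u) (Suc (pair 2 n))}) (iterate F {})"
    using computable_iteration_displayed assms by blast
  have "{n. tout (config (P i) {} {} u) (Suc (pair 2 (pair 1 n)))} = shown_code i (universal_run u)"
      for u
    using in_cells[of i 2 _ u] unfolding shown_code_def cells_def tape_cell_def by simp
  then show ?thesis using that displays_vimage[OF i, of "pair 1"] unfolding track_def by simp
qed

definition cells_between :: "nat set \<Rightarrow> nat set \<Rightarrow> nat set" where
  "cells_between c d = (\<Union>t\<in>{height c..<height d}. cells t)"

lemma in_cells_between: "n \<in> cells_between c d \<longleftrightarrow> (\<exists>t. height c \<le> t \<and> t < height d \<and> n \<in> cells t)"
  unfolding cells_between_def by auto

lemma computable_cells_between:
  assumes "computable C" "computable E"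
  shows "computable (\<lambda>X. cells_between (C X) (E X))"
proof -
  define G where "G X S = on_track 1 (track 1 S \<union> acc_step (C X) (track 1 S)) \<union> on_track 2 (universal_step (track 2 S))
    \<union> on_track 3 (track 3 S \<union> (if acc_step (C X) (track 1 S) \<subseteq> track 1 S then track 4 (track 2 S) else {}))" for X S
  let ?run = "\<lambda>X. iterate (G X) {}"
  have C: "computable (\<lambda>Z. C (track 1 Z))" by (rule computable_compose[OF _ assms(1)])
      (intro computable_rules)
  have "computable (\<lambda>Z. G (track 1 Z) (track 2 Z))" unfolding G_def
    by (intro computable_rules computable_if decidable_subset computable_acc_step C computable_compose[OF _ computable_universal_step])
  from computable_track[OF computable_iterate_height[OF assms(2) computable_empty this], of 3]
  have "computable (\<lambda>X. track 3 (?run X (height (E X))))" .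
  moreover have "track 3 (?run X t) = (\<Union>s<t. if height (C X) \<le> s then cells s else {})" for X t
  proof (rule increasing_union)
    have stage: "track 1 (?run X s) = wf_stage (C X) s" for s unfolding wf_stage_def
      by (subst iterate_track[where G' = "\<lambda>W. W \<union> acc_step (C X) W"]) (simp_all add: G_def)
    have "track 2 (?run X s) = universal_run s" for s
      by (subst iterate_track[where G' = universal_step]) (simp_all add: G_def)
    then show "track 3 (?run X (succ s)) = track 3 (?run X s) \<union> (if height (C X) \<le> s then cells s
        else {})" for s
      unfolding iterate_succ height_le_iff_acc_step stage[symmetric] by (simp add: G_def cells_def)
  qed (simp_all add: track_iterate_limit)
  moreover have "(\<Union>s<height (E X). if height (C X) \<le> s then cells s else {}) =
      cells_between (C X) (E X)" for X
    by (auto simp: in_cells_between split: if_splits)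
  ultimately show ?thesis by simp
qed

text \<open>The eventually writable reals of Hamkins and Lewis, with operators in place of machines.\<close>

definition eventually_writable :: "nat set \<Rightarrow> bool" where
  "eventually_writable c \<longleftrightarrow>
     (\<exists>F T. computable F \<and> (\<forall>t. 0 \<notin> iterate F {} t) \<and> (\<forall>t\<ge>T. track 1 (iterate F {} t) = c))"

lemma eventually_writable_empty: "eventually_writable {}"
  unfolding eventually_writable_def by (intro exI[of _ "\<lambda>S. S"])
      (simp add: computable_ident iterate_ident)

text \<open>A machine may revise a guess by means of an eventually writable real \<open>c\<close> and the universal run; a guess on which
  it settles is eventually writable.\<close>

lemma ex_guesses:
  assumes "eventually_writable c" "computable (\<lambda>Z. B (track 1 Z) (track 2 Z) (track 3 Z))"
  obtains d T where "\<forall>s\<ge>T. d (succ s) = B (d s) c (universal_run s)"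
    "\<forall>s\<ge>T. (\<forall>u\<ge>s. B (d s) c (universal_run u) = d s) \<longrightarrow> eventually_writable (d s)"
proof -
  obtain F T where F: "computable F" "\<And>t. 0 \<notin> iterate F {} t" "\<And>t. T \<le> t \<Longrightarrow> track 1 (iterate F {} t) = c"
    using assms(1) unfolding eventually_writable_def by blast
  define G where "G S = on_track 1 (B (track 1 S) (track 1 (track 2 S)) (track 3 S)) \<union> on_track 2 (F (track 2 S))
    \<union> on_track 3 (universal_step (track 3 S))" for S
  define d where "d s = track 1 (iterate G {} s)" for s
  have "computable (\<lambda>S. on_track 1 (track 1 S) \<union> on_track 2 (track 1 (track 2 S)) \<union> on_track 3 (track 3 S))"
    by (intro computable_rules)
  from computable_compose[OF this assms(2)] have "computable G" unfolding G_def
    by (intro computable_rules computable_compose[OF _ F(1)] computable_compose[OF _ computable_universal_step]) simp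
  moreover have "0 \<notin> iterate G {} s" for s by (rule zero_notin_iterate) (simp_all add: G_def)
  moreover have "track 2 (iterate G {} s) = iterate F {} s" for s
    by (subst iterate_track[where G' = F]) (simp_all add: G_def)
  moreover have "track 3 (iterate G {} s) = universal_run s" for s
    by (subst iterate_track[where G' = universal_step]) (simp_all add: G_def)
  ultimately have G: "computable G" "\<And>s. 0 \<notin> iterate G {} s"
    and revise: "\<forall>s\<ge>T. d (succ s) = B (d s) c (universal_run s)"
    unfolding d_def iterate_succ using F(3) by (simp_all add: G_def)
  have "eventually_writable (d s)" if s: "T \<le> s" and settled: "\<forall>u\<ge>s. B (d s) c (universal_run u) =
      d s" for s
  proof -
    have "d t = d s" if "s \<le> t" for t
    proof (rule stays_constant[where f = d, OF refl _ _ that])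
      fix u assume "s \<le> u" "d u = d s"
      then show "d (succ u) = d s" using revise settled s by simp
    qed (unfold d_def, rule track_iterate_limit)
    then show ?thesis unfolding eventually_writable_def d_def using G by blast
  qed
  then show ?thesis using that revise by blast
qed

lemma eventually_writable_succ_code:
  assumes "eventually_writable c"
  shows "eventually_writable (succ_code c)"
proof -
  have "computable (\<lambda>Z. succ_code (track 2 Z))"
    by (intro computable_compose[OF _ computable_succ_code] computable_rules)
  then obtain d T where "\<forall>s\<ge>T. d (succ s) = succ_code c"
    "\<forall>s\<ge>T. (\<forall>u\<ge>s. succ_code c = d s) \<longrightarrow> eventually_writable (d s)"
    by (rule ex_guesses[where B = "\<lambda>_ c _. succ_code c", OF assms])
  then show ?thesis using le_succ[of T] order_refl[of T] by metis
qed

lemma shown_height_grows: "\<exists>u\<ge>t. shown_height t < shown_height u"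
proof -
  define F where "F S =
      on_track 1 (succ_code (shown_bound (track 2 S))) \<union> on_track 2 (universal_step (track 2 S))" for S
  have "computable F" unfolding F_def
    by (intro computable_rules computable_compose[OF _ computable_succ_code] computable_compose[OF _ computable_shown_bound]
        computable_compose[OF _ computable_universal_step])
  moreover have "0 \<notin> iterate F {} s" for s by (rule zero_notin_iterate) (simp_all add: F_def)
  ultimately obtain i
      where "displays (\<lambda>u. shown_code i (universal_run u)) (\<lambda>s. track 1 (iterate F {} s))"
    using shown_code_displays by blast
  then obtain u where u: "succ t \<le> u" "shown_code i (universal_run u) = track 1 (iterate F {} (succ t))"
    unfolding displays_def by blast
  have "track 2 (iterate F {} s) = universal_run s" for s
    by (subst iterate_track[where G' = universal_step]) (simp_all add: F_def)
  then have "shown_code i (universal_run u) = succ_code (shown_bound (universal_run t))"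
    unfolding u(2) iterate_succ by (simp add: F_def)
  then have "shown_height t < height (shown_code i (universal_run u))"
    unfolding shown_height_def by (simp add: height_succ_code)
  also have "\<dots> < shown_height u" by (rule height_shown_code)
  finally show ?thesis using order_trans[OF le_succ u(1)] by blast
qed

lemma eventually_writable_shown:
  assumes "eventually_writable c"
  shows "\<exists>i u. \<forall>w\<ge>u. shown_code i (universal_run w) = c"
proof -
  obtain F T where F: "computable F" "\<And>t. 0 \<notin> iterate F {} t" "\<And>t. T \<le> t \<Longrightarrow> track 1 (iterate F {} t) = c"
    using assms unfolding eventually_writable_def by blast
  obtain i where "displays (\<lambda>u. shown_code i (universal_run u)) (\<lambda>t. track 1 (iterate F {} t))"
    using shown_code_displays[OF F(1,2)] .
  then obtain u
      where u: "\<forall>w\<ge>u. mixture (\<lambda>t. track 1 (iterate F {} t)) {T..} (shown_code i (universal_run w))"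
    unfolding displays_def by blast
  have "shown_code i (universal_run w) = c" if "u \<le> w" for w
    by (rule mixture_const[OF u[rule_format, OF that]]) (simp only: atLeast_iff F(3))
  then show ?thesis by blast
qed

lemma height_eventually_writable_bounded: "\<exists>U. \<forall>c. eventually_writable c \<longrightarrow>
    (\<forall>w\<ge>U. height c < shown_height w)"
proof -
  define settled where "settled i u c \<longleftrightarrow> (\<forall>w\<ge>u. shown_code i (universal_run w) = c)" for i u c
  define settling_time where "settling_time i = (SOME u. \<exists>c. settled i u c)" for i
  obtain U where U: "\<And>i. settling_time i < U" using time_bounded_nat[of settling_time] by blast
  have "height c < shown_height w" if c: "eventually_writable c" and w: "U \<le> w" for c w
  proof -
    obtain i u where u: "settled i u c" using eventually_writable_shown[OF c] unfolding settled_def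
      by blast
    then have "\<exists>c. settled i (settling_time i) c" unfolding settling_time_def
      by (intro someI_ex[of "\<lambda>u. \<exists>c. settled i u c"]) blast
    then obtain c' where c': "settled i (settling_time i) c'" by blast
    have "c' = c" using u c' max.cobounded1 max.cobounded2 unfolding settled_def by metis
    moreover have "settling_time i \<le> w" using U[of i] w by simp
    ultimately have "shown_code i (universal_run w) = c" using c' unfolding settled_def by blast
    then show ?thesis using height_shown_code[of i w] by simp
  qed
  then show ?thesis by blast
qed

text \<open>The ordinals \<open>\<Sigma>\<close> and \<open>\<zeta>\<close> of Welch.\<close>

definition shown_limit :: time where "shown_limit = (LEAST s. \<exists>T. \<forall>t\<ge>T. shown_height t \<le> s)"

definition writable_limit :: time where "writable_limit =
    (LEAST s. \<forall>c. eventually_writable c \<longrightarrow> height c < s)"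

lemma shown_height_less_shown_limit: "\<exists>T. \<forall>t\<ge>T. shown_height t < shown_limit"
proof -
  obtain b where "\<And>c. height c < b" using time_bounded_real[of height] by blast
  then have "\<exists>T. \<forall>t\<ge>T. shown_height t \<le> b" unfolding shown_height_def by (meson less_imp_le)
  then have "\<exists>T. \<forall>t\<ge>T. shown_height t \<le> shown_limit" unfolding shown_limit_def by (rule LeastI)
  then show ?thesis using shown_height_grows by (meson less_le_trans order_trans)
qed

lemma less_shown_limitD: "s < shown_limit \<Longrightarrow> \<exists>t\<ge>T. s < shown_height t"
  using not_less_Least[of s "\<lambda>s. \<exists>T. \<forall>t\<ge>T. shown_height t \<le> s"] unfolding shown_limit_def
  by (auto simp: not_le)

lemma is_limit_shown_limit: "is_limit shown_limit"
proof -
  obtain T where T: "\<forall>t\<ge>T. shown_height t < shown_limit" using shown_height_less_shown_limit by blast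
  then have "\<exists>u<shown_limit. b < u" if "b < shown_limit" for b
    using less_shown_limitD[OF that, of T] by blast
  then show ?thesis using T by (intro is_limitI[of "shown_height T"]) auto
qed

lemma height_less_writable_limit: "eventually_writable c \<Longrightarrow> height c < writable_limit"
  and writable_limit_less_shown_limit: "writable_limit < shown_limit"
proof -
  obtain U T where "\<forall>c. eventually_writable c \<longrightarrow> (\<forall>w\<ge>U. height c < shown_height w)"
    "\<forall>t\<ge>T. shown_height t < shown_limit"
    using height_eventually_writable_bounded shown_height_less_shown_limit by blast
  then have bound: "\<forall>c. eventually_writable c \<longrightarrow> height c < shown_height (max U T)"
    "shown_height (max U T) < shown_limit"
    by simp_all
  have "\<forall>c. eventually_writable c \<longrightarrow> height c < writable_limit" unfolding writable_limit_def
    by (rule LeastI) (rule bound(1))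
  then show "eventually_writable c \<Longrightarrow> height c < writable_limit" by blast
  have "writable_limit \<le> shown_height (max U T)" unfolding writable_limit_def
    by (rule Least_le) (rule bound(1))
  then show "writable_limit < shown_limit" using bound(2) by simp
qed

lemma less_writable_limitD: "s < writable_limit \<Longrightarrow> \<exists>c. eventually_writable c \<and> s \<le> height c"
  using not_less_Least[of s "\<lambda>s. \<forall>c. eventually_writable c \<longrightarrow> height c < s"]
  unfolding writable_limit_def by (auto simp: not_less)

lemma is_limit_writable_limit: "is_limit writable_limit"
proof (rule is_limitI)
  show "height {} < writable_limit" by (rule height_less_writable_limit[OF eventually_writable_empty])
  fix b assume "b < writable_limit"
  then obtain c where c: "eventually_writable c" "b \<le> height c" using less_writable_limitD by blast
  then have "b < height (succ_code c)" using height_succ_code[of c] by simp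
  then show "\<exists>u<writable_limit. b < u"
    using height_less_writable_limit[OF eventually_writable_succ_code[OF c(1)]] by blast
qed

text \<open>A machine that guesses ordinals until it finds one below which the cell is on somewhere above \<open>height c\<close>
  eventually writes such an ordinal.\<close>

lemma cell_reflects:
  assumes c: "eventually_writable c" and t: "height c \<le> t" "t < shown_limit" "n \<in> cells t"
  shows "\<exists>d. eventually_writable d \<and> n \<in> cells_between c d"
proof -
  define B where "B d c S = (if n \<in> cells_between c d then d else shown_bound S)" for d c S
  have "computable (\<lambda>Z. B (track 1 Z) (track 2 Z) (track 3 Z))" unfolding B_def
    by (intro computable_if computable_compose[OF _ computable_shown_bound] computable_rules decidable_rules
        computable_cells_between prim_rec_rules)
  then obtain d T where revise: "\<forall>s\<ge>T. d (succ s) = B (d s) c (universal_run s)"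
    and settled: "\<forall>s\<ge>T. (\<forall>u\<ge>s. B (d s) c (universal_run u) = d s) \<longrightarrow> eventually_writable (d s)"
    by (rule ex_guesses[where B = B, OF c])
  have "\<exists>s\<ge>T. n \<in> cells_between c (d s)"
  proof (rule ccontr)
    assume none: "\<not> (\<exists>s\<ge>T. n \<in> cells_between c (d s))"
    obtain u where u: "T \<le> u" "t < shown_height u" using less_shown_limitD[OF t(2)] by blast
    then have "d (succ u) = shown_bound (universal_run u)" using revise none unfolding B_def by simp
    then have "n \<in> cells_between c (d (succ u))"
      using t u(2) unfolding in_cells_between shown_height_def by auto
    then show False using none u(1) order_trans[OF u(1) le_succ] by blast
  qed
  then obtain s where s: "T \<le> s" "n \<in> cells_between c (d s)" by blast
  then have "eventually_writable (d s)" using settled by (simp add: B_def)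
  then show ?thesis using s(2) by blast
qed

lemma cell_settles:
  assumes "\<eta> < shown_limit" and off: "\<And>t. \<eta> \<le> t \<Longrightarrow> t < shown_limit \<Longrightarrow> n \<notin> cells t"
  shows "\<exists>c. eventually_writable c \<and> (\<forall>t. height c \<le> t \<longrightarrow> t < shown_limit \<longrightarrow> n \<notin> cells t)"
proof -
  define B where "B c d S = (if n \<in> cells_between c (shown_bound S) then shown_bound S else c)"
      for c d :: "nat set" and S
  have "computable (\<lambda>Z. B (track 1 Z) (track 2 Z) (track 3 Z))" unfolding B_def
    by (intro computable_if computable_compose[OF _ computable_shown_bound] computable_rules decidable_rules
        computable_cells_between prim_rec_rules)
  then obtain c T where revise: "\<forall>s\<ge>T. c (succ s) = B (c s) {} (universal_run s)"
    and settled: "\<forall>s\<ge>T. (\<forall>u\<ge>s. B (c s) {} (universal_run u) = c s) \<longrightarrow> eventually_writable (c s)"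
    by (rule ex_guesses[where B = B, OF eventually_writable_empty])
  obtain T' where T': "\<forall>t\<ge>T'. shown_height t < shown_limit" using shown_height_less_shown_limit by blast
  obtain u where u: "max T T' \<le> u" "\<eta> < shown_height u" using less_shown_limitD[OF assms(1)] by blast
  have off_above: "\<forall>t. height (c (succ u)) \<le> t \<longrightarrow> t < shown_limit \<longrightarrow> n \<notin> cells t"
  proof (cases "n \<in> cells_between (c u) (shown_bound (universal_run u))")
    case True
    then have "height (c (succ u)) = shown_height u" using revise u(1)
      unfolding B_def shown_height_def by simp
    then show ?thesis using off u(2) by (metis less_imp_le less_le_trans)
  next
    case False
    then have "c (succ u) = c u" using revise u(1) unfolding B_def by simp
    then show ?thesis
      using False off u(2) unfolding in_cells_between shown_height_def[symmetric]
      by (metis less_imp_le less_le_trans not_le)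
  qed
  have later: "max T T' \<le> succ u" using order_trans[OF u(1) le_succ] .
  have "B (c (succ u)) {} (universal_run w) = c (succ u)" if "succ u \<le> w" for w
  proof -
    have "shown_height w < shown_limit" using T' later that by (meson max.boundedE order_trans)
    then show ?thesis using off_above unfolding B_def in_cells_between shown_height_def[symmetric]
      by (meson less_trans)
  qed
  then have "eventually_writable (c (succ u))" using settled later by simp
  then show ?thesis using off_above by blast
qed

lemma cells_subset_cells_writable_limit:
  assumes "writable_limit \<le> t" "t < shown_limit"
  shows "cells t \<subseteq> cells writable_limit"
  unfolding cells_limit[OF is_limit_writable_limit]
proof (intro subsetI in_limsupI)
  fix n b assume n: "n \<in> cells t" and "b < writable_limit"
  then obtain c where c: "eventually_writable c" "b \<le> height c" using less_writable_limitD by blast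
  then have "height c \<le> t" using height_less_writable_limit[OF c(1)] assms(1) by simp
  then obtain d where d: "eventually_writable d" "n \<in> cells_between c d"
    using cell_reflects[OF c(1) _ assms(2) n] by blast
  then obtain s where "height c \<le> s" "s < height d" "n \<in> cells s" unfolding in_cells_between by blast
  then show "\<exists>s. b \<le> s \<and> s < writable_limit \<and> n \<in> cells s"
    using c(2) height_less_writable_limit[OF d(1)] by (metis order_trans less_trans)
qed

lemma cells_shown_limit: "cells shown_limit = cells writable_limit"
proof (intro set_eqI iffI)
  fix n assume "n \<in> cells shown_limit"
  then obtain t where "writable_limit \<le> t" "t < shown_limit" "n \<in> cells t"
    unfolding cells_limit[OF is_limit_shown_limit]
    by (rule in_limsupD[OF _ writable_limit_less_shown_limit])
  then show "n \<in> cells writable_limit" using cells_subset_cells_writable_limit by blast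
next
  fix n assume n: "n \<in> cells writable_limit"
  show "n \<in> cells shown_limit"
  proof (rule ccontr)
    assume "n \<notin> cells shown_limit"
    then obtain \<eta> where "\<eta> < shown_limit" "\<And>t. \<eta> \<le> t \<Longrightarrow> t < shown_limit \<Longrightarrow> n \<notin> cells t"
      unfolding cells_limit[OF is_limit_shown_limit] limsup_def by blast
    then obtain c where "eventually_writable c" "\<forall>t. height c \<le> t \<longrightarrow> t < shown_limit \<longrightarrow> n \<notin> cells t"
      using cell_settles by blast
    then show False
      using n writable_limit_less_shown_limit height_less_writable_limit[of c] less_imp_le by blast
  qed
qed

lemma ex_greatest_time:
  assumes "u \<in> B" "\<And>u. u \<in> B \<Longrightarrow> u \<le> t"
    and closed: "\<And>m. is_limit m \<Longrightarrow> m \<le> t \<Longrightarrow> (\<And>b. b < m \<Longrightarrow> \<exists>u\<in>B. b < u \<and> u < m) \<Longrightarrow> m \<in> B"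
  obtains m where "m \<in> B" "\<And>u. u \<in> B \<Longrightarrow> u \<le> m"
proof -
  define m where "m = (LEAST m. \<forall>u\<in>B. u \<le> m)"
  have upper: "\<forall>u\<in>B. u \<le> m" unfolding m_def by (rule LeastI[of _ t]) (use assms(2) in blast)
  have "m \<le> t" unfolding m_def by (rule Least_le) (use assms(2) in blast)
  have cofinal: "\<exists>u\<in>B. b < u" if "b < m" for b
    using not_less_Least[of b "\<lambda>m. \<forall>u\<in>B. u \<le> m"] that unfolding m_def by (auto simp: not_le)
  have "m \<in> B"
  proof (rule ccontr)
    assume "m \<notin> B"
    then have below: "\<exists>u\<in>B. b < u \<and> u < m" if "b < m" for b using cofinal[OF that] upper
      by (metis le_less)
    have "u < m" using assms(1) \<open>m \<notin> B\<close> upper by (metis le_less)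
    then have "is_limit m" using below by (intro is_limitI) blast+
    then show False using closed \<open>m \<le> t\<close> below \<open>m \<notin> B\<close> by blast
  qed
  then show ?thesis using that upper by blast
qed

text \<open>A run that repeats at \<open>\<sigma>\<close> its configuration at \<open>\<zeta>\<close> and has no further cell on in between loops.\<close>

locale config_loop =
  fixes p :: prog and y z :: "nat set" and \<zeta> \<sigma> :: time
  assumes limit: "is_limit \<zeta>" and nonempty: "\<zeta> < \<sigma>" and repeats: "config p y z \<sigma> = config p y z \<zeta>"
    and cells_le: "\<And>t k n. \<zeta> \<le> t \<Longrightarrow> t < \<sigma> \<Longrightarrow> tape_cell (config p y z t) k n \<Longrightarrow>
        tape_cell (config p y z \<zeta>) k n"
begin

abbreviation C :: "time \<Rightarrow> cfg" where "C \<equiv> config p y z"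

lemma return_limit:
  assumes m: "is_limit m" "\<zeta> < m" and returns: "\<And>b. b < m \<Longrightarrow> \<exists>u. b < u \<and> u < m \<and> C u = C \<zeta>"
    and in_loop: "\<And>d. \<zeta> \<le> d \<Longrightarrow> d < m \<Longrightarrow> \<exists>s\<ge>\<zeta>. s < \<sigma> \<and> C d = C s"
  shows "C m = C \<zeta>"
proof -
  have "tape_cell (C m) k n \<longleftrightarrow> tape_cell (C \<zeta>) k n" for k n
  proof
    assume "tape_cell (C m) k n"
    then obtain d where d: "\<zeta> \<le> d" "d < m" "tape_cell (C d) k n"
      unfolding config_limit[OF m(1)] tape_cell_cfg_limsup[OF m(1)] using in_limsupD[OF _ m(2)] by blast
    then show "tape_cell (C \<zeta>) k n" using in_loop[OF d(1,2)] cells_le by metis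
  next
    assume "tape_cell (C \<zeta>) k n"
    then show "tape_cell (C m) k n"
      unfolding config_limit[OF m(1)] tape_cell_cfg_limsup[OF m(1)] using returns
      by (intro in_limsupI) (metis less_imp_le mem_Collect_eq)
  qed
  from this[of 0] this[of 1] this[of 2] show ?thesis
    by (intro cfg.equality)
       (simp_all add: tape_cell_def config_limit_sel(1,2)[OF m(1)] config_limit_sel(1,2)[OF limit] fun_eq_iff)
qed

theorem config_in_loop: "\<zeta> \<le> t \<Longrightarrow> \<exists>s\<ge>\<zeta>. s < \<sigma> \<and> C t = C s"
proof (induction t rule: less_induct)
  case (less t)
  obtain \<delta> where \<delta>: "\<sigma> = \<zeta> + \<delta>" using ex_add_eq_time[OF less_imp_le[OF nonempty]] by metis
  obtain m where m: "\<zeta> \<le> m" "m \<le> t" "C m = C \<zeta>" and greatest: "\<And>u. \<zeta> \<le> u \<Longrightarrow> u \<le> t \<Longrightarrow> C u = C \<zeta> \<Longrightarrow> u \<le> m"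
  proof (rule ex_greatest_time[of \<zeta> "{u. \<zeta> \<le> u \<and> u \<le> t \<and> C u = C \<zeta>}" t])
    fix m assume "is_limit m" "m \<le> t" and returns: "\<And>b. b < m \<Longrightarrow>
        \<exists>u\<in>{u. \<zeta> \<le> u \<and> u \<le> t \<and> C u = C \<zeta>}. b < u \<and> u < m"
    then have "\<zeta> < m" using returns[OF is_limit_pos] by auto
    have "C m = C \<zeta>"
    proof (rule return_limit[OF \<open>is_limit m\<close> \<open>\<zeta> < m\<close>])
      show "\<exists>u. b < u \<and> u < m \<and> C u = C \<zeta>" if "b < m" for b using returns[OF that] by blast
      show "\<exists>s\<ge>\<zeta>. s < \<sigma> \<and> C d = C s" if "\<zeta> \<le> d" "d < m" for d using less.IH[of d] that \<open>m \<le> t\<close> by simp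
    qed
    then show "m \<in> {u. \<zeta> \<le> u \<and> u \<le> t \<and> C u = C \<zeta>}" using \<open>m \<le> t\<close> \<open>\<zeta> < m\<close> by simp
  qed (use less.prems that in auto)
  obtain s where s: "t = m + s" using ex_add_eq_time[OF m(2)] by blast
  have "s < \<delta>"
  proof (rule ccontr)
    assume "\<not> s < \<delta>"
    then have "m + \<delta> \<le> t" unfolding s by (simp add: add_le_iff_time not_less)
    moreover have "C (m + \<delta>) = C \<zeta>" using config_add_cong[OF m(3), of \<delta>] repeats \<delta> by simp
    moreover have "\<zeta> \<le> m + \<delta>" using m(1) le_add_time order_trans by blast
    ultimately have "m + \<delta> \<le> m + 0" using greatest by simp
    then have "\<zeta> + \<delta> \<le> \<zeta> + 0" unfolding add_le_iff_time .
    then show False using nonempty \<delta> by simp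
  qed
  then have "\<zeta> + s < \<sigma>" unfolding \<delta> add_less_iff_time .
  moreover have "C t = C (\<zeta> + s)" unfolding s by (rule config_add_cong[OF m(3)])
  ultimately show ?case using le_add_time by blast
qed

end

theorem halting_time_less_shown_limit:
  assumes "st (config (P e) {} {} t) = 1"
  shows "\<exists>s<shown_limit. st (config (P e) {} {} s) = 1"
proof (cases "t < shown_limit")
  case False
  let ?C = "config (P e) {} {}"
  have "tape_cell (?C shown_limit) k n \<longleftrightarrow> tape_cell (?C writable_limit) k n" for k n
    unfolding in_cells[symmetric] cells_shown_limit ..
  from this[of 0] this[of 1] this[of 2] have repeats: "?C shown_limit = ?C writable_limit"
    by (intro cfg.equality) (simp_all add: tape_cell_def config_limit_sel(1,2)[OF is_limit_shown_limit]
        config_limit_sel(1,2)[OF is_limit_writable_limit] fun_eq_iff)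
  interpret config_loop "P e" "{}" "{}" writable_limit shown_limit
  proof
    show "tape_cell (?C writable_limit) k n"
      if "writable_limit \<le> t" "t < shown_limit" "tape_cell (?C t) k n" for t k n
      using cells_subset_cells_writable_limit[OF that(1,2)] that(3) unfolding in_cells[symmetric]
      by blast
  qed (use is_limit_writable_limit writable_limit_less_shown_limit repeats in auto)
  have "writable_limit \<le> t" using False writable_limit_less_shown_limit by simp
  then show ?thesis using config_in_loop assms by metis
qed (use assms in blast)

section \<open>Runs along a coded well-founded relation\<close>

definition rank :: "nat set \<Rightarrow> nat \<Rightarrow> time" where "rank c b = (LEAST s. b \<in> acc_step c (wf_stage c s))"

lemma in_wf_stage_iff_rank:
  assumes "b \<in> wf_part c"
  shows "b \<in> wf_stage c t \<longleftrightarrow> rank c b < t"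
proof -
  have "\<exists>s. b \<in> acc_step c (wf_stage c s)" using assms unfolding wf_part_def UN_iff in_wf_stage by blast
  then have "b \<in> acc_step c (wf_stage c (rank c b))" unfolding rank_def by (rule LeastI_ex)
  moreover have "rank c b \<le> s" if "b \<in> acc_step c (wf_stage c s)" for s unfolding rank_def
    by (rule Least_le) (rule that)
  ultimately show ?thesis unfolding in_wf_stage by (auto intro: le_less_trans)
qed

lemma ex_rank_eq:
  assumes "t < height c"
  shows "\<exists>b\<in>wf_part c. rank c b = t"
proof -
  obtain b where b: "b \<in> acc_step c (wf_stage c t)" "b \<notin> wf_stage c t"
    using assms unfolding not_le[symmetric] height_le_iff_acc_step by blast
  then have "b \<in> wf_stage c (succ t)" using less_succ unfolding in_wf_stage[of b c "succ t"] by blast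
  then have "b \<in> wf_part c" "b \<in> wf_stage c (succ t)" using wf_stage_subset_wf_part by blast+
  then show ?thesis using b(2) by (intro bexI[of _ b]) (simp_all add: in_wf_stage_iff_rank less_succ_iff)
qed

lemma ex_rank_eq_below:
  assumes "b \<in> wf_part c" "t < rank c b"
  shows "\<exists>a\<in>wf_part c. rank c a = t"
proof -
  have "rank c b < height c" using assms(1) in_wf_stage_iff_rank
    unfolding wf_stage_height[symmetric] by blast
  then show ?thesis using ex_rank_eq assms(2) less_trans by blast
qed

definition rank_less :: "nat set \<Rightarrow> nat set" where
  "rank_less c = {m. pfst m \<in> wf_part c \<and> psnd m \<in> wf_part c \<and> rank c (pfst m) < rank c (psnd m)}"

lemma in_rank_less: "pair a b \<in> rank_less c \<longleftrightarrow> a \<in> wf_part c \<and> b \<in> wf_part c \<and> rank c a < rank c b"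
  unfolding rank_less_def by simp

lemma rank_less_eq:
  "rank_less c = {m. psnd m \<in> wf_part c \<and> (\<exists>s<height c. pfst m \<in> wf_stage c s \<and> psnd m \<notin> wf_stage c s)}"
proof (intro set_eqI iffI)
  fix m assume "m \<in> rank_less c"
  then have "pfst m \<in> wf_part c" "psnd m \<in> wf_part c" "rank c (pfst m) < rank c (psnd m)"
    unfolding rank_less_def by blast+
  moreover then have "rank c (psnd m) < height c" using in_wf_stage_iff_rank
    unfolding wf_stage_height[symmetric] by blast
  ultimately show "m \<in> {m. psnd m \<in> wf_part c \<and> (\<exists>s<height c. pfst m \<in> wf_stage c s \<and>
      psnd m \<notin> wf_stage c s)}"
    by (auto simp: in_wf_stage_iff_rank)
next
  fix m assume "m \<in> {m. psnd m \<in> wf_part c \<and> (\<exists>s<height c. pfst m \<in> wf_stage c s \<and>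
      psnd m \<notin> wf_stage c s)}"
  then obtain s where s: "psnd m \<in> wf_part c" "pfst m \<in> wf_stage c s" "psnd m \<notin> wf_stage c s" by blast
  then have "pfst m \<in> wf_part c" using wf_stage_subset_wf_part by blast
  then show "m \<in> rank_less c" using s unfolding rank_less_def
    by (auto simp: in_wf_stage_iff_rank not_less)
qed

lemma computable_rank_less: "computable rank_less"
proof -
  define G where "G c S = on_track 1 (track 1 S \<union> acc_step c (track 1 S))
    \<union> on_track 2 (track 2 S \<union> {m. pfst m \<in> track 1 S \<and> psnd m \<notin> track 1 S})" for c S
  let ?run = "\<lambda>c. iterate (G c) {}"
  have "computable (\<lambda>Z. G (track 1 Z) (track 2 Z))" unfolding G_def
    by (intro computable_rules computable_acc_step computable_Collect decidable_rules prim_rec_rules)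
  from computable_track[OF computable_iterate_height[OF computable_ident computable_empty this], of 2]
  have run: "computable (\<lambda>c. track 2 (?run c (height c)))" .
  have steps: "track 2 (?run c t) = (\<Union>s<t. {m. pfst m \<in> wf_stage c s \<and> psnd m \<notin> wf_stage c s})" for c t
  proof (rule increasing_union)
    have stage: "track 1 (?run c s) = wf_stage c s" for s unfolding wf_stage_def
      by (subst iterate_track[where G' = "\<lambda>W. W \<union> acc_step c W"]) (simp_all add: G_def)
    show "track 2 (?run c (succ s)) = track 2 (?run c s) \<union> {m. pfst m \<in> wf_stage c s \<and>
        psnd m \<notin> wf_stage c s}" for s
      unfolding stage[symmetric] by (simp add: G_def)
  qed (simp_all add: track_iterate_limit)
  have "rank_less = (\<lambda>c. {m. psnd m \<in> wf_part c \<and> m \<in> track 2 (?run c (height c))})"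
    unfolding steps by (rule ext) (auto simp: rank_less_eq)
  moreover have "computable (\<lambda>c. {m. psnd m \<in> wf_part c \<and> m \<in> track 2 (?run c (height c))})"
    by (intro computable_Collect decidable_rules computable_wf_part run prim_rec_rules)
  ultimately show ?thesis by simp
qed

definition zero_node :: "nat set \<Rightarrow> nat \<Rightarrow> bool" where
  "zero_node c b \<longleftrightarrow> b \<in> wf_part c \<and> rank c b = 0"

definition succ_node :: "nat set \<Rightarrow> nat \<Rightarrow> nat \<Rightarrow> bool" where
  "succ_node c a b \<longleftrightarrow> a \<in> wf_part c \<and> b \<in> wf_part c \<and> rank c b = succ (rank c a)"

definition limit_node :: "nat set \<Rightarrow> nat \<Rightarrow> bool" where
  "limit_node c b \<longleftrightarrow> b \<in> wf_part c \<and> is_limit (rank c b)"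

lemma zero_node_iff: "zero_node c b \<longleftrightarrow> b \<in> wf_part c \<and> (\<forall>a. pair a b \<notin> rank_less c)"
proof -
  have "rank c b = 0" if minimal: "b \<in> wf_part c" "\<forall>a. pair a b \<notin> rank_less c"
  proof (rule ccontr)
    assume "rank c b \<noteq> 0"
    then obtain a where "a \<in> wf_part c" "rank c a = 0"
      using ex_rank_eq_below[OF minimal(1), of 0] zero_less_time_iff by blast
    then show False using minimal \<open>rank c b \<noteq> 0\<close>
      unfolding in_rank_less zero_less_time_iff[symmetric] by metis
  qed
  then show ?thesis unfolding zero_node_def by (auto simp: in_rank_less not_less_zero_time)
qed

lemma succ_node_iff:
  "succ_node c a b \<longleftrightarrow> pair a b \<in> rank_less c \<and> (\<forall>d. pair a d \<in> rank_less c \<longrightarrow> pair d b \<notin> rank_less c)"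
proof
  assume "succ_node c a b"
  then show "pair a b \<in> rank_less c \<and> (\<forall>d. pair a d \<in> rank_less c \<longrightarrow> pair d b \<notin> rank_less c)"
    unfolding succ_node_def in_rank_less by (auto simp: less_succ_iff not_le)
next
  assume consecutive: "pair a b \<in> rank_less c \<and> (\<forall>d. pair a d \<in> rank_less c \<longrightarrow> pair d b \<notin> rank_less c)"
  then have ab: "a \<in> wf_part c" "b \<in> wf_part c" "rank c a < rank c b" unfolding in_rank_less by blast+
  have "\<not> succ (rank c a) < rank c b"
  proof
    assume "succ (rank c a) < rank c b"
    then obtain d where "d \<in> wf_part c" "rank c d = succ (rank c a)"
      using ex_rank_eq_below[OF ab(2)] by blast
    then show False using consecutive ab \<open>succ (rank c a) < rank c b\<close> less_succ
      unfolding in_rank_less by metis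
  qed
  moreover have "succ (rank c a) \<le> rank c b" using ab(3) by (simp add: succ_le_iff)
  ultimately show "succ_node c a b" unfolding succ_node_def using ab by simp
qed

lemma limit_node_iff:
  "limit_node c b \<longleftrightarrow> b \<in> wf_part c \<and> (\<exists>a. pair a b \<in> rank_less c) \<and>
     (\<forall>a. pair a b \<in> rank_less c \<longrightarrow> (\<exists>d. pair a d \<in> rank_less c \<and> pair d b \<in> rank_less c))"
proof
  assume "limit_node c b"
  then have b: "b \<in> wf_part c" and limit: "is_limit (rank c b)" unfolding limit_node_def by blast+
  have above: "\<exists>d. d \<in> wf_part c \<and> t < rank c d \<and> rank c d < rank c b" if "t < rank c b" for t
    using ex_rank_eq_below[OF b is_limit_succ_less[OF limit that]] less_succ is_limit_succ_less[OF limit that] by metis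
  then show "b \<in> wf_part c \<and> (\<exists>a. pair a b \<in> rank_less c) \<and>
      (\<forall>a. pair a b \<in> rank_less c \<longrightarrow> (\<exists>d. pair a d \<in> rank_less c \<and> pair d b \<in> rank_less c))"
    unfolding in_rank_less using b is_limit_pos[OF limit] by blast
next
  assume dense: "b \<in> wf_part c \<and> (\<exists>a. pair a b \<in> rank_less c) \<and>
     (\<forall>a. pair a b \<in> rank_less c \<longrightarrow> (\<exists>d. pair a d \<in> rank_less c \<and> pair d b \<in> rank_less c))"
  then obtain a where "rank c a < rank c b" unfolding in_rank_less by blast
  moreover have "\<exists>u<rank c b. t < u" if t: "t < rank c b" for t
  proof -
    obtain a where "a \<in> wf_part c" "rank c a = t" using ex_rank_eq_below dense t by blast
    then show ?thesis using dense t unfolding in_rank_less by blast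
  qed
  ultimately show "limit_node c b" unfolding limit_node_def using dense is_limitI by blast
qed

lemma decidable_zero_node: assumes "prim_rec f" shows "decidable (\<lambda>c n. zero_node c (f n))"
proof -
  have "decidable zero_node" unfolding zero_node_iff[abs_def]
    by (intro decidable_rules computable_wf_part computable_rank_less prim_rec_rules)
  from decidable_subst[OF this assms] show ?thesis .
qed

lemma decidable_succ_node: assumes "prim_rec f" "prim_rec g"
  shows "decidable (\<lambda>c n. succ_node c (f n) (g n))"
proof -
  have "decidable (\<lambda>c m. succ_node c (pfst m) (psnd m))" unfolding succ_node_iff
    by (intro decidable_rules computable_rank_less prim_rec_rules)
  from decidable_subst[OF this prim_rec_pair[OF assms]] show ?thesis by simp
qed

lemma decidable_limit_node: assumes "prim_rec f" shows "decidable (\<lambda>c n. limit_node c (f n))"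
proof -
  have "decidable limit_node" unfolding limit_node_iff[abs_def]
    by (intro decidable_rules computable_wf_part computable_rank_less prim_rec_rules)
  from decidable_subst[OF this assms] show ?thesis .
qed

text \<open>A function \<open>f\<close> on addresses codes a run of program \<open>r\<close> along the nodes of \<open>c\<close>: it gives the oracle, the local
  views and the tape cells.  At a limit node \<open>b\<close>, \<open>on_at a b k n\<close> is a node between \<open>a\<close> and \<open>b\<close> at which the cell is on,
  and \<open>off_at b k n\<close> a node from which on the cell is off.  These Skolem functions make the conditions closed; each
  involves only the values \<open>u\<close>, \<open>v\<close>, \<open>w\<close> of \<open>f\<close> at three addresses \<open>i\<close>, \<open>j\<close>, \<open>l\<close>.\<close>

abbreviation oracle_at :: "nat \<Rightarrow> nat" where "oracle_at m \<equiv> pair 0 m"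
abbreviation view_at :: "nat \<Rightarrow> nat" where "view_at b \<equiv> pair 1 b"
abbreviation cell_at :: "nat \<Rightarrow> nat \<Rightarrow> nat \<Rightarrow> nat" where "cell_at b k n \<equiv> pair 2 (pair b (pair k n))"
abbreviation on_at :: "nat \<Rightarrow> nat \<Rightarrow> nat \<Rightarrow> nat \<Rightarrow> nat"
    where "on_at a b k n \<equiv> pair 3 (pair a (pair b (pair k n)))"
abbreviation off_at :: "nat \<Rightarrow> nat \<Rightarrow> nat \<Rightarrow> nat" where "off_at b k n \<equiv> pair 4 (pair b (pair k n))"
abbreviation halting_at :: nat where "halting_at \<equiv> pair 5 0"

definition reads_correctly :: "nat set \<Rightarrow> nat \<Rightarrow> nat \<Rightarrow> nat \<Rightarrow> nat \<Rightarrow> bool" where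
  "reads_correctly c i j u v \<longleftrightarrow> (\<forall>b. b \<in> wf_part c \<and> i = view_at b \<longrightarrow> psnd (psnd u) div 2 ^ 4 = 0 \<and>
     (j = oracle_at (pfst (psnd u)) \<longrightarrow> (bit (psnd (psnd u)) 0 \<longleftrightarrow> v \<noteq> 0)) \<and>
     (\<forall>k<3. j = cell_at b k (pfst (psnd u)) \<longrightarrow> (bit (psnd (psnd u)) (Suc k) \<longleftrightarrow> v \<noteq> 0)))"

definition starts_correctly :: "nat set \<Rightarrow> nat \<Rightarrow> nat \<Rightarrow> bool" where
  "starts_correctly c i u \<longleftrightarrow> (\<forall>b. zero_node c b \<longrightarrow>
     (i = view_at b \<longrightarrow> pfst u = 0 \<and> pfst (psnd u) = 0) \<and> (\<forall>k n. i = cell_at b k n \<longrightarrow> u = 0))"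

definition steps_correctly :: "nat \<Rightarrow> nat set \<Rightarrow> nat \<Rightarrow> nat \<Rightarrow> nat \<Rightarrow> nat \<Rightarrow> nat \<Rightarrow> nat \<Rightarrow> bool" where
  "steps_correctly r c i j l u v w \<longleftrightarrow> (\<forall>a b. succ_node c a b \<and> i = view_at a \<longrightarrow>
     (j = view_at b \<longrightarrow> pfst v = next_st r u \<and> pfst (psnd v) = next_hd r u) \<and>
     (\<forall>k n. j = cell_at b k n \<and> l = cell_at a k n \<longrightarrow> (v \<noteq> 0 \<longleftrightarrow> next_cell r u k n (w \<noteq> 0))))"

definition limits_correctly :: "nat set \<Rightarrow> nat \<Rightarrow> nat \<Rightarrow> nat \<Rightarrow> nat \<Rightarrow> nat \<Rightarrow> nat \<Rightarrow> bool" where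
  "limits_correctly c i j l u v w \<longleftrightarrow> (\<forall>b. limit_node c b \<longrightarrow>
     (i = view_at b \<longrightarrow> pfst u = 2 \<and> pfst (psnd u) = 0) \<and>
     (\<forall>k n. i = cell_at b k n \<longrightarrow>
       (\<forall>a. u \<noteq> 0 \<and> pair a b \<in> rank_less c \<and> j = on_at a b k n \<longrightarrow>
         pair v a \<notin> rank_less c \<and> pair v b \<in> rank_less c \<and> (l = cell_at v k n \<longrightarrow> w \<noteq> 0)) \<and>
       (u = 0 \<and> j = off_at b k n \<longrightarrow> pair v b \<in> rank_less c \<and>
         (\<forall>d. pair d v \<notin> rank_less c \<and> pair d b \<in> rank_less c \<and> l = cell_at d k n \<longrightarrow> w = 0))))"

definition accepts :: "nat set \<Rightarrow> nat \<Rightarrow> nat \<Rightarrow> nat \<Rightarrow> nat \<Rightarrow> bool" where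
  "accepts c i j u v \<longleftrightarrow> (i = halting_at \<longrightarrow> u \<in> wf_part c \<and> (j = view_at u \<longrightarrow> pfst v = 1) \<and>
     (j = cell_at u 2 0 \<longrightarrow> v \<noteq> 0) \<and> (\<forall>a. pair a u \<in> rank_less c \<and> j = view_at a \<longrightarrow> pfst v \<noteq> 1))"

definition locally_correct :: "nat \<Rightarrow> nat set \<Rightarrow> nat \<Rightarrow> nat \<Rightarrow> nat \<Rightarrow> nat \<Rightarrow> nat \<Rightarrow> nat \<Rightarrow> bool" where
  "locally_correct r c i j l u v w \<longleftrightarrow> reads_correctly c i j u v \<and> starts_correctly c i u \<and>
     steps_correctly r c i j l u v w \<and> limits_correctly c i j l u v w \<and> accepts c i j u v"

lemma decidable_locally_correct:
  assumes "prim_rec i" "prim_rec j" "prim_rec l" "prim_rec u" "prim_rec v" "prim_rec w"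
  shows "decidable (\<lambda>c n. locally_correct r c (i n) (j n) (l n) (u n) (v n) (w n))"
proof -
  have "decidable (\<lambda>c m. locally_correct r c (pfst m) (pfst (psnd m)) (pfst (psnd (psnd m)))
      (pfst (psnd (psnd (psnd m)))) (pfst (psnd (psnd (psnd (psnd m))))) (psnd (psnd (psnd (psnd (psnd m))))))"
    unfolding locally_correct_def reads_correctly_def starts_correctly_def steps_correctly_def limits_correctly_def accepts_def
    by (intro decidable_zero_node decidable_succ_node decidable_limit_node decidable_next_cell decidable_rules
        computable_wf_part computable_rank_less prim_rec_next_st prim_rec_next_hd prim_rec_div_power2 prim_rec_rules)
  from decidable_subst[OF this, of "\<lambda>n. pair (i n) (pair (j n) (pair (l n) (pair (u n) (pair (v n) (w n)))))"]
  show ?thesis by (simp add: prim_rec_rules assms)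
qed

definition coded_run :: "nat \<Rightarrow> nat set \<Rightarrow> (nat \<Rightarrow> nat) \<Rightarrow> bool" where
  "coded_run r c f \<longleftrightarrow> (\<forall>i j l. locally_correct r c i j l (f i) (f j) (f l))"

definition coded_oracle :: "(nat \<Rightarrow> nat) \<Rightarrow> nat set" where "coded_oracle f = {m. f (oracle_at m) \<noteq> 0}"

locale accepting_code =
  fixes r :: nat and c :: "nat set" and f :: "nat \<Rightarrow> nat"
  assumes coded_run: "coded_run r c f"
begin

abbreviation C :: "time \<Rightarrow> cfg" where "C \<equiv> config (P r) (coded_oracle f) {}"

lemma local_conditions:
  "reads_correctly c i j (f i) (f j)" "starts_correctly c i (f i)"
    "steps_correctly r c i j l (f i) (f j) (f l)"
  "limits_correctly c i j l (f i) (f j) (f l)" "accepts c i j (f i) (f j)"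
  using coded_run unfolding coded_run_def locally_correct_def by blast+

definition shows_config :: "nat \<Rightarrow> cfg \<Rightarrow> bool" where
  "shows_config b D \<longleftrightarrow> f (view_at b) = local_view (coded_oracle f) D \<and>
    (\<forall>k n. f (cell_at b k n) \<noteq> 0 \<longleftrightarrow> tape_cell D k n)"

lemma shows_configI:
  assumes "b \<in> wf_part c" and view: "pfst (f (view_at b)) = st D"
    "pfst (psnd (f (view_at b))) = cfg.hd D"
    and cell: "\<And>k n. f (cell_at b k n) \<noteq> 0 \<longleftrightarrow> tape_cell D k n"
  shows "shows_config b D"
proof -
  let ?h = "cfg.hd D" and ?symbols = "psnd (psnd (f (view_at b)))"
  have bits: "?symbols div 2 ^ 4 = 0" "bit ?symbols 0 \<longleftrightarrow> f (oracle_at ?h) \<noteq> 0"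
    "k < 3 \<Longrightarrow> bit ?symbols (Suc k) \<longleftrightarrow> f (cell_at b k ?h) \<noteq> 0" for k
    using local_conditions(1)[of "view_at b"] assms(1) unfolding reads_correctly_def view(2) by blast+
  have "?symbols = readcode (coded_oracle f) D"
    unfolding readcode_eq_bits_code eq_bits_code_iff coded_oracle_def mem_Collect_eq
    using bits(1,2) bits(3)[of 0] bits(3)[of 1] bits(3)[of 2] unfolding cell
    by (simp add: tape_cell_def numeral_2_eq_2 numeral_3_eq_3)
  then have "f (view_at b) = local_view (coded_oracle f) D"
    unfolding local_view_def view[symmetric] by (metis pair_collapse)
  then show ?thesis unfolding shows_config_def using cell by blast
qed

lemma zero_node_shows_config:
  assumes "zero_node c b"
  shows "shows_config b (C (rank c b))"
proof (rule shows_configI)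
  have init: "C (rank c b) = init_cfg {}" using assms unfolding zero_node_def by simp
  show "pfst (f (view_at b)) = st (C (rank c b))" "pfst (psnd (f (view_at b))) = cfg.hd (C (rank c b))"
    using local_conditions(2)[of "view_at b"] assms unfolding init starts_correctly_def
    by (auto simp: init_cfg_def)
  show "f (cell_at b k n) \<noteq> 0 \<longleftrightarrow> tape_cell (C (rank c b)) k n" for k n
    using local_conditions(2)[of "cell_at b k n"] assms unfolding init starts_correctly_def
    by (auto simp: init_cfg_def tape_cell_def)
qed (use assms in \<open>simp add: zero_node_def\<close>)

lemma succ_node_shows_config:
  assumes "succ_node c a b" "shows_config a (C (rank c a))"
  shows "shows_config b (C (rank c b))"
proof (rule shows_configI)
  let ?D = "C (rank c a)"
  have step: "C (rank c b) = step (P r) (coded_oracle f) ?D" using assms(1) unfolding succ_node_def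
    by simp
  have a: "f (view_at a) = local_view (coded_oracle f) ?D"
    "f (cell_at a k n) \<noteq> 0 \<longleftrightarrow> tape_cell ?D k n" for k n
    using assms(2) unfolding shows_config_def by blast+
  show "pfst (f (view_at b)) = st (C (rank c b))" "pfst (psnd (f (view_at b))) = cfg.hd (C (rank c b))"
    using local_conditions(3)[of "view_at a" "view_at b"] assms(1)
    unfolding steps_correctly_def step st_step_P hd_step_P a(1)[symmetric] by blast+
  show "f (cell_at b k n) \<noteq> 0 \<longleftrightarrow> tape_cell (C (rank c b)) k n" for k n
    using local_conditions(3)[of "view_at a" "cell_at b k n" "cell_at a k n"] assms(1)
    unfolding steps_correctly_def step tape_cell_step_P a[symmetric] by blast
qed (use assms in \<open>simp add: succ_node_def\<close>)

lemma limit_node_cell: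
  assumes b: "limit_node c b" and below: "\<And>d. pair d b \<in> rank_less c \<Longrightarrow> shows_config d (C (rank c d))"
  shows "f (cell_at b k n) \<noteq> 0 \<longleftrightarrow> tape_cell (C (rank c b)) k n"
proof -
  have limit: "is_limit (rank c b)" and b_wf: "b \<in> wf_part c" using b unfolding limit_node_def by blast+
  have cell: "f (cell_at d k n) \<noteq> 0 \<longleftrightarrow> n \<in> Collect (tape_cell (C (rank c d)) k)"
      if "pair d b \<in> rank_less c" for d
    using below[OF that] unfolding shows_config_def by blast
  have "n \<in> limsup (\<lambda>t. Collect (tape_cell (C t) k)) (rank c b)" if on: "f (cell_at b k n) \<noteq> 0"
  proof (rule in_limsupI)
    fix t assume "t < rank c b"
    then obtain a where a: "rank c a = t" "pair a b \<in> rank_less c"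
      using ex_rank_eq_below[OF b_wf] b_wf unfolding in_rank_less by blast
    define d where "d = f (on_at a b k n)"
    have "pair d a \<notin> rank_less c" "pair d b \<in> rank_less c" "f (cell_at d k n) \<noteq> 0"
      using local_conditions(4)[of "cell_at b k n" "on_at a b k n" "cell_at d k n"] b on a(2)
      unfolding limits_correctly_def d_def by blast+
    then show "\<exists>s. t \<le> s \<and> s < rank c b \<and> n \<in> Collect (tape_cell (C s) k)"
      using cell[of d] a by (intro exI[of _ "rank c d"]) (auto simp: in_rank_less not_less)
  qed
  moreover have "n \<notin> limsup (\<lambda>t. Collect (tape_cell (C t) k)) (rank c b)" if off: "f (cell_at b k n) = 0"
  proof
    define a where "a = f (off_at b k n)"
    have a: "pair a b \<in> rank_less c"
      using local_conditions(4)[of "cell_at b k n" "off_at b k n"] b off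
      unfolding limits_correctly_def a_def by blast
    have off_above: "f (cell_at d k n) = 0" if "pair d a \<notin> rank_less c" "pair d b \<in> rank_less c" for d
      using local_conditions(4)[of "cell_at b k n" "off_at b k n" "cell_at d k n"] b off that
      unfolding limits_correctly_def a_def by blast
    assume on: "n \<in> limsup (\<lambda>t. Collect (tape_cell (C t) k)) (rank c b)"
    have "rank c a < rank c b" using a unfolding in_rank_less by blast
    with on obtain t where t: "rank c a \<le> t" "t < rank c b" "n \<in> Collect (tape_cell (C t) k)"
      by (rule in_limsupD)
    then obtain d where d: "rank c d = t" "pair d b \<in> rank_less c"
      using ex_rank_eq_below[OF b_wf] b_wf unfolding in_rank_less by blast
    then have "f (cell_at d k n) = 0" using t(1) by (intro off_above) (auto simp: in_rank_less)
    then show False using cell[OF d(2)] t(3) d(1) by simp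
  qed
  ultimately show ?thesis unfolding config_limit[OF limit] tape_cell_cfg_limsup[OF limit] by blast
qed

theorem coded_run_sound: "b \<in> wf_part c \<Longrightarrow> shows_config b (C (rank c b))"
proof (induction "rank c b" arbitrary: b rule: less_induct)
  case (less b)
  show ?case
  proof (cases "rank c b" rule: time_cases)
    case zero
    then show ?thesis using less.prems by (intro zero_node_shows_config) (simp add: zero_node_def)
  next
    case (succ t)
    then have "t < rank c b" by simp
    then obtain a where "a \<in> wf_part c" "rank c a = t" using ex_rank_eq_below[OF less.prems] by blast
    then have "succ_node c a b" "shows_config a (C (rank c a))"
      using less.hyps[of a] less.prems succ by (simp_all add: succ_node_def)
    then show ?thesis by (rule succ_node_shows_config)
  next
    case limit
    then have b: "limit_node c b" using less.prems unfolding limit_node_def by blast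
    show ?thesis
    proof (rule shows_configI[OF less.prems _ _ limit_node_cell[OF b]])
      show "pfst (f (view_at b)) = st (C (rank c b))"
        "pfst (psnd (f (view_at b))) = cfg.hd (C (rank c b))"
        using local_conditions(4)[of "view_at b"] b
        unfolding limits_correctly_def config_limit_sel(1,2)[OF limit] by blast+
      show "shows_config d (C (rank c d))" if "pair d b \<in> rank_less c" for d using less.hyps that
        unfolding in_rank_less by blast
    qed
  qed
qed

lemma accepted: "\<exists>w. halts_with (P r) (coded_oracle f) {} w \<and> 0 \<in> w"
proof -
  define b where "b = f halting_at"
  have halting: "accepts c halting_at j b (f j)" for j unfolding b_def by (rule local_conditions(5))
  then have b: "b \<in> wf_part c" unfolding accepts_def by blast
  note shown = coded_run_sound[unfolded shows_config_def local_view_def]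
  have "st (C (rank c b)) = 1" "tout (C (rank c b)) 0"
    using halting[of "view_at b"] halting[of "cell_at b 2 0"] shown[OF b] unfolding accepts_def
    by (auto simp: tape_cell_def)
  moreover have "st (C u) \<noteq> 1" if u: "u < rank c b" for u
  proof -
    obtain a where a: "a \<in> wf_part c" "rank c a = u" using ex_rank_eq_below[OF b u] by blast
    then have "pfst (f (view_at a)) \<noteq> 1" using halting[of "view_at a"] u b
      unfolding accepts_def in_rank_less by blast
    then show ?thesis using shown[OF a(1)] a(2) by simp
  qed
  ultimately show ?thesis unfolding halts_with_iff halts_at_def by blast
qed

end

lemma coded_runI:
  fixes r x c f
  defines "D b \<equiv> config (P r) x {} (rank c b)"
  assumes oracle_bit: "\<And>m. f (oracle_at m) \<noteq> 0 \<longleftrightarrow> m \<in> x"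
    and view: "\<And>b. f (view_at b) = local_view x (D b)"
    and cell: "\<And>b k n. f (cell_at b k n) \<noteq> 0 \<longleftrightarrow> tape_cell (D b) k n"
    and on_node: "\<And>a b k n. limit_node c b \<Longrightarrow> tape_cell (D b) k n \<Longrightarrow> pair a b \<in> rank_less c \<Longrightarrow>
      pair (f (on_at a b k n)) a \<notin> rank_less c \<and> pair (f (on_at a b k n)) b \<in> rank_less c \<and> tape_cell (D (f (on_at a b k n))) k n"
    and off_node: "\<And>b k n. limit_node c b \<Longrightarrow> \<not> tape_cell (D b) k n \<Longrightarrow> pair (f (off_at b k n)) b \<in> rank_less c \<and>
      (\<forall>d. pair d (f (off_at b k n)) \<notin> rank_less c \<and> pair d b \<in> rank_less c \<longrightarrow> \<not> tape_cell (D d) k n)"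
    and halting: "f halting_at \<in> wf_part c" "st (D (f halting_at)) = 1" "tout (D (f halting_at)) 0"
      "\<And>a. pair a (f halting_at) \<in> rank_less c \<Longrightarrow> st (D a) \<noteq> 1"
  shows "coded_run r c f"
proof -
  have zero_iff: "f (oracle_at m) = 0 \<longleftrightarrow> m \<notin> x" "f (cell_at b k n) = 0 \<longleftrightarrow> \<not> tape_cell (D b) k n"
      for m b k n
    using oracle_bit cell by blast+
  have "reads_correctly c i j (f i) (f j)" for i j
  proof -
    have "bit (readcode x C) (Suc k) \<longleftrightarrow> tape_cell C k (cfg.hd C)" if "k < 3" for k C
    proof -
      consider "k = 0" | "k = 1" | "k = 2" using \<open>k < 3\<close> by linarith
      then show ?thesis
        by cases (simp_all add: readcode_eq_bits_code tape_cell_def numeral_2_eq_2[symmetric])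
    qed
    moreover have "readcode x C div 2 ^ 4 = 0" "bit (readcode x C) 0 \<longleftrightarrow> cfg.hd C \<in> x" for C
      using eq_bits_code_iff[of "readcode x C"] readcode_eq_bits_code[of x C] by blast+
    ultimately show ?thesis
      unfolding reads_correctly_def
      by (auto simp: view local_view_def zero_iff simp del: One_nat_def neq0_conv)
  qed
  moreover have "starts_correctly c i (f i)" for i
    unfolding starts_correctly_def
    by (auto simp: zero_iff view local_view_def zero_node_def D_def init_cfg_def tape_cell_def simp del: One_nat_def neq0_conv)
  moreover have "steps_correctly r c i j l (f i) (f j) (f l)" for i j l
  proof -
    have "D b = step (P r) x (D a)" if "succ_node c a b" for a b using that
      unfolding succ_node_def D_def by simp
    then have "st (D b) = next_st r (local_view x (D a))" "cfg.hd (D b) = next_hd r (local_view x (D a))"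
      "tape_cell (D b) k n \<longleftrightarrow> next_cell r (local_view x (D a)) k n (tape_cell (D a) k n)"
          if "succ_node c a b" for a b k n
      using that by (simp_all add: st_step_P hd_step_P tape_cell_step_P)
    then show ?thesis unfolding steps_correctly_def
      by (auto simp: view local_view_def[of x "D _"] zero_iff simp del: One_nat_def neq0_conv)
  qed
  moreover have "limits_correctly c i j l (f i) (f j) (f l)" for i j l
  proof -
    have "st (D b) = 2" "cfg.hd (D b) = 0" if "limit_node c b" for b
      using that unfolding limit_node_def D_def by (simp_all add: config_limit_sel)
    then show ?thesis unfolding limits_correctly_def using on_node off_node
      by (auto simp: view local_view_def zero_iff simp del: One_nat_def neq0_conv)
  qed
  moreover have "accepts c i j (f i) (f j)" for i j
    unfolding accepts_def using halting
    by (auto simp: view local_view_def zero_iff tape_cell_def simp del: One_nat_def neq0_conv)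
  ultimately show ?thesis unfolding coded_run_def locally_correct_def by blast
qed

lemma ex_function_on_addresses:
  "\<exists>f. (\<forall>m. f (oracle_at m) = A m) \<and> (\<forall>b. f (view_at b) = B b) \<and> (\<forall>b k n. f (cell_at b k n) = E b k n) \<and>
     (\<forall>a b k n. f (on_at a b k n) = F a b k n) \<and> (\<forall>b k n. f (off_at b k n) = G b k n) \<and> f halting_at = h"
  by (rule exI[of _ "\<lambda>m. let a = psnd m in if pfst m = 0 then A a else if pfst m = 1 then B a
      else if pfst m = 2 then E (pfst a) (pfst (psnd a)) (psnd (psnd a))
      else if pfst m = 3 then F (pfst a) (pfst (psnd a)) (pfst (psnd (psnd a))) (psnd (psnd (psnd a)))
      else if pfst m = 4 then G (pfst a) (pfst (psnd a)) (psnd (psnd a)) else h"]) simp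

lemma limit_node_witnesses:
  assumes "limit_node c b"
  shows "tape_cell (config p y {} (rank c b)) k n \<Longrightarrow> pair a b \<in> rank_less c \<Longrightarrow>
      \<exists>d. pair d a \<notin> rank_less c \<and> pair d b \<in> rank_less c \<and> tape_cell (config p y {} (rank c d)) k n"
    and "\<not> tape_cell (config p y {} (rank c b)) k n \<Longrightarrow> \<exists>a. pair a b \<in> rank_less c \<and>
      (\<forall>d. pair d a \<notin> rank_less c \<and> pair d b \<in> rank_less c \<longrightarrow> \<not> tape_cell (config p y {} (rank c d)) k n)"
proof -
  let ?C = "config p y {}"
  have b: "b \<in> wf_part c" and limit: "is_limit (rank c b)" using assms unfolding limit_node_def by blast+
  have cell: "tape_cell (?C (rank c b)) k n \<longleftrightarrow> n \<in> limsup (\<lambda>d. Collect (tape_cell (?C d) k)) (rank c b)"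
    unfolding config_limit[OF limit] tape_cell_cfg_limsup[OF limit] ..
  show "\<exists>d. pair d a \<notin> rank_less c \<and> pair d b \<in> rank_less c \<and> tape_cell (?C (rank c d)) k n"
    if lit: "tape_cell (?C (rank c b)) k n" and ab: "pair a b \<in> rank_less c"
  proof -
    have "rank c a < rank c b" using ab unfolding in_rank_less by blast
    with lit[unfolded cell] obtain s where s: "rank c a \<le> s" "s < rank c b"
      "n \<in> Collect (tape_cell (?C s) k)"
      by (rule in_limsupD)
    then obtain d where "d \<in> wf_part c" "rank c d = s" using ex_rank_eq_below[OF b] by blast
    then show ?thesis using s b by (intro exI[of _ d]) (simp add: in_rank_less not_less)
  qed
  show "\<exists>a. pair a b \<in> rank_less c \<and> (\<forall>d. pair d a \<notin> rank_less c \<and> pair d b \<in> rank_less c \<longrightarrow>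
      \<not> tape_cell (?C (rank c d)) k n)"
    if unlit: "\<not> tape_cell (?C (rank c b)) k n"
  proof -
    obtain s where s: "s < rank c b" "\<And>d. s \<le> d \<Longrightarrow> d < rank c b \<Longrightarrow> \<not> tape_cell (?C d) k n"
      using unlit unfolding cell limsup_def by auto
    then obtain a where "a \<in> wf_part c" "rank c a = s" using ex_rank_eq_below[OF b] by blast
    then show ?thesis using s b by (intro exI[of _ a]) (auto simp: in_rank_less not_less)
  qed
qed

theorem coded_run_complete:
  assumes "halts_at (P r) x {} t" "tout (config (P r) x {} t) 0" "t < height c"
  obtains f where "coded_run r c f" "coded_oracle f = x"
proof -
  let ?D = "\<lambda>b. config (P r) x {} (rank c b)"
  obtain h where h: "h \<in> wf_part c" "rank c h = t" using ex_rank_eq[OF assms(3)] by blast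
  define on_node where "on_node a b k n =
    (SOME d. pair d a \<notin> rank_less c \<and> pair d b \<in> rank_less c \<and> tape_cell (?D d) k n)" for a b k n
  define off_node where "off_node b k n = (SOME a. pair a b \<in> rank_less c \<and>
    (\<forall>d. pair d a \<notin> rank_less c \<and> pair d b \<in> rank_less c \<longrightarrow> \<not> tape_cell (?D d) k n))" for b k n
  have on_node: "pair (on_node a b k n) a \<notin> rank_less c \<and> pair (on_node a b k n) b \<in> rank_less c \<and>
      tape_cell (?D (on_node a b k n)) k n"
    if "limit_node c b" "tape_cell (?D b) k n" "pair a b \<in> rank_less c" for a b k n
    unfolding on_node_def by (rule someI_ex[OF limit_node_witnesses(1)[OF that]])
  have off_node: "pair (off_node b k n) b \<in> rank_less c \<and>
      (\<forall>d. pair d (off_node b k n) \<notin> rank_less c \<and> pair d b \<in> rank_less c \<longrightarrow> \<not> tape_cell (?D d) k n)"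
    if "limit_node c b" "\<not> tape_cell (?D b) k n" for b k n
    unfolding off_node_def by (rule someI_ex[OF limit_node_witnesses(2)[OF that]])
  obtain f where f: "\<And>m. f (oracle_at m) = of_bool (m \<in> x)" "\<And>b. f (view_at b) = local_view x (?D b)"
    "\<And>b k n. f (cell_at b k n) = of_bool (tape_cell (?D b) k n)"
      "\<And>a b k n. f (on_at a b k n) = on_node a b k n"
    "\<And>b k n. f (off_at b k n) = off_node b k n" "f halting_at = h"
    using ex_function_on_addresses[of "\<lambda>m. of_bool (m \<in> x)" "\<lambda>b. local_view x (?D b)"
        "\<lambda>b k n. of_bool (tape_cell (?D b) k n)" on_node off_node h] by auto
  have "coded_run r c f"
  proof (rule coded_runI[where x = x])
    show "st (?D a) \<noteq> 1" if "pair a (f halting_at) \<in> rank_less c" for a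
      using that assms(1) h(2) unfolding f(6) in_rank_less halts_at_def by auto
    show "f halting_at \<in> wf_part c" "st (?D (f halting_at)) = 1" "tout (?D (f halting_at)) 0"
      using assms(1,2) h unfolding f(6) halts_at_def by simp_all
    show "f (view_at b) = local_view x (?D b)" for b by (rule f(2))
  qed (simp_all add: f(1,3), unfold f(4,5), (erule on_node off_node; assumption)+)
  moreover have "coded_oracle f = x" unfolding coded_oracle_def f(1) by simp
  ultimately show ?thesis by (rule that)
qed

section \<open>Finding the certified oracle\<close>

lemma notin_wf_part_iff: "b \<notin> wf_part c \<longleftrightarrow> (\<exists>S. S 0 = b \<and> (\<forall>n. pair (S (Suc n)) (S n) \<in> c))"
proof
  assume "b \<notin> wf_part c"
  have "\<exists>a. pair a d \<in> c \<and> a \<notin> wf_part c" if "d \<notin> wf_part c" for d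
    using that height_le_iff_acc_step[of c "height c"]
    unfolding wf_stage_height in_acc_step[symmetric] by (auto simp: in_acc_step)
  then have "\<exists>S. \<forall>n. (S n \<notin> wf_part c \<and> (n = 0 \<longrightarrow> S n = b)) \<and> pair (S (Suc n)) (S n) \<in> c"
    using dependent_nat_choice[of "\<lambda>n d. d \<notin> wf_part c \<and>
        (n = 0 \<longrightarrow> d = b)" "\<lambda>n d a. pair a d \<in> c"] \<open>b \<notin> wf_part c\<close> by auto
  then show "\<exists>S. S 0 = b \<and> (\<forall>n. pair (S (Suc n)) (S n) \<in> c)" by blast
next
  assume "\<exists>S. S 0 = b \<and> (\<forall>n. pair (S (Suc n)) (S n) \<in> c)"
  then obtain S where S: "S 0 = b" "\<And>n. pair (S (Suc n)) (S n) \<in> c" by blast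
  have "S n \<notin> wf_stage c t" for n t
  proof (induction t arbitrary: n rule: less_induct)
    case (less t)
    then show ?case using S(2) unfolding in_wf_stage[of _ c t] in_acc_step by blast
  qed
  then show "b \<notin> wf_part c" using S(1) unfolding wf_part_def by blast
qed

definition entry :: "nat \<Rightarrow> nat \<Rightarrow> nat" where
  "entry s i = (if i < length (list_decode s) then list_decode s ! i else 0)"

definition extends :: "nat \<Rightarrow> nat \<Rightarrow> bool" where
  "extends s s' \<longleftrightarrow> length (list_decode s) < length (list_decode s') \<and>
    (\<forall>i<length (list_decode s). entry s i = entry s' i)"

definition extension_rel :: "nat set \<Rightarrow> nat set" where
  "extension_rel T = {k. pfst k \<in> T \<and> extends (psnd k) (pfst k)}"

abbreviation initial_segment :: "(nat \<Rightarrow> nat) \<Rightarrow> nat \<Rightarrow> nat" where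
  "initial_segment f n \<equiv> list_encode (map f [0..<n])"

lemma list_decode_funpow_tail: "list_decode (((\<lambda>n. psnd (n - 1)) ^^ i) s) = drop i (list_decode s)"
proof (induction i)
  case (Suc i)
  have tail: "list_decode (psnd (n - 1)) = drop 1 (list_decode n)" for n
    by (cases n) (simp_all add: list_decode_Suc del: list_decode.simps(2))
  show ?case unfolding funpow.simps comp_apply tail Suc by simp
qed simp

lemma list_decode_eq_Nil_iff: "list_decode s = [] \<longleftrightarrow> s = 0"
  by (cases s) (simp_all add: list_decode_Suc del: list_decode.simps(2))

lemma less_length_list_decode_iff: "i < length (list_decode s) \<longleftrightarrow> ((\<lambda>n. psnd (n - 1)) ^^ i) s \<noteq> 0"
  unfolding list_decode_eq_Nil_iff[symmetric] list_decode_funpow_tail by (simp add: not_le)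

lemma entry_eq_funpow: "entry s i = pfst (((\<lambda>n. psnd (n - 1)) ^^ i) s - 1)"
proof (cases "((\<lambda>n. psnd (n - 1)) ^^ i) s")
  case (Suc k)
  then have "drop i (list_decode s) = pfst k # list_decode (psnd k)"
    unfolding list_decode_funpow_tail[symmetric] by (simp only: list_decode_Suc)
  moreover have "i < length (list_decode s)" unfolding less_length_list_decode_iff Suc by simp
  ultimately have "list_decode s ! i = pfst k" by (metis hd_drop_conv_nth list.sel(1))
  then show ?thesis using \<open>i < length (list_decode s)\<close> Suc by (simp add: entry_def)
qed (simp add: entry_def less_length_list_decode_iff)

lemma decidable_less_length: "prim_rec f \<Longrightarrow> prim_rec g \<Longrightarrow>
    decidable (\<lambda>X n. f n < length (list_decode (g n)))"
  unfolding less_length_list_decode_iff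
  by (intro decidable_not decidable_eq prim_rec_funpow prim_rec_rules)

lemma prim_rec_entry: "prim_rec f \<Longrightarrow> prim_rec g \<Longrightarrow> prim_rec (\<lambda>n. entry (f n) (g n))"
  unfolding entry_eq_funpow by (intro prim_rec_funpow prim_rec_rules)

lemma initial_segment_notin_wf_part:
  assumes "\<And>n. initial_segment f n \<in> T"
  shows "initial_segment f n \<notin> wf_part (extension_rel T)"
proof -
  have "pair (initial_segment f (Suc m)) (initial_segment f m) \<in> extension_rel T" for m
    unfolding extension_rel_def extends_def using assms by (auto simp: entry_def simp del: upt_Suc)
  then show ?thesis unfolding notin_wf_part_iff by (intro exI[of _ "\<lambda>m. initial_segment f (n + m)"]) simp
qed

lemma ex_branch:
  assumes "s \<in> T" "s \<notin> wf_part (extension_rel T)"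
  obtains f where "\<And>i. i < length (list_decode s) \<Longrightarrow> f i = entry s i"
    "\<And>n. \<exists>s'\<in>T. n \<le> length (list_decode s') \<and> (\<forall>i<length (list_decode s'). entry s' i = f i)"
proof -
  obtain S where S: "S 0 = s" "\<And>n. pair (S (Suc n)) (S n) \<in> extension_rel T"
    using assms(2) unfolding notin_wf_part_iff by blast
  have ext: "extends (S n) (S (Suc n))" for n using S(2)[of n] unfolding extension_rel_def by simp
  have S_T: "S n \<in> T" for n using S assms(1) unfolding extension_rel_def by (cases n) auto
  have len: "n \<le> length (list_decode (S n))" for n
  proof (induction n)
    case (Suc n)
    then show ?case using ext[of n] unfolding extends_def by simp
  qed simp
  have stable: "i < length (list_decode (S n)) \<Longrightarrow>
      i < length (list_decode (S (n + k))) \<and> entry (S (n + k)) i = entry (S n) i" for i n k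
  proof (induction k)
    case (Suc k)
    then show ?case using ext[of "n + k"] unfolding extends_def by auto
  qed simp
  define f where "f i = entry (S (Suc i)) i" for i
  have f: "entry (S n) i = f i" if i: "i < length (list_decode (S n))" for n i
  proof (cases "n \<le> Suc i")
    case True
    then show ?thesis using stable[OF i, of "Suc i - n"] unfolding f_def by simp
  next
    case False
    then show ?thesis using stable[of i "Suc i" "n - Suc i"] len[of "Suc i"] unfolding f_def by simp
  qed
  show ?thesis by (rule that[of f]) (use f S(1) S_T len in \<open>metis+\<close>)
qed

definition partial_runs :: "nat \<Rightarrow> nat set \<Rightarrow> nat set" where
  "partial_runs r c = {s. \<forall>i j l. i < length (list_decode s) \<and> j < length (list_decode s) \<and> l < length (list_decode s) \<longrightarrow>
     locally_correct r c i j l (entry s i) (entry s j) (entry s l)}"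

text \<open>The oracle bits given by the partial runs that lie on a branch, i.e. on a coded run.\<close>

definition certified_oracle :: "nat \<Rightarrow> nat set \<Rightarrow> nat set" where
  "certified_oracle r c =
    {m. \<exists>s. s \<in> partial_runs r c \<and> s \<notin> wf_part (extension_rel (partial_runs r c)) \<and> entry s (oracle_at m) \<noteq> 0}"

lemma computable_certified_oracle: "computable (certified_oracle r)"
proof -
  have runs: "computable (partial_runs r)" unfolding partial_runs_def[abs_def]
    by (intro computable_Collect decidable_locally_correct decidable_less_length decidable_rules prim_rec_entry prim_rec_rules)
  have "length (list_decode s) < length (list_decode s') \<longleftrightarrow>
      (\<exists>i. i < length (list_decode s') \<and> \<not> i < length (list_decode s))" for s s'
    by (auto simp: not_less dest: le_less_trans)
  then have "computable (\<lambda>c. extension_rel (partial_runs r c))" unfolding extension_rel_def extends_def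
    by (simp only:)
       (intro computable_Collect decidable_less_length decidable_rules runs prim_rec_entry prim_rec_rules)
  then show ?thesis unfolding certified_oracle_def[abs_def]
    by (intro computable_Collect decidable_rules runs computable_compose[OF _ computable_wf_part] prim_rec_entry prim_rec_rules)
qed

lemma certified_oracle_subset:
  assumes "\<And>z w. halts_with (P r) z {} w \<Longrightarrow> 0 \<in> w \<Longrightarrow> z = x"
  shows "certified_oracle r c \<subseteq> x"
proof
  fix m assume "m \<in> certified_oracle r c"
  then obtain s where s: "s \<in> partial_runs r c" "s \<notin> wf_part (extension_rel (partial_runs r c))"
    "entry s (oracle_at m) \<noteq> 0"
    unfolding certified_oracle_def by blast
  obtain f where f: "\<And>i. i < length (list_decode s) \<Longrightarrow> f i = entry s i"
    "\<And>n. \<exists>s'\<in>partial_runs r c. n \<le> length (list_decode s') \<and>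
      (\<forall>i<length (list_decode s'). entry s' i = f i)"
    using ex_branch[OF s(1,2)] by metis
  have "locally_correct r c i j l (f i) (f j) (f l)" for i j l
  proof -
    obtain s' where s': "s' \<in> partial_runs r c" "Suc (i + j + l) \<le> length (list_decode s')"
      "\<forall>i<length (list_decode s'). entry s' i = f i" using f(2) by blast
    then have "locally_correct r c i j l (entry s' i) (entry s' j) (entry s' l)"
      unfolding partial_runs_def by simp
    then show ?thesis using s'(2,3) by simp
  qed
  then interpret accepting_code r c f by unfold_locales (simp add: coded_run_def)
  have "coded_oracle f = x" using accepted assms by blast
  moreover have "f (oracle_at m) \<noteq> 0" using f(1)[of "oracle_at m"] s(3) unfolding entry_def
    by (auto split: if_splits)
  ultimately show "m \<in> x" unfolding coded_oracle_def by blast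
qed

lemma subset_certified_oracle:
  assumes "halts_at (P r) x {} t" "tout (config (P r) x {} t) 0" "t < height c"
  shows "x \<subseteq> certified_oracle r c"
proof
  fix m assume "m \<in> x"
  obtain f where f: "coded_run r c f" "coded_oracle f = x" using coded_run_complete[OF assms] .
  have entry: "i < n \<Longrightarrow> entry (initial_segment f n) i = f i" for i n by (simp add: entry_def)
  have runs: "initial_segment f n \<in> partial_runs r c" for n
    using f(1) unfolding partial_runs_def coded_run_def by (simp add: entry)
  moreover have "entry (initial_segment f (Suc (oracle_at m))) (oracle_at m) \<noteq> 0"
    using \<open>m \<in> x\<close> f(2) unfolding coded_oracle_def by (auto simp: entry simp del: upt_Suc)
  ultimately show "m \<in> certified_oracle r c"
    using initial_segment_notin_wf_part[of f, OF runs] unfolding certified_oracle_def by blast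
qed

section \<open>Recognizable reals\<close>

locale recognizer =
  fixes r :: nat and x :: "nat set"
  assumes recognizes: "halts_with (P r) z {} (delta z x)"
begin

definition halting_time :: "nat set \<Rightarrow> time" where
  "halting_time z = (LEAST t. st (config (P r) z {} t) = 1)"

lemma halts_at_halting_time: "halts_at (P r) z {} (halting_time z)"
  and tout_halting_time: "tout (config (P r) z {} (halting_time z)) 0 \<longleftrightarrow> z = x"
proof -
  obtain t where t: "halts_at (P r) z {} t" "{n. tout (config (P r) z {} t) n} = delta z x"
    using recognizes[of z] unfolding halts_with_iff by blast
  then have "halting_time z = t"
    unfolding halting_time_def halts_at_def by (intro Least_equality) (auto simp: not_less[symmetric])
  then show "halts_at (P r) z {} (halting_time z)" "tout (config (P r) z {} (halting_time z)) 0 \<longleftrightarrow> z = x"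
    using t by (auto simp: delta_def split: if_splits)
qed

lemma accepted_oracle_eq:
  assumes "halts_with (P r) z {} w" "0 \<in> w"
  shows "z = x"
  using halts_with_unique[OF assms(1) recognizes] assms(2) by (simp add: delta_def split: if_splits)

lemma universal_run_simulates:
  "in_state (iterate universal_step (on_track 1 z) t) e q \<longleftrightarrow> q = st (config (P e) z {} t)"
  "pair e (pair k n) \<in> track 4 (iterate universal_step (on_track 1 z) t) \<longleftrightarrow>
    tape_cell (config (P e) z {} t) k n"
  using universal_step_simulates_all[of z t] unfolding simulates_all_def by blast+

lemma Least_halted: "(LEAST t. in_state (iterate universal_step (on_track 1 z) t) r 1) = halting_time z"
  unfolding universal_run_simulates halting_time_def by (simp only: eq_commute[of "1 :: nat"])

lemma ex_halted: "\<exists>t. in_state (iterate universal_step (on_track 1 z) t) r 1"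
  using halts_at_halting_time[of z] unfolding universal_run_simulates halts_at_def by metis

lemma decidable_eq_recognized: "decidable (\<lambda>z n. z = x)"
proof -
  have "computable (\<lambda>z. iterate universal_step (on_track 1 z) (halting_time z))"
    unfolding Least_halted[symmetric]
    by (rule computable_while)
       (intro computable_universal_step decidable_in_state computable_rules prim_rec_rules ex_halted)+
  from computable_track[OF this, of 4]
  have "decidable (\<lambda>z n.
      pair r (pair 2 0) \<in> track 4 (iterate universal_step (on_track 1 z) (halting_time z)))"
    by (intro decidable_mem prim_rec_rules)
  then show ?thesis using tout_halting_time unfolding universal_run_simulates
    by (simp add: tape_cell_def)
qed

lemma certified_oracle_eq:
  assumes "halting_time x < height c"
  shows "certified_oracle r c = x"
proof
  show "certified_oracle r c \<subseteq> x" using accepted_oracle_eq by (rule certified_oracle_subset)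
  show "x \<subseteq> certified_oracle r c"
    by (rule subset_certified_oracle[OF halts_at_halting_time _ assms]) (simp add: tout_halting_time)
qed

text \<open>If \<open>x\<close> is accepted early, it is certified along an ordinal that is shown at some time, and a machine can search
  for such a time because it can decide equality with \<open>x\<close>.\<close>

theorem computable_if_accepted_early:
  assumes "halting_time x < shown_limit"
  shows "ittm_computable x"
proof -
  define found where "found S = certified_oracle r (shown_bound S)" for S
  have found: "computable found" unfolding found_def
    by (intro computable_compose[OF computable_shown_bound] computable_certified_oracle)
  obtain t where "halting_time x < shown_height t" using less_shown_limitD[OF assms] by blast
  then have "found (universal_run t) = x" unfolding found_def shown_height_def
    by (rule certified_oracle_eq)
  then have ex: "\<exists>t. found (universal_run t) = x" by blast
  have "computable_on {{}} (\<lambda>X. iterate universal_step X (LEAST t. found (iterate universal_step X t) = x))"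
  proof (rule computable_while[OF computable_universal_step decidable_compose[OF decidable_eq_recognized found]])
    show "computable_on {{}} (\<lambda>X. X)" by (rule computable_on_subset[OF computable_ident]) simp
    show "\<exists>t. found (iterate universal_step X t) = x" if "X \<in> {{}}" for X using ex that by simp
  qed
  from computable_on_halts_with[OF computable_compose[OF this found]] obtain i
    where "halts_with (P i) {} {} (found (universal_run (LEAST t. found (universal_run t) = x)))"
      by blast
  then have "halts_with (P i) {} {} x" using LeastI_ex[OF ex] by simp
  then show ?thesis unfolding ittm_computable_def ittm_computable_from_def by blast
qed

theorem halting_set_computable_if_accepted_late:
  assumes "shown_limit \<le> halting_time x"
  shows "ittm_computable_from ittm_halting_set x"
proof -
  define G where "G S = on_track 1 (universal_step (track 1 S)) \<union> on_track 2 (universal_step (track 2 S))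
    \<union> on_track 3 (track 3 S \<union> {e. in_state (track 2 S) e 1})" for S
  let ?run = "\<lambda>y. iterate G (on_track 1 (on_track 1 y))"
  have in_state: "decidable (\<lambda>S e. in_state (track i S) (f e) 1)" if "prim_rec f" for i f
    by (rule decidable_compose[OF decidable_in_state[OF that prim_rec_const] computable_track[OF computable_ident]])
  have "computable G" unfolding G_def
    by (intro computable_rules computable_compose[OF _ computable_universal_step] computable_Collect in_state prim_rec_id)
  moreover have reader: "track 1 (?run y t) = iterate universal_step (on_track 1 y) t" for y t
    by (subst iterate_track[where G' = universal_step]) (simp_all add: G_def)
  have "computable (\<lambda>y. on_track 1 (on_track 1 y))" by (intro computable_rules)
  ultimately have "computable (\<lambda>y. ?run y (LEAST t. in_state (track 1 (?run y t)) r 1))"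
    by (rule computable_while[OF _ in_state[OF prim_rec_const]]) (use ex_halted reader in metis)
  then have "computable (\<lambda>y. track 3 (?run y (halting_time y)))" unfolding reader Least_halted
    by (rule computable_track)
  then obtain i where i: "halts_with (P i) x {} (track 3 (?run x (halting_time x)))"
    using computable_on_halts_with by blast
  have "track 3 (?run x t) = (\<Union>s<t. {e. in_state (universal_run s) e 1})" for t
  proof (rule increasing_union)
    have "track 2 (?run x s) = universal_run s" for s
      by (subst iterate_track[where G' = universal_step]) (simp_all add: G_def)
    then show "track 3 (?run x (succ s)) = track 3 (?run x s) \<union> {e. in_state (universal_run s) e 1}"
        for s
      by (simp add: G_def)
  qed (simp_all add: track_iterate_limit)
  moreover have "(\<Union>s<halting_time x. {e. in_state (universal_run s) e 1}) = ittm_halting_set"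
  proof -
    have "in_state (universal_run s) e 1 \<longleftrightarrow> st (config (P e) {} {} s) = 1" for s e
      using universal_run_simulates(1)[of "{}" s e 1] by auto
    moreover have "halts (P e) {} {} \<longleftrightarrow> (\<exists>s<halting_time x. st (config (P e) {} {} s) = 1)" for e
      unfolding halts_iff using halting_time_less_shown_limit assms less_le_trans by blast
    ultimately show ?thesis unfolding ittm_halting_set_def by auto
  qed
  ultimately show ?thesis using i unfolding ittm_computable_from_def by auto
qed

end

theorem mainTheorem7:
  fixes x :: "nat set"
  assumes "ittm_recognizable x"
  shows "ittm_computable x \<or> ittm_computable_from ittm_halting_set x"
proof -
  obtain r where "\<And>z. halts_with (P r) z {} (delta z x)"
    using assms unfolding ittm_recognizable_def by blast
  then interpret recognizer r x by unfold_locales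
  show ?thesis
  proof (cases "halting_time x < shown_limit")
    case True
    then show ?thesis using computable_if_accepted_early by blast
  next
    case False
    then show ?thesis using halting_set_computable_if_accepted_late by simp
  qed
qed

end
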